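(* Let $\mathbb{F}$ be a field (of arbitrary characteristic) equipped with a non-identity involution $x\mapsto x^\bullet$. Let $b$ be a non-degenerate Hermitian form on a finite-dimensional vector space $V$ over $\mathbb{F}$, and let $u$ be a nilpotent $b$-selfadjoint endomorphism of $V$. The following conditions are equivalent: (i) $u$ is the sum of two square-zero $b$-selfadjoint endomorphisms of $V$; (ii) for every integer $k\ge0$, the Hermitian form $(b,u)_{t,2k+1}$ Witt-simplifies $\underset{i>k}{\bot}\,(b,u)_{t,2i+1}$.
   Context: Here an involution is a field automorphism of order $2$. Hermitian forms are linear in the right variable and semilinear in the left one, with $b(y,x)=b(x,y)^\bullet$. $u$ is $b$-selfadjoint if $b(u(x),y)=b(x,u(y))$ for all $x,y$. For $k\ge1$, $(b,u)_{t,k}$ is the non-degenerate Hermitian form over $\mathbb{F}$ induced by $(x,y)\mapsto b(x,u^{k-1}(y))$ on the quotient space $\mathrm{Ker}\,u^k/\bigl(\mathrm{Ker}\,u^{k-1}+(\mathrm{Ker}\,u^k\cap\mathrm{Im}\,u)\bigr)$. For a non-degenerate Hermitian form $H$, $\nu(H)$ (Witt index) is the greatest dimension of a totally $H$-isotropic subspace, $\mathrm{rk}(H)$ is the dimension of its space, and $H$ is the orthogonal sum of a hyperbolic form of rank $2\nu(H)$ and of a nonisotropic form, unique up to equivalence, called a nonisotropic part of $H$. For non-degenerate Hermitian forms $H,H'$ over $\mathbb{F}$, $H$ Witt-simplifies $H'$ if each nonisotropic part of $H'$ is equivalent to a subform of $-H$ (restriction of $-H$ to a linear subspace); equivalently $\nu(H')+\nu(H'\bot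 H)\ge\mathrm{rk}(H')$. *)

theory Defs
  imports "Jordan_Normal_Form.VS_Connect" "HOL-Algebra.AbelCoset"
begin

text \<open>
  Vector spaces over a field \<open>'f\<close> are carrier-based: \<open>vectorspace class_ring V\<close>. The fields
  \<open>mult\<close> and \<open>one\<close> that the record \<open>module\<close> inherits from \<open>ring\<close> are never used.
  Restricting a form to a linear subspace \<open>W\<close> is the record update \<open>H\<lparr>carrier := W\<rparr>\<close>.
\<close>

record ('f, 'v) form_space = "('f, 'v) module" +
  form :: "'v \<Rightarrow> 'v \<Rightarrow> 'f"

definition field_involution :: "('f::field \<Rightarrow> 'f) \<Rightarrow> bool" where
  "field_involution \<sigma> \<longleftrightarrow>
     bij \<sigma> \<and> \<sigma> 1 = 1 \<and>
     (\<forall>a b. \<sigma> (a + b) = \<sigma> a + \<sigma> b) \<and> (\<forall>a b. \<sigma> (a * b) = \<sigma> a * \<sigma> b) \<and>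
     \<sigma> \<circ> \<sigma> = id \<and> \<sigma> \<noteq> id"

definition hermitian :: "('f::field \<Rightarrow> 'f) \<Rightarrow> ('f, 'v) form_space \<Rightarrow> bool" where
  "hermitian \<sigma> H \<longleftrightarrow>
     vectorspace class_ring H \<and>
     (\<forall>x\<in>carrier H. \<forall>y\<in>carrier H. \<forall>z\<in>carrier H. form H x (y \<oplus>\<^bsub>H\<^esub> z) = form H x y + form H x z) \<and>
     (\<forall>x\<in>carrier H. \<forall>y\<in>carrier H. \<forall>z\<in>carrier H. form H (x \<oplus>\<^bsub>H\<^esub> y) z = form H x z + form H y z) \<and>
     (\<forall>a. \<forall>x\<in>carrier H. \<forall>y\<in>carrier H. form H x (a \<odot>\<^bsub>H\<^esub> y) = a * form H x y) \<and>
     (\<forall>a. \<forall>x\<in>carrier H. \<forall>y\<in>carrier H. form H (a \<odot>\<^bsub>H\<^esub> x) y = \<sigma> a * form H x y) \<and>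
     (\<forall>x\<in>carrier H. \<forall>y\<in>carrier H. form H y x = \<sigma> (form H x y))"

definition nondegenerate :: "('f::field, 'v) form_space \<Rightarrow> bool" where
  "nondegenerate H \<longleftrightarrow>
     (\<forall>x\<in>carrier H. (\<forall>y\<in>carrier H. form H x y = 0) \<longrightarrow> x = \<zero>\<^bsub>H\<^esub>)"

definition selfadjoint :: "('f::field, 'v) form_space \<Rightarrow> ('v \<Rightarrow> 'v) \<Rightarrow> bool" where
  "selfadjoint H u \<longleftrightarrow>
     u \<in> LinearCombinations.module_hom class_ring H H \<and>
     (\<forall>x\<in>carrier H. \<forall>y\<in>carrier H. form H (u x) y = form H x (u y))"

definition nilpotent_on :: "('f::field, 'v) form_space \<Rightarrow> ('v \<Rightarrow> 'v) \<Rightarrow> bool" where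
  "nilpotent_on H u \<longleftrightarrow> (\<exists>n. \<forall>x\<in>carrier H. (u ^^ n) x = \<zero>\<^bsub>H\<^esub>)"

definition square_zero_on :: "('f::field, 'v) form_space \<Rightarrow> ('v \<Rightarrow> 'v) \<Rightarrow> bool" where
  "square_zero_on H u \<longleftrightarrow> (\<forall>x\<in>carrier H. u (u x) = \<zero>\<^bsub>H\<^esub>)"


text \<open>
  The quotient of \<open>H\<close> by a subspace \<open>N\<close> lying in the radical of the form. The value on a pair of
  cosets is the common value at all pairs of representatives.
\<close>

definition quotient_form :: "('f::field, 'v) form_space \<Rightarrow> 'v set \<Rightarrow> ('f, 'v set) form_space" where
  "quotient_form H N =
     \<lparr>carrier = a_rcosets\<^bsub>H\<^esub> N, mult = (\<lambda>_ _. N), one = N, zero = N, add = set_add H,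
      smult = (\<lambda>a X. \<Union>x\<in>X. N +>\<^bsub>H\<^esub> (a \<odot>\<^bsub>H\<^esub> x)),
      form = (\<lambda>X Y. THE c. \<forall>x\<in>X. \<forall>y\<in>Y. form H x y = c)\<rparr>"

text \<open>
  \<open>t_form V u k\<close> is $(b,u)_{t,k}$, where \<open>b = form V\<close>; it is meant for \<open>k \<ge> 1\<close> only.
  Here \<open>a_kernel V V (u ^^ k)\<close> is the kernel of $u^k$.
\<close>

definition t_form ::
  "('f::field, 'v) form_space \<Rightarrow> ('v \<Rightarrow> 'v) \<Rightarrow> nat \<Rightarrow> ('f, 'v set) form_space" where
  "t_form V u k =
     quotient_form
       (V\<lparr>carrier := a_kernel V V (u ^^ k), form := (\<lambda>x y. form V x ((u ^^ (k - 1)) y))\<rparr>)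
       (a_kernel V V (u ^^ (k - 1)) <+>\<^bsub>V\<^esub> (a_kernel V V (u ^^ k) \<inter> u ` carrier V))"

text \<open>
  External orthogonal direct sum: finitely supported families, extended by \<open>undefined\<close> outside the
  index set.
\<close>

definition orth_sum :: "'i set \<Rightarrow> ('i \<Rightarrow> ('f::field, 'v) form_space) \<Rightarrow> ('f, 'i \<Rightarrow> 'v) form_space" where
  "orth_sum I H =
     \<lparr>carrier = {f \<in> (\<Pi>\<^sub>E i\<in>I. carrier (H i)). finite {i\<in>I. f i \<noteq> \<zero>\<^bsub>H i\<^esub>}},
      mult = (\<lambda>_ _. \<lambda>i\<in>I. \<zero>\<^bsub>H i\<^esub>), one = (\<lambda>i\<in>I. \<zero>\<^bsub>H i\<^esub>), zero = (\<lambda>i\<in>I. \<zero>\<^bsub>H i\<^esub>),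
      add = (\<lambda>f g. \<lambda>i\<in>I. f i \<oplus>\<^bsub>H i\<^esub> g i),
      smult = (\<lambda>a f. \<lambda>i\<in>I. a \<odot>\<^bsub>H i\<^esub> f i),
      form = (\<lambda>f g. \<Sum>i | i \<in> I \<and> f i \<noteq> \<zero>\<^bsub>H i\<^esub> \<and> g i \<noteq> \<zero>\<^bsub>H i\<^esub>. form (H i) (f i) (g i))\<rparr>"

definition isometric :: "('f::field, 'v) form_space \<Rightarrow> ('f, 'w) form_space \<Rightarrow> bool" where
  "isometric H K \<longleftrightarrow>
     (\<exists>\<phi>. \<phi> \<in> LinearCombinations.module_hom class_ring H K \<and> bij_betw \<phi> (carrier H) (carrier K) \<and>
          (\<forall>x\<in>carrier H. \<forall>y\<in>carrier H. form K (\<phi> x) (\<phi> y) = form H x y))"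

definition neg_form :: "('f::field, 'v) form_space \<Rightarrow> ('f, 'v) form_space" where
  "neg_form H = H\<lparr>form := (\<lambda>x y. - form H x y)\<rparr>"

abbreviation rk :: "('f::field, 'v) form_space \<Rightarrow> nat" where
  "rk H \<equiv> vectorspace.dim class_ring H"

definition totally_isotropic :: "('f::field, 'v) form_space \<Rightarrow> 'v set \<Rightarrow> bool" where
  "totally_isotropic H W \<longleftrightarrow>
     subspace class_ring W H \<and> (\<forall>x\<in>W. \<forall>y\<in>W. form H x y = 0)"

definition witt_index :: "('f::field, 'v) form_space \<Rightarrow> nat" where
  "witt_index H = (GREATEST n. \<exists>W. totally_isotropic H W \<and> rk (H\<lparr>carrier := W\<rparr>) = n)"

definition nonisotropic :: "('f::field, 'v) form_space \<Rightarrow> bool" where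
  "nonisotropic H \<longleftrightarrow> (\<forall>x\<in>carrier H. form H x x = 0 \<longrightarrow> x = \<zero>\<^bsub>H\<^esub>)"

text \<open>
  A form is hyperbolic if it is non-degenerate and its space splits as $L \oplus M$ with \<open>L\<close> and
  \<open>M\<close> totally isotropic; \<open>M\<close> is then dual to \<open>L\<close> through the form, and dual bases exhibit the
  form as an orthogonal sum of hyperbolic planes.
\<close>

definition hyperbolic :: "('f::field, 'v) form_space \<Rightarrow> bool" where
  "hyperbolic H \<longleftrightarrow>
     nondegenerate H \<and>
     (\<exists>L M. totally_isotropic H L \<and> totally_isotropic H M \<and>
            L \<inter> M = {\<zero>\<^bsub>H\<^esub>} \<and> L <+>\<^bsub>H\<^esub> M = carrier H)"

text \<open>
  Nonisotropic parts are realised inside \<open>H\<close>: if \<open>H\<close> is equivalent to an external orthogonal sum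
  of a hyperbolic form and a nonisotropic form, the images of the two summands are such \<open>U\<close>, \<open>W\<close>.
\<close>

definition nonisotropic_part :: "('f::field, 'v) form_space \<Rightarrow> 'v set \<Rightarrow> bool" where
  "nonisotropic_part H W \<longleftrightarrow>
     subspace class_ring W H \<and> nonisotropic (H\<lparr>carrier := W\<rparr>) \<and>
     (\<exists>U. subspace class_ring U H \<and> hyperbolic (H\<lparr>carrier := U\<rparr>) \<and>
          rk (H\<lparr>carrier := U\<rparr>) = 2 * witt_index H \<and>
          (\<forall>x\<in>U. \<forall>y\<in>W. form H x y = 0) \<and>
          U \<inter> W = {\<zero>\<^bsub>H\<^esub>} \<and> U <+>\<^bsub>H\<^esub> W = carrier H)"

definition witt_simplifies ::
  "('f::field, 'v) form_space \<Rightarrow> ('f, 'w) form_space \<Rightarrow> bool" where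
  "witt_simplifies H H' \<longleftrightarrow>
     (\<forall>W. nonisotropic_part H' W \<longrightarrow>
        (\<exists>Z. subspace class_ring Z (neg_form H) \<and>
             isometric (H'\<lparr>carrier := W\<rparr>) ((neg_form H)\<lparr>carrier := Z\<rparr>)))"

end

theory Submission
  imports Defs "HOL-Library.Function_Algebras"
begin

text \<open>
  The space is an orthogonal sum of the $u$-orbits of subspaces $E_n \subseteq \mathrm{Ker}\,u^n$, where
  $E_n$ carries $(b,u)_{t,n}$. Put $F_k = \sum_{i \ge k} u^{i-k}(E_{2i+1})$: with the form
  $b(x, u^{2k} y)$ it is the orthogonal sum of the $(b,u)_{t,2i+1}$, $i \ge k$. Hence (ii) says that for
  each $k$ a nonisotropic part of $F_{k+1}$ embeds into $E_{2k+1}$ with the sign of the form reversed.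

  Given these embeddings, $u$ splits on the orbits of the $E_{2i}$, on the orbits of a pair of dual
  isotropic subspaces of $E_{2i+1}$, and on the orbit of $A + \theta(A)$ for a nonisotropic
  $A \subseteq E_{2k+3}$ and an embedding $\theta$ of $A$ into $E_{2k+1}$ reversing the sign; descending
  from the largest $k$, cells of these three shapes and a subspace of $E_1$, where $u = 0$, exhaust the space.

  Conversely, let $u = v + w$ with $v^2 = w^2 = 0$, so that $u^2 = wv + vw$ commutes with $v$ and $w$. Let $L$
  be isotropic for $b(x, u^{2k+2} y)$, with $L^\perp/L$ a nonisotropic part of $F_{k+1}$. A double
  orthogonality argument yields, for $x \in L^\perp$, some $x' \in L^\perp$ and $l \in L$ with
  $u^{2k}(wv x + vw x') = u^{2k+2} l$, and $j(x) = v x + w x' - u l$ lies in $\mathrm{Ker}\,u^{2k+1}$ and satisfies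
  $b(j x, u^{2k} j y) = - b(x, u^{2k+2} y)$.

  Some $c$ with $c + c^\bullet = 1$ exists since the involution is not the identity; it replaces $1/2$ and makes
  the argument independent of the characteristic.
\<close>

section \<open>Hermitian forms\<close>

text \<open>Each step of the descent has to return the kind of data it received. At level 2k the
  vectors u a + \<theta>(a), with a in A, are isotropic: the value of a under b(x, u^(2k+2) y) is
  cancelled by that of \<theta>(a). So A and its image drop out together, and a nonisotropic part A'
  of the orthogonal of \<theta>(A) in E_{2k+1} is a nonisotropic part of F_k. As nonisotropic parts
  are unique up to equivalence, the next embedding can be moved to A'.

  In the converse the obstacle is that v and w ignore the normal form; they are therefore tested on
  the whole space modulo an isotropic subspace. The map v alone is useless: it commutes with u^2, so
  b(v x, u^(2k) v y) = b(x, u^(2k) v^2 y) = 0, and likewise for w. Only the cross terms between v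
  and w contribute to the values of j. The equation for x' makes wv x and - vw x' agree at level 2k
  modulo u^(2k+2) L, which is orthogonal to all vectors considered; this turns the cross terms into
  - b(x, u^(2k) (wv + vw) y). The term u l only moves j(x) into the kernel and leaves the values
  unchanged.\<close>

locale hermitian_space = vector_space scale
  for scale :: "'f::field \<Rightarrow> 'b::ab_group_add \<Rightarrow> 'b" (infixr "*s" 75) +
  fixes \<sigma> :: "'f \<Rightarrow> 'f" and q :: "'b \<Rightarrow> 'b \<Rightarrow> 'f"
  assumes inv: "field_involution \<sigma>"
    and q_add_left: "q (x + y) z = q x z + q y z"
    and q_scale_left: "q (a *s x) z = \<sigma> a * q x z"
    and q_swap: "q y x = \<sigma> (q x y)"
begin

lemma \<sigma>_add: "\<sigma> (a + b) = \<sigma> a + \<sigma> b"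
  and \<sigma>_mult: "\<sigma> (a * b) = \<sigma> a * \<sigma> b"
  and \<sigma>_1 [simp]: "\<sigma> 1 = 1"
  and \<sigma>_\<sigma> [simp]: "\<sigma> (\<sigma> a) = a"
  using inv by (auto simp: field_involution_def fun_eq_iff)

lemma \<sigma>_0 [simp]: "\<sigma> 0 = 0"
  by (metis \<sigma>_add add_cancel_right_right)

lemma \<sigma>_minus: "\<sigma> (- a) = - \<sigma> a"
  using \<sigma>_add[of a "- a"] by (simp add: eq_neg_iff_add_eq_0 add.commute)

lemma \<sigma>_eq_0_iff [simp]: "\<sigma> a = 0 \<longleftrightarrow> a = 0"
  by (metis \<sigma>_0 \<sigma>_\<sigma>)

lemma \<sigma>_divide: "\<sigma> (a / b) = \<sigma> a / \<sigma> b"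
proof (cases "b = 0")
  case False
  then have "\<sigma> (a / b) * \<sigma> b = \<sigma> a" by (simp flip: \<sigma>_mult)
  with False show ?thesis by (simp add: field_simps)
qed simp

text \<open>If the trace \<open>t + \<sigma> t\<close> vanished identically, t = 1 would force
  characteristic 2, and then \<open>\<sigma> t = - t = t\<close> for all t. A nonzero trace s is
  fixed by \<sigma>, hence t / s has trace 1.\<close>

lemma trace_one: obtains c where "c + \<sigma> c = 1"
proof -
  have "\<exists>t. t + \<sigma> t \<noteq> 0"
  proof (rule ccontr)
    assume "\<not> ?thesis"
    then have t: "t + \<sigma> t = 0" for t by auto
    from t[of 1] have "(1::'f) + 1 = 0" by simp
    then have "x + x = 0" for x :: 'f
      by (metis distrib_left mult_1_right mult_zero_right)
    with t have "\<sigma> x = x" for x by (metis add_left_cancel)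
    with inv show False by (auto simp: field_involution_def fun_eq_iff)
  qed
  then obtain t where t: "t + \<sigma> t \<noteq> 0" by auto
  define s where "s = t + \<sigma> t"
  have "\<sigma> s = s" by (simp add: s_def \<sigma>_add add.commute)
  moreover have "s \<noteq> 0" using t by (simp add: s_def)
  ultimately have "t / s + \<sigma> (t / s) = 1"
    by (simp add: \<sigma>_divide add_divide_distrib[symmetric] s_def[symmetric])
  then show thesis by (rule that)
qed

lemma q_add_right: "q z (x + y) = q z x + q z y"
  using q_add_left[of x y z] q_swap \<sigma>_add by metis

lemma q_scale_right: "q z (a *s x) = a * q z x"
proof -
  have "q z (a *s x) = \<sigma> (\<sigma> a * q x z)" by (subst q_swap) (simp only: q_scale_left)
  also have "\<dots> = a * q z x" by (simp only: \<sigma>_mult \<sigma>_\<sigma> q_swap[of z x])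
  finally show ?thesis .
qed

lemma q_0_left [simp]: "q 0 z = 0" using q_scale_left[of 0 0 z] by simp
lemma q_0_right [simp]: "q z 0 = 0" using q_scale_right[of z 0 0] by simp
lemma q_minus_left: "q (- x) z = - q x z"
  using q_add_left[of x "- x" z] by (simp add: eq_neg_iff_add_eq_0 add.commute)
lemma q_minus_right: "q z (- x) = - q z x"
  using q_add_right[of z x "- x"] by (simp add: eq_neg_iff_add_eq_0 add.commute)
lemma q_diff_left: "q (x - y) z = q x z - q y z"
  using q_add_left[of x "- y" z] by (simp add: q_minus_left)
lemma q_diff_right: "q z (x - y) = q z x - q z y"
  using q_add_right[of z x "- y"] by (simp add: q_minus_right)
lemma q_swap_0: "q x y = 0 \<longleftrightarrow> q y x = 0"
  using q_swap[of x y] q_swap[of y x] by auto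

lemmas q_simps = q_add_left q_add_right q_scale_left q_scale_right q_minus_left q_minus_right
  q_diff_left q_diff_right

lemma subspace_perp: "subspace F \<Longrightarrow> subspace {x \<in> F. \<forall>s\<in>S. q s x = 0}"
  by (auto simp: subspace_def q_simps)

lemma perp_span: "(\<And>s. s \<in> S \<Longrightarrow> q s x = 0) \<Longrightarrow> s \<in> span S \<Longrightarrow> q s x = 0"
proof -
  assume *: "\<And>s. s \<in> S \<Longrightarrow> q s x = 0" and s: "s \<in> span S"
  have "subspace {s. q s x = 0}" by (auto simp: subspace_def q_simps)
  from span_induct[OF s this] * show ?thesis by blast
qed

lemma isotropic_span:
  assumes "\<And>x y. x \<in> S \<Longrightarrow> y \<in> S \<Longrightarrow> q x y = 0" "x \<in> span S" "y \<in> span S"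
  shows "q x y = 0"
proof (rule perp_span[OF _ assms(2)])
  fix s assume "s \<in> S"
  then have "q y s = 0" using assms(1,3) perp_span by blast
  then show "q s y = 0" using q_swap_0 by blast
qed

section \<open>Finite-dimensional subspaces, nondegeneracy and double orthogonality\<close>

definition fin_sp :: "'b set \<Rightarrow> bool" where
  "fin_sp S \<longleftrightarrow> (\<exists>B. finite B \<and> S = span B)"

lemma fin_sp_subspace: "fin_sp S \<Longrightarrow> subspace S"
  by (auto simp: fin_sp_def)

lemma fin_sp_basis:
  assumes "fin_sp S" "subspace T" "T \<subseteq> S"
  obtains B where "finite B" "independent B" "T = span B" "B \<subseteq> T"
proof -
  obtain C where C: "finite C" "S = span C" using assms by (auto simp: fin_sp_def)
  obtain B where B: "B \<subseteq> T" "independent B" "T \<subseteq> span B"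
    using maximal_independent_subset[of T] by blast
  have "finite B" using independent_span_bound[OF C(1) B(2)] B assms C by blast
  moreover have "span B = T" using B assms(2) by (simp add: span_minimal subset_antisym)
  ultimately show thesis using that B by auto
qed

lemma fin_sp_mono: "fin_sp S \<Longrightarrow> subspace T \<Longrightarrow> T \<subseteq> S \<Longrightarrow> fin_sp T"
  using fin_sp_basis fin_sp_def by metis

definition nondeg :: "'b set \<Rightarrow> bool" where
  "nondeg S \<longleftrightarrow> (\<forall>x\<in>S. (\<forall>y\<in>S. q y x = 0) \<longrightarrow> x = 0)"

text \<open>Polarization without 1/2: for isotropic x and y, the vector
  \<open>x + (c / q x y) *s y\<close> has norm \<open>c + \<sigma> c = 1\<close>.\<close>

lemma nonisotropic_vector:
  assumes "subspace S" "x \<in> S" "y \<in> S" "q x y \<noteq> 0"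
  obtains z where "z \<in> S" "q z z \<noteq> 0"
proof (cases "q x x = 0 \<and> q y y = 0")
  case True
  obtain c where c: "c + \<sigma> c = 1" using trace_one by blast
  define z where "z = x + (c / q x y) *s y"
  have "q z z = c + \<sigma> (c / q x y) * \<sigma> (q x y)"
    using True assms(4) by (simp add: z_def q_simps q_swap[of x y])
  also have "\<dots> = 1" using assms(4) c by (simp flip: \<sigma>_mult)
  finally show thesis using that[of z] assms by (auto simp: z_def subspace_add subspace_scale)
qed (use assms that in blast)

text \<open>A functional that vanishes wherever finitely many others do is a combination of them.
  The domain D is kept apart from S because the uses differ: D is the ambient X in
  \<open>double_perp\<close>, S itself in \<open>nondeg_split\<close>, and a second isotropic space
  in \<open>aniso_reduction_unique\<close>.\<close>

lemma represent_functional: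
  assumes "fin_sp S" "subspace D"
    and "\<And>y. y \<in> D \<Longrightarrow> (\<forall>s\<in>S. q y s = 0) \<Longrightarrow> q y t = 0"
  obtains s where "s \<in> S" "\<And>y. y \<in> D \<Longrightarrow> q y t = q y s"
proof -
  obtain B where "finite B" "S = span B" using assms(1) by (auto simp: fin_sp_def)
  have "\<exists>s\<in>span B. \<forall>y\<in>D. q y t = q y s"
    using \<open>finite B\<close> assms(2) assms(3)[unfolded \<open>S = span B\<close>]
  proof (induction B arbitrary: D)
    case empty
    then show ?case by (intro bexI[of _ 0]) auto
  next
    case (insert s B)
    define D0 where "D0 = {y\<in>D. q y s = 0}"
    have "subspace D0" using insert.prems(1) by (auto simp: D0_def subspace_def q_simps)
    moreover have "q y t = 0" if "y \<in> D0" "\<forall>s\<in>span B. q y s = 0" for y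
    proof -
      have "q y r = 0" if "r \<in> span (insert s B)" for r
      proof -
        have "q r y = 0"
        proof (rule perp_span[OF _ \<open>r \<in> _\<close>])
          fix z assume "z \<in> insert s B"
          then have "q y z = 0"
            using \<open>y \<in> D0\<close> \<open>\<forall>s\<in>span B. q y s = 0\<close> by (auto simp: D0_def span_base)
          then show "q z y = 0" using q_swap_0 by blast
        qed
        then show ?thesis using q_swap_0 by blast
      qed
      then show ?thesis using insert.prems(2) \<open>y \<in> D0\<close> by (auto simp: D0_def)
    qed
    ultimately obtain s0 where s0: "s0 \<in> span B" "\<And>y. y \<in> D0 \<Longrightarrow> q y t = q y s0"
      using insert.IH[of D0] by blast
    have s0': "s0 \<in> span (insert s B)" using s0(1) span_mono[of B "insert s B"] by auto
    show ?case
    proof (cases "\<forall>y\<in>D. q y s = 0")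
      case True
      then show ?thesis using s0 s0' by (auto simp: D0_def)
    next
      case False
      then obtain y1 where y1: "y1 \<in> D" "q y1 s \<noteq> 0" by auto
      \<comment> \<open>D0 is a hyperplane of D, so only the value at one y1 outside it is left to
        adjust. A multiple of s does this without disturbing D0, which is orthogonal to s.\<close>
      define l where "l = (q y1 t - q y1 s0) / q y1 s"
      have "q y t = q y (s0 + l *s s)" if "y \<in> D" for y
      proof -
        define r where "r = q y s / q y1 s"
        have "y - \<sigma> r *s y1 \<in> D0"
          using that y1 insert.prems(1)
          by (simp add: D0_def q_simps r_def subspace_diff subspace_scale)
        from s0(2)[OF this] have "q y t = q y s0 + r * (q y1 t - q y1 s0)"
          by (simp add: q_simps algebra_simps)
        also have "r * (q y1 t - q y1 s0) = l * q y s" by (simp add: r_def l_def)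
        finally show ?thesis by (simp add: q_simps)
      qed
      moreover have "s0 + l *s s \<in> span (insert s B)"
        using s0' by (simp add: span_add span_scale span_base)
      ultimately show ?thesis by blast
    qed
  qed
  then show thesis using that \<open>S = span B\<close> by blast
qed

text \<open>On X the functional of x is that of some s in S by \<open>represent_functional\<close>;
  then x - s lies in the radical of X.\<close>

lemma double_perp:
  assumes "fin_sp S" "S \<subseteq> X" "subspace X" "nondeg X" "x \<in> X"
    and "\<And>y. y \<in> X \<Longrightarrow> (\<forall>s\<in>S. q y s = 0) \<Longrightarrow> q y x = 0"
  shows "x \<in> S"
proof -
  obtain s where s: "s \<in> S" "\<And>y. y \<in> X \<Longrightarrow> q y x = q y s"
    using represent_functional[OF assms(1,3,6)] by blast
  have "x - s \<in> X" using s(1) assms by (auto simp: subspace_diff)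
  moreover have "\<forall>y\<in>X. q y (x - s) = 0" using s(2) by (auto simp: q_simps)
  ultimately have "x - s = 0" using assms(4) unfolding nondeg_def by blast
  then show ?thesis using s by simp
qed

lemma nondeg_split:
  assumes "fin_sp U" "nondeg U"
  obtains y where "y \<in> U" "\<And>u. u \<in> U \<Longrightarrow> q u (x - y) = 0"
proof -
  obtain y where "y \<in> U" "\<And>u. u \<in> U \<Longrightarrow> q u x = q u y"
  proof (rule represent_functional[OF assms(1) fin_sp_subspace[OF assms(1)], of x])
    fix y assume "y \<in> U" "\<forall>s\<in>U. q y s = 0"
    then have "y = 0" using assms(2) q_swap_0 unfolding nondeg_def by blast
    then show "q y x = 0" by simp
  qed blast
  then show thesis using that by (auto simp: q_simps)
qed

lemma nondeg_perp:
  assumes "fin_sp U" "nondeg U" "U \<subseteq> F" "subspace F" "nondeg F"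
  shows "nondeg {x\<in>F. \<forall>u\<in>U. q u x = 0}"
  unfolding nondeg_def
proof (intro ballI impI, goal_cases)
  case (1 x)
  have "q y x = 0" if "y \<in> F" for y
  proof -
    obtain z where z: "z \<in> U" "\<And>u. u \<in> U \<Longrightarrow> q u (y - z) = 0"
      using nondeg_split[OF assms(1,2)] by blast
    then have "y - z \<in> {x\<in>F. \<forall>u\<in>U. q u x = 0}" using that assms by (auto simp: subspace_diff)
    then have "q (y - z) x = 0" using 1 by blast
    moreover have "q z x = 0" using 1 z by auto
    ultimately show ?thesis by (simp add: q_simps)
  qed
  then show ?case using 1 assms(5) by (auto simp: nondeg_def)
qed

text \<open>Hyperbolic planes are split off one at a time. A vector y dual to t and orthogonal to B
  spans a plane with t whose orthogonal in F is nondegenerate and still contains B; the induction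
  continues there, which is why F is generalized.\<close>

lemma hyperbolic_complement:
  assumes "finite B" "independent B" "\<And>x y. x \<in> B \<Longrightarrow> y \<in> B \<Longrightarrow> q x y = 0"
    "B \<subseteq> F" "fin_sp F" "nondeg F"
  shows "\<exists>C. finite C \<and> card C = card B \<and> B \<inter> C = {} \<and> independent (B \<union> C) \<and> C \<subseteq> F \<and>
     (\<forall>x\<in>C. \<forall>y\<in>C. q x y = 0) \<and> nondeg (span (B \<union> C))"
  using assms
proof (induction B arbitrary: F)
  case empty
  then show ?case by (intro exI[of _ "{}"]) (auto simp: nondeg_def)
next
  case (insert t B)
  have sF: "subspace F" using fin_sp_subspace insert.prems by blast
  have fB: "fin_sp (span B)" using insert.hyps by (auto simp: fin_sp_def)
  have tB: "t \<notin> span B" "independent B"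
    using insert.prems(1) insert.hyps by (auto simp: independent_insert)
  have BF: "span B \<subseteq> F" using insert.prems(3) sF by (simp add: span_minimal)
  \<comment> \<open>Since t is not in \<open>span B\<close>, double orthogonality yields a vector
    orthogonal to B but not to t.\<close>
  obtain y0 where y0: "y0 \<in> F" "\<forall>s\<in>span B. q y0 s = 0" "q y0 t \<noteq> 0"
    using double_perp[OF fB BF sF insert.prems(5), of t] tB insert.prems(3) by blast
  define y1 where "y1 = (1 / q t y0) *s y0"
  have ty0: "q t y0 \<noteq> 0" using y0 q_swap_0 by blast
  have y1: "y1 \<in> F" "q t y1 = 1" "\<And>s. s \<in> span B \<Longrightarrow> q s y1 = 0"
    using y0 ty0 sF q_swap_0[of _ y0] by (auto simp: y1_def q_simps subspace_scale)
  obtain c where c: "c + \<sigma> c = 1" using trace_one by blast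
  \<comment> \<open>Subtracting this multiple of t lowers the norm of y1 by the trace of
    \<open>c * q y1 y1\<close>. As \<open>q y1 y1\<close> is fixed by \<sigma>, that trace is
    \<open>q y1 y1\<close> itself, so y is isotropic; \<open>q t y = 1\<close> persists because t is
    isotropic.\<close>
  define y where "y = y1 - (c * q y1 y1) *s t"
  have tt: "q t t = 0" "\<And>s. s \<in> B \<Longrightarrow> q s t = 0" using insert.prems by auto
  have tB0: "q s t = 0" if "s \<in> span B" for s using perp_span[OF _ that] tt by blast
  have ty: "q t y = 1" using y1 tt by (simp add: y_def q_simps)
  have yt: "q y t = 1" using q_swap[of y t] ty by simp
  have yF: "y \<in> F" using y1 insert.prems sF by (auto simp: y_def subspace_diff subspace_scale)
  have y1t: "q y1 t = 1" using q_swap[of y1 t] y1 by simp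
  have yy: "q y y = 0"
  proof -
    have "q y y = q y1 y1 - c * q y1 y1 - \<sigma> c * \<sigma> (q y1 y1)"
      by (simp add: y_def q_simps y1 y1t tt \<sigma>_mult)
    also have "\<dots> = q y1 y1 * (1 - (c + \<sigma> c))"
      by (simp add: q_swap[of y1 y1, symmetric] algebra_simps)
    finally show ?thesis using c by simp
  qed
  have By: "q s y = 0" if "s \<in> span B" for s using y1(3)[OF that] tB0[OF that] by (simp add: y_def q_simps)
  define F1 where "F1 = {x\<in>F. \<forall>u\<in>span {t, y}. q u x = 0}"
  have spty: "u \<in> span {t, y} \<Longrightarrow> \<exists>a b. u = a *s t + b *s y" for u
    by (auto simp: span_insert span_singleton) (metis add.commute diff_add_cancel)
  have ndty: "nondeg (span {t, y})"
    unfolding nondeg_def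
  proof (intro ballI impI)
    fix x assume x: "x \<in> span {t, y}" "\<forall>u\<in>span {t, y}. q u x = 0"
    then obtain a b where ab: "x = a *s t + b *s y" using spty by blast
    have "q t x = 0" "q y x = 0" using x(2) by (simp_all add: span_base)
    then show "x = 0" using ty yt yy tt by (simp add: ab q_simps)
  qed
  have "nondeg F1" unfolding F1_def
    by (rule nondeg_perp) (use insert.prems yF sF ndty in \<open>auto simp: fin_sp_def span_minimal intro: exI[of _ "{t,y}"]\<close>)
  moreover have sF1: "subspace F1" unfolding F1_def by (rule subspace_perp[OF sF])
  moreover have "fin_sp F1" using fin_sp_mono[OF insert.prems(4) sF1] by (auto simp: F1_def)
  moreover have F1: "x \<in> F1 \<longleftrightarrow> x \<in> F \<and> q t x = 0 \<and> q y x = 0" for x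
    using perp_span[of "{t, y}" x] by (auto simp: F1_def span_base)
  have "B \<subseteq> F1"
    using insert.prems(2,3) By by (auto simp: F1 span_base q_swap_0[of y])
  ultimately obtain C where C: "finite C" "card C = card B" "B \<inter> C = {}" "independent (B \<union> C)"
    "C \<subseteq> F1" "\<forall>x\<in>C. \<forall>y\<in>C. q x y = 0" "nondeg (span (B \<union> C))"
    using insert.IH[of F1] tB(2) insert.prems(2) by blast
  have BCF1: "span (B \<union> C) \<subseteq> F1" using C(5) \<open>B \<subseteq> F1\<close> sF1 by (simp add: span_minimal)
  have y_nin: "y \<notin> span (B \<union> C)" using BCF1 F1 ty by auto
  have t_nin: "t \<notin> span (insert y (B \<union> C))"
  proof
    assume "t \<in> span (insert y (B \<union> C))"
    then have "q t y = 0" by (rule perp_span[rotated]) (use BCF1 F1 yy span_base q_swap_0 in blast)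
    with ty show False by simp
  qed
  have tC: "t \<notin> C" "y \<notin> B" "y \<notin> C" "t \<noteq> y"
    using t_nin y_nin by (auto simp: span_base)
  show ?case
  proof (intro exI[of _ "insert y C"] conjI)
    show "card (insert y C) = card (insert t B)" using C insert.hyps tC by simp
    show "insert t B \<inter> insert y C = {}" using C insert.hyps tC by auto
    have "independent (insert y (B \<union> C))" using y_nin C(4) by (rule independent_insertI)
    then have "independent (insert t (insert y (B \<union> C)))" using t_nin independent_insertI by blast
    then show "independent (insert t B \<union> insert y C)" by (simp add: insert_commute)
    show "insert y C \<subseteq> F" using yF C(5) F1 by auto
    show "\<forall>x\<in>insert y C. \<forall>z\<in>insert y C. q x z = 0" using C(5,6) yy F1 q_swap_0 by blast
    show "nondeg (span (insert t B \<union> insert y C))" unfolding nondeg_def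
    proof (intro ballI impI)
      fix x assume x: "x \<in> span (insert t B \<union> insert y C)"
        "\<forall>z\<in>span (insert t B \<union> insert y C). q z x = 0"
      have "insert t B \<union> insert y C = insert t (insert y (B \<union> C))" by auto
      then obtain a b where "x - a *s t - b *s y \<in> span (B \<union> C)"
        using x(1) by (auto simp: span_insert)
      then obtain x0 where x0: "x0 \<in> span (B \<union> C)" "x = x0 + a *s t + b *s y"
        by (metis diff_add_cancel add.assoc add.commute)
      have "q t x0 = 0" "q y x0 = 0" using x0(1) BCF1 F1 by auto
      moreover have "q t x = 0" "q y x = 0" using x(2) by (simp_all add: span_base)
      ultimately have "b = 0" "a = 0" using ty yt yy tt by (simp_all add: x0(2) q_simps)
      then have "x = x0" by (simp add: x0)
      moreover have "span (B \<union> C) \<subseteq> span (insert t B \<union> insert y C)" by (rule span_mono) auto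
      ultimately show "x = 0" using C(7) x(2) x0(1) unfolding nondeg_def by blast
    qed
  qed (use C in auto)
qed

text \<open>\<open>A\<close> represents the quotient of the orthogonal space of \<open>T\<close> by \<open>T\<close>. Unlike in a Witt
  decomposition, no isotropic complement dual to \<open>T\<close> is recorded.\<close>

definition aniso_reduction :: "'b set \<Rightarrow> 'b set \<Rightarrow> 'b set \<Rightarrow> bool" where
  "aniso_reduction F T A \<longleftrightarrow> subspace F \<and> subspace T \<and> subspace A \<and> T \<subseteq> F \<and> A \<subseteq> F \<and>
     (\<forall>x\<in>T. \<forall>y\<in>T. q x y = 0) \<and> (\<forall>t\<in>T. \<forall>a\<in>A. q t a = 0) \<and> (\<forall>a\<in>A. q a a = 0 \<longrightarrow> a = 0) \<and>
     (\<forall>x\<in>F. (\<forall>t\<in>T. q t x = 0) \<longrightarrow> (\<exists>t\<in>T. \<exists>a\<in>A. x = t + a))"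

lemma aniso_reductionD:
  assumes "aniso_reduction F T A"
  shows "subspace F" "subspace T" "subspace A" "T \<subseteq> F" "A \<subseteq> F"
    "\<And>x y. x \<in> T \<Longrightarrow> y \<in> T \<Longrightarrow> q x y = 0" "\<And>t a. t \<in> T \<Longrightarrow> a \<in> A \<Longrightarrow> q t a = 0"
    "\<And>t a. t \<in> T \<Longrightarrow> a \<in> A \<Longrightarrow> q a t = 0"
    "\<And>a. a \<in> A \<Longrightarrow> q a a = 0 \<Longrightarrow> a = 0"
    "\<And>x. x \<in> F \<Longrightarrow> (\<And>t. t \<in> T \<Longrightarrow> q t x = 0) \<Longrightarrow> \<exists>t\<in>T. \<exists>a\<in>A. x = t + a"
proof -
  show d: "subspace F" "subspace T" "subspace A" "T \<subseteq> F" "A \<subseteq> F"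
    "\<And>x y. x \<in> T \<Longrightarrow> y \<in> T \<Longrightarrow> q x y = 0" "\<And>t a. t \<in> T \<Longrightarrow> a \<in> A \<Longrightarrow> q t a = 0"
    "\<And>a. a \<in> A \<Longrightarrow> q a a = 0 \<Longrightarrow> a = 0"
    "\<And>x. x \<in> F \<Longrightarrow> (\<And>t. t \<in> T \<Longrightarrow> q t x = 0) \<Longrightarrow> \<exists>t\<in>T. \<exists>a\<in>A. x = t + a"
    using assms by (simp_all add: aniso_reduction_def)
  show "\<And>t a. t \<in> T \<Longrightarrow> a \<in> A \<Longrightarrow> q a t = 0" using d(7) q_swap_0 by blast
qed

text \<open>This replaces Witt cancellation: both A and A' represent the same form on different
  quotients. Each a is shifted by some t in T until it is orthogonal to T', and then read modulo T'
  in A'. The map h is only a choice function; linearity is restored by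
  \<open>linear_representative\<close>.\<close>

lemma aniso_reduction_unique:
  assumes "fin_sp F" "aniso_reduction F T A" "aniso_reduction F T' A'"
  obtains h where "\<And>a. a \<in> A \<Longrightarrow> h a \<in> A'" "\<And>a b. a \<in> A \<Longrightarrow> b \<in> A \<Longrightarrow> q (h a) (h b) = q a b"
proof -
  note d = aniso_reductionD[OF assms(2)] and d' = aniso_reductionD[OF assms(3)]
  have fT: "fin_sp T" using fin_sp_mono[OF assms(1) d(2,4)] .
  have ex: "\<exists>a'. a' \<in> A' \<and> (\<exists>t\<in>T. \<exists>t'\<in>T'. a + t = t' + a')" if a: "a \<in> A" for a
  proof -
    \<comment> \<open>Solvability: a vector y of T' orthogonal to T is t0 + a0 with
      \<open>q a0 a0 = q y y = 0\<close>, so a0 = 0 and y lies in T, hence y is orthogonal to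
      a.\<close>
    obtain t where t: "t \<in> T" "\<And>y. y \<in> T' \<Longrightarrow> q y (- a) = q y t"
    proof (rule represent_functional[OF fT d'(2), of "- a"])
      fix y assume y: "y \<in> T'" "\<forall>s\<in>T. q y s = 0"
      then have "q s y = 0" if "s \<in> T" for s using that q_swap_0 by blast
      then obtain t0 a0 where ta: "t0 \<in> T" "a0 \<in> A" "y = t0 + a0" using d(10)[of y] d'(4) y(1) by blast
      have "q y y = q a0 a0" using ta by (simp add: q_simps d)
      then have "a0 = 0" using d'(6)[OF y(1) y(1)] d(9)[OF ta(2)] by simp
      then show "q y (- a) = 0" using ta a by (simp add: q_simps d)
    qed blast
    have "q t' (a + t) = 0" if "t' \<in> T'" for t'
      by (simp add: q_add_right q_minus_right t(2)[OF that, symmetric])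
    moreover have "a + t \<in> F" using a t(1) d(4,5) by (intro subspace_add[OF d(1)]) auto
    ultimately obtain t' a' where "t' \<in> T'" "a' \<in> A'" "a + t = t' + a'" using d'(10)[of "a + t"] by blast
    then show ?thesis using t(1) by blast
  qed
  define h where "h a = (SOME a'. a' \<in> A' \<and> (\<exists>t\<in>T. \<exists>t'\<in>T'. a + t = t' + a'))" for a
  have h: "h a \<in> A'" "\<exists>t\<in>T. \<exists>t'\<in>T'. a + t = t' + h a" if "a \<in> A" for a
    using someI_ex[OF ex[OF that]] by (auto simp: h_def)
  have "q (h a) (h b) = q a b" if ab: "a \<in> A" "b \<in> A" for a b
  proof -
    obtain t t' where 1: "t \<in> T" "t' \<in> T'" "a + t = t' + h a" using h(2)[OF ab(1)] by auto
    obtain s s' where 2: "s \<in> T" "s' \<in> T'" "b + s = s' + h b" using h(2)[OF ab(2)] by auto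
    have "q a b = q (a + t) (b + s)" using 1(1,2) 2(1,2) ab by (simp add: q_simps d)
    also have "\<dots> = q (t' + h a) (s' + h b)" by (simp only: 1(3) 2(3))
    also have "\<dots> = q (h a) (h b)" using 1(1,2) 2(1,2) h(1) ab by (simp add: q_simps d')
    finally show ?thesis ..
  qed
  with h(1) show thesis by (rule that)
qed

text \<open>B is an independent isotropic set of maximal size, C a dual set, and A the orthogonal of
  both: a nonzero isotropic vector of A could be added to B. The bound on \<open>card D\<close> is
  kept in the conclusion because it identifies \<open>card B\<close> with the Witt index
  later.\<close>

lemma witt_decomposition:
  assumes "fin_sp F" "nondeg F"
  obtains B C A where "finite B" "finite C" "card C = card B" "B \<inter> C = {}" "independent (B \<union> C)"
    "B \<subseteq> F" "C \<subseteq> F" "\<And>x y. x \<in> span B \<Longrightarrow> y \<in> span B \<Longrightarrow> q x y = 0"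
    "\<And>x y. x \<in> span C \<Longrightarrow> y \<in> span C \<Longrightarrow> q x y = 0" "nondeg (span (B \<union> C))"
    "A = {x\<in>F. \<forall>y\<in>span (B \<union> C). q y x = 0}" "\<And>a. a \<in> A \<Longrightarrow> q a a = 0 \<Longrightarrow> a = 0"
    "\<And>x. x \<in> F \<Longrightarrow> \<exists>u\<in>span (B \<union> C). x - u \<in> A"
    "\<And>D. finite D \<Longrightarrow> independent D \<Longrightarrow> D \<subseteq> F \<Longrightarrow> (\<And>x y. x \<in> D \<Longrightarrow> y \<in> D \<Longrightarrow> q x y = 0) \<Longrightarrow> card D \<le> card B"
proof -
  define P where "P n \<longleftrightarrow> (\<exists>B. finite B \<and> independent B \<and> B \<subseteq> F \<and> (\<forall>x\<in>B. \<forall>y\<in>B. q x y = 0) \<and> card B = n)" for n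
  obtain G where G: "finite G" "F = span G" using assms(1) by (auto simp: fin_sp_def)
  have sF: "subspace F" using assms(1) fin_sp_subspace by blast
  have bound: "n \<le> card G" if "P n" for n
    using that G independent_span_bound[OF G(1)] by (auto simp: P_def)
  have "P 0" unfolding P_def by (intro exI[of _ "{}"]) (simp add: independent_empty)
  from GreatestI_nat[of P, OF this] bound have "P (Greatest P)" by blast
  then obtain B where B: "finite B" "independent B" "B \<subseteq> F" "\<forall>x\<in>B. \<forall>y\<in>B. q x y = 0" "card B = Greatest P"
    unfolding P_def[of "Greatest P"] by auto
  have max: "card D \<le> card B" if "finite D" "independent D" "D \<subseteq> F" "\<And>x y. x \<in> D \<Longrightarrow> y \<in> D \<Longrightarrow> q x y = 0" for D
    unfolding B(5) by (rule Greatest_le_nat[of P _ "card G"]) (use that bound in \<open>auto simp: P_def\<close>)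
  obtain C where C: "finite C" "card C = card B" "B \<inter> C = {}" "independent (B \<union> C)" "C \<subseteq> F"
     "\<forall>x\<in>C. \<forall>y\<in>C. q x y = 0" "nondeg (span (B \<union> C))"
    using hyperbolic_complement[OF B(1,2) _ B(3) assms] B(4) by blast
  define A where "A = {x\<in>F. \<forall>y\<in>span (B \<union> C). q y x = 0}"
  have fU: "fin_sp (span (B \<union> C))" using B C by (auto simp: fin_sp_def)
  have UF: "span (B \<union> C) \<subseteq> F" using B C sF by (simp add: span_minimal)
  have aniso: "a = 0" if a: "a \<in> A" "q a a = 0" for a
  proof (rule ccontr)
    assume "a \<noteq> 0"
    have "a \<notin> span B"
    proof
      assume "a \<in> span B"
      then have "a \<in> span (B \<union> C)" using span_mono[of B "B \<union> C"] by auto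
      with a(1) C(7) have "a = 0" by (auto simp: A_def nondeg_def)
      with \<open>a \<noteq> 0\<close> show False by simp
    qed
    moreover have "q x a = 0" "q a x = 0" if "x \<in> B" for x
      using a(1) that q_swap_0 by (auto simp: A_def span_base)
    ultimately have "card (insert a B) \<le> card B"
      using a B by (intro max) (auto simp: A_def independent_insert)
    moreover have "a \<notin> B" using \<open>a \<notin> span B\<close> span_base by blast
    ultimately show False using B(1) by simp
  qed
  have split: "\<exists>u\<in>span (B \<union> C). x - u \<in> A" if "x \<in> F" for x
  proof -
    obtain u where "u \<in> span (B \<union> C)" "\<And>y. y \<in> span (B \<union> C) \<Longrightarrow> q y (x - u) = 0"
      using nondeg_split[OF fU C(7)] by blast
    then show ?thesis using that UF sF by (intro bexI[of _ u]) (auto simp: A_def subspace_diff)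
  qed
  have iB: "q x y = 0" if "x \<in> span B" "y \<in> span B" for x y
    by (rule isotropic_span[OF _ that]) (use B(4) in blast)
  have iC: "q x y = 0" if "x \<in> span C" "y \<in> span C" for x y
    by (rule isotropic_span[OF _ that]) (use C(6) in blast)
  show thesis
    by (rule that[OF B(1) C(1-4) B(3) C(5) iB iC C(7) A_def aniso split max])
qed

end

section \<open>Normal form of a nilpotent selfadjoint operator\<close>

lemma (in hermitian_space) dim_less:
  assumes "fin_sp S" "subspace T" "T \<subseteq> S" "x \<in> S" "x \<notin> T"
  shows "dim T < dim S"
proof -
  obtain B where B: "finite B" "independent B" "S = span B"
    using fin_sp_basis[OF assms(1) fin_sp_subspace[OF assms(1)]] by blast
  obtain C where C: "finite C" "independent C" "T = span C" "C \<subseteq> T"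
    using fin_sp_basis[OF assms(1-3)] by blast
  have "independent (insert x C)" using C assms(5) by (simp add: independent_insertI)
  moreover have "insert x C \<subseteq> span B" using C B assms by auto
  ultimately have "card (insert x C) \<le> card B" using independent_span_bound[OF B(1)] by blast
  moreover have "x \<notin> C" using C assms(5) by auto
  ultimately show ?thesis using B C by (simp add: dim_eq_card_independent)
qed

section \<open>Powers of the operator and the Hermitian forms they induce\<close>

locale selfadjoint_operator = hermitian_space +
  fixes u :: "'b \<Rightarrow> 'b"
  assumes u_add: "u (x + y) = u x + u y"
    and u_scale: "u (a *s x) = a *s u x"
    and u_sa: "q (u x) y = q x (u y)"
begin

lemma up_add: "(u ^^ n) (x + y) = (u ^^ n) x + (u ^^ n) y"
  by (induction n) (simp_all add: u_add)

lemma up_scale: "(u ^^ n) (a *s x) = a *s (u ^^ n) x"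
  by (induction n) (simp_all add: u_scale)

lemma up_0 [simp]: "(u ^^ n) 0 = 0"
  using up_scale[of n 0 0] by simp

lemma up_minus: "(u ^^ n) (- x) = - (u ^^ n) x"
  using up_add[of n x "- x"] by (simp add: eq_neg_iff_add_eq_0 add.commute)

lemma up_diff: "(u ^^ n) (x - y) = (u ^^ n) x - (u ^^ n) y"
  using up_add[of n x "- y"] by (simp add: up_minus)

lemmas up_simps = up_add up_scale up_minus up_diff

lemma u_0 [simp]: "u 0 = 0" using up_0[of 1] by simp
lemma u_minus: "u (- x) = - u x" using up_minus[of 1] by simp
lemma u_diff: "u (x - y) = u x - u y" using up_diff[of 1] by simp

lemmas u_simps = u_add u_scale u_minus u_diff

lemma up_up [simp]: "(u ^^ i) ((u ^^ j) x) = (u ^^ (i + j)) x"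
  by (simp add: funpow_add)

declare funpow.simps(2) [simp del]

lemma u_up2: "u ((u ^^ i) x) = (u ^^ Suc i) x" "(u ^^ i) (u x) = (u ^^ Suc i) x"
  by (simp_all add: funpow.simps(2) funpow_swap1)

lemma up_sa: "q ((u ^^ n) x) y = q x ((u ^^ n) y)"
  by (induction n arbitrary: x y) (simp_all add: u_sa funpow.simps(2) funpow_swap1)

text \<open>Selfadjointness of u makes these forms Hermitian, so the whole theory above is available
  at each level j with prefix \<open>lev\<close>. The level 2 * k is the one that induces
  (b,u)_{t,2k+1}. These forms have the kernel of \<open>u ^^ j\<close> in their radical, so
  nondegeneracy is a property of subspaces here.\<close>

sublocale lev: hermitian_space scale \<sigma> "\<lambda>x y. q x ((u ^^ j) y)" for j
proof
  show "field_involution \<sigma>" by (rule inv)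
  show "q y ((u ^^ j) x) = \<sigma> (q x ((u ^^ j) y))" for x y
    using up_sa q_swap by metis
qed (simp_all add: q_simps up_simps)

lemma up_zero_mono: "(u ^^ n) x = 0 \<Longrightarrow> n \<le> m \<Longrightarrow> (u ^^ m) x = 0"
  using up_up[of "m - n" n x] by simp

text \<open>By the last conjunct \<open>E n\<close> spans the kernel of $u^n$ modulo
  $\mathrm{Ker}\,u^{n-1} + (\mathrm{Ker}\,u^n \cap \mathrm{Im}\,u)$, so it carries the form $(q,u)_{t,n}$.\<close>

definition normal_form :: "'b set \<Rightarrow> (nat \<Rightarrow> 'b set) \<Rightarrow> bool" where
  "normal_form X E \<longleftrightarrow> (\<forall>n. subspace (E n) \<and> E n \<subseteq> X) \<and> (\<forall>n. \<forall>x\<in>E n. (u ^^ n) x = 0) \<and>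
     (\<forall>n. \<forall>x\<in>E n. \<forall>y\<in>E n. \<forall>p. Suc p \<noteq> n \<longrightarrow> q x ((u ^^ p) y) = 0) \<and>
     (\<forall>n m. n \<noteq> m \<longrightarrow> (\<forall>x\<in>E n. \<forall>y\<in>E m. \<forall>p. q x ((u ^^ p) y) = 0)) \<and>
     X \<subseteq> span (\<Union>n m. (u ^^ m) ` E n) \<and>
     (\<forall>n. \<forall>x\<in>X. (u ^^ n) x = 0 \<longrightarrow>
        (\<exists>e\<in>E n. \<exists>z\<in>X. \<exists>w\<in>X. (u ^^ (n - 1)) z = 0 \<and> (u ^^ Suc n) w = 0 \<and> x = e + z + u w))"

text \<open>The products below level N are killed from the top down: adding a multiple of
  \<open>(u ^^ Suc s) x\<close> changes the product at level N - Suc s and none above it, since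
  u^(N+1) vanishes on X.\<close>

lemma normalized_vector:
  assumes "subspace X" "\<And>x. x \<in> X \<Longrightarrow> u x \<in> X" "\<And>x. x \<in> X \<Longrightarrow> (u ^^ Suc N) x = 0"
    "z \<in> X" "q z ((u ^^ N) z) \<noteq> 0"
  obtains x where "x \<in> X" "q x ((u ^^ N) x) \<noteq> 0" "\<And>p. p \<noteq> N \<Longrightarrow> q x ((u ^^ p) x) = 0"
proof -
  have upX: "(u ^^ p) x \<in> X" if "x \<in> X" for p x
    using that by (induction p) (auto simp: funpow.simps(2) assms(2))
  have zero: "(u ^^ p) x = 0" if "x \<in> X" "p > N" for p x
    using up_zero_mono[OF assms(3)[OF that(1)]] that(2) by simp
  obtain c where c: "c + \<sigma> c = 1" using trace_one by blast
  \<comment> \<open>Here s counts the levels below N that are already cleared; writing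
    \<open>N \<le> p + s\<close> avoids truncated subtraction.\<close>
  have "\<exists>x\<in>X. q x ((u ^^ N) x) \<noteq> 0 \<and> (\<forall>p. N \<le> p + s \<longrightarrow> p \<noteq> N \<longrightarrow> q x ((u ^^ p) x) = 0)" for s
  proof (induction s)
    case 0
    then show ?case using assms(4,5) zero by (intro bexI[of _ z]) auto
  next
    case (Suc s)
    then obtain x where x: "x \<in> X" "q x ((u ^^ N) x) \<noteq> 0"
      "\<And>p. N \<le> p + s \<Longrightarrow> p \<noteq> N \<Longrightarrow> q x ((u ^^ p) x) = 0" by blast
    show ?case
    proof (cases "N \<le> s")
      case True
      then show ?thesis using x by (intro bexI[of _ x]) auto
    next
      case False
      define p0 where "p0 = N - Suc s"
      have p0: "p0 + Suc s = N" using False by (simp add: p0_def)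
      define a where "a = q x ((u ^^ N) x)"
      \<comment> \<open>The product at level p0 changes by \<open>(t + \<sigma> t) * a\<close>. Both
        this product and a are fixed by \<sigma>, so t needs only the right trace, and c provides
        it.\<close>
      define t where "t = - (c * q x ((u ^^ p0) x) / a)"
      have sy: "\<sigma> (q x ((u ^^ p) x)) = q x ((u ^^ p) x)" for p
        using lev.q_swap[of x p x] by simp
      have t: "t + \<sigma> t = - q x ((u ^^ p0) x) / a"
      proof -
        have "t + \<sigma> t = - ((c + \<sigma> c) * q x ((u ^^ p0) x) / a)"
          by (simp add: t_def \<sigma>_minus \<sigma>_divide \<sigma>_mult sy a_def algebra_simps add_divide_distrib)
        then show ?thesis using c by simp
      qed
      define x' where "x' = x + t *s (u ^^ Suc s) x"
      have q': "q x' ((u ^^ p) x') = q x ((u ^^ p) x) + (t + \<sigma> t) * q x ((u ^^ (p + Suc s)) x)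
          + t * \<sigma> t * q x ((u ^^ (p + Suc s + Suc s)) x)" for p
        by (simp add: x'_def q_simps up_simps up_sa algebra_simps)
      have "q x' ((u ^^ p) x') = (if p = N then a else 0)" if "N \<le> p + Suc s" for p
      proof -
        have "q x ((u ^^ (p + Suc s + Suc s)) x) = 0" using zero[OF x(1)] that by simp
        moreover have "q x ((u ^^ (p + Suc s)) x) = (if p = p0 then a else 0)"
          using zero[OF x(1), of "p + Suc s"] that p0 by (auto simp: a_def)
        moreover have "p = p0 \<or> p = N \<or> q x ((u ^^ p) x) = 0"
          using x(3)[of p] that p0 by (cases "N \<le> p + s") auto
        moreover have "p0 \<noteq> N" using p0 by simp
        ultimately show ?thesis using t x(2) by (auto simp: q' a_def)
      qed
      moreover have "x' \<in> X" using x(1) upX assms(1) by (simp add: x'_def subspace_add subspace_scale)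
      ultimately show ?thesis using x(2) by (intro bexI[of _ x']) (auto simp: a_def)
    qed
  qed
  from this[of N] that show thesis by auto
qed

text \<open>A cell of maximal length is split off. For a normalized x the products of
  \<open>(u ^^ i) x\<close> and \<open>(u ^^ j) x\<close> vanish unless i + j = N, so its cyclic
  span C is nondegenerate, and the orthogonal X' is again u-stable with smaller dimension.\<close>

lemma normal_form_exists:
  assumes "fin_sp X" "nondeg X" "\<And>x. x \<in> X \<Longrightarrow> u x \<in> X" "\<And>x. x \<in> X \<Longrightarrow> (u ^^ k) x = 0"
  shows "\<exists>E. normal_form X E"
  using assms
proof (induction "dim X" arbitrary: X rule: less_induct)
  case less
  note fX = less.prems(1) and nX = less.prems(2) and uX = less.prems(3)
  have sX: "subspace X" using fX by (rule fin_sp_subspace)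
  have upX: "(u ^^ p) x \<in> X" if "x \<in> X" for p x
    using that by (induction p) (auto simp: funpow.simps(2) uX)
  show ?case
  proof (cases "X = {0}")
    case True
    then show ?thesis
      by (intro exI[of _ "\<lambda>_. {0}"]) (auto simp: normal_form_def subspace_single_0 span_zero)
  next
    case False
    define n where "n = (LEAST n. \<forall>x\<in>X. (u ^^ n) x = 0)"
    have n: "(u ^^ n) x = 0" if "x \<in> X" for x
      using LeastI[of "\<lambda>n. \<forall>x\<in>X. (u ^^ n) x = 0" k] less.prems(4) that by (auto simp: n_def)
    have "n \<noteq> 0"
    proof
      assume "n = 0"
      with n have "X \<subseteq> {0}" by auto
      with False sX show False by (auto simp: subspace_0)
    qed
    then obtain N where N: "n = Suc N" by (auto simp: gr0_conv_Suc)
    have "\<not> (\<forall>x\<in>X. (u ^^ N) x = 0)"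
      using not_less_Least[of N "\<lambda>n. \<forall>x\<in>X. (u ^^ n) x = 0"] N by (auto simp: n_def)
    then obtain x0 where x0: "x0 \<in> X" "(u ^^ N) x0 \<noteq> 0" by auto
    \<comment> \<open>Nondegeneracy gives a nonzero product at level N, and polarization at that
      level turns it into a nonzero norm.\<close>
    then obtain y0 where "y0 \<in> X" "q y0 ((u ^^ N) x0) \<noteq> 0"
      using nX upX unfolding nondeg_def by blast
    then obtain z0 where "z0 \<in> X" "q z0 ((u ^^ N) z0) \<noteq> 0"
      using lev.nonisotropic_vector[OF sX _ x0(1)] by blast
    with normalized_vector[OF sX uX n[unfolded N]] obtain x where
      x: "x \<in> X" "q x ((u ^^ N) x) \<noteq> 0" "\<And>p. p \<noteq> N \<Longrightarrow> q x ((u ^^ p) x) = 0" by blast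
    define C where "C = span ((\<lambda>p. (u ^^ p) x) ` {..<n})"
    have sC: "subspace C" by (simp add: C_def)
    have fC: "fin_sp C" by (auto simp: C_def fin_sp_def)
    have CX: "C \<subseteq> X" unfolding C_def by (rule span_minimal) (use upX x(1) sX in auto)
    have pC: "(u ^^ p) x \<in> C" for p
    proof (cases "p < n")
      case False
      then have "(u ^^ p) x = 0" using up_zero_mono[OF n[OF x(1)]] by simp
      then show ?thesis using sC by (simp add: subspace_0)
    qed (simp add: C_def span_base)
    have C_dec: "\<exists>g. \<exists>c'\<in>C. c = g *s x + u c'" if "c \<in> C" for c
      using that unfolding C_def
    proof (induction rule: span_induct_alt)
      case base
      then show ?case by (intro exI[of _ 0] bexI[of _ 0]) (auto simp: span_zero)
    next
      case (step a y c)
      then obtain p where p: "y = (u ^^ p) x" by auto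
      obtain g c' where gc: "c' \<in> C" "c = g *s x + u c'" using step by (auto simp: C_def)
      show ?case
      proof (cases p)
        case 0
        then have "a *s y + c = (a + g) *s x + u c'" using gc p by (simp add: scale_left_distrib)
        then show ?thesis using gc unfolding C_def by blast
      next
        case (Suc r)
        then have "a *s y + c = g *s x + u (a *s (u ^^ r) x + c')"
          using gc p by (simp add: u_simps u_up2)
        moreover have "a *s (u ^^ r) x + c' \<in> C" using gc pC sC by (simp add: subspace_add subspace_scale)
        ultimately show ?thesis unfolding C_def by blast
      qed
    qed
    have uC: "u c \<in> C" if "c \<in> C" for c
      using that unfolding C_def
    proof (induction rule: span_induct_alt)
      case (step a y c)
      then show ?case using pC unfolding C_def by (auto simp: u_simps u_up2 span_add span_scale)
    qed (simp add: span_zero)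
    have upC: "(u ^^ p) c \<in> C" if "c \<in> C" for p c
      using that by (induction p) (auto simp: funpow.simps(2) uC)
    \<comment> \<open>Pairing at total exponent N isolates the leading coefficient g: the term u c
      meets u^(N+1) = u^n, which is zero on X.\<close>
    have coeff: "q ((u ^^ i) x) ((u ^^ j) (g *s x + u c)) = g * q x ((u ^^ N) x)"
      if "i + j = N" "c \<in> C" for i j g c
      using that n[of c] CX N by (auto simp: up_sa q_simps up_simps u_up2)
    \<comment> \<open>A vector c orthogonal to C is divisible by u^k for every k up to n: if
      \<open>c = (u ^^ k) c1\<close>, pairing with \<open>(u ^^ (N - k)) x\<close> kills the leading
      coefficient of c1. Divisibility by u^n means c = 0.\<close>
    have nC: "nondeg C" unfolding nondeg_def
    proof (intro ballI impI)
      fix c assume c: "c \<in> C" "\<forall>y\<in>C. q y c = 0"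
      have "\<exists>c'\<in>C. c = (u ^^ k) c'" if "k \<le> n" for k
        using that
      proof (induction k)
        case (Suc k)
        then obtain c1 where c1: "c1 \<in> C" "c = (u ^^ k) c1" by auto
        obtain g c2 where c2: "c2 \<in> C" "c1 = g *s x + u c2" using C_dec[OF c1(1)] by blast
        have "g * q x ((u ^^ N) x) = q ((u ^^ (N - k)) x) c"
          using coeff[of "N - k" k c2 g] c2 Suc.prems N by (simp add: c1(2))
        also have "\<dots> = 0" using c pC by blast
        finally have "g = 0" using x(2) by simp
        then show ?case using c1 c2 by (auto simp: u_up2)
      qed (use c in auto)
      from this[of n] n CX show "c = 0" by auto
    qed
    define X' where "X' = {y\<in>X. \<forall>z\<in>C. q z y = 0}"
    have sX': "subspace X'" unfolding X'_def by (rule subspace_perp[OF sX])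
    have X'X: "X' \<subseteq> X" by (auto simp: X'_def)
    have fX': "fin_sp X'" by (rule fin_sp_mono[OF fX sX' X'X])
    have nX': "nondeg X'" unfolding X'_def by (rule nondeg_perp[OF fC nC CX sX nX])
    have uX': "u y \<in> X'" if "y \<in> X'" for y
      using that uX uC u_sa by (auto simp: X'_def) (metis u_sa)
    have upX': "(u ^^ p) y \<in> X'" if "y \<in> X'" for p y
      using that by (induction p) (auto simp: funpow.simps(2) uX')
    have "q ((u ^^ N) x) x \<noteq> 0" using x(2) by (simp add: up_sa)
    then have "x \<notin> X'" using pC by (auto simp: X'_def)
    then have "dim X' < dim X" by (rule dim_less[OF fX sX' X'X x(1)])
    from less.hyps[OF this fX' nX' uX'] less.prems(4) X'X obtain E where E: "normal_form X' E" by blast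
    have E1: "subspace (E m)" "E m \<subseteq> X'" "\<And>y. y \<in> E m \<Longrightarrow> (u ^^ m) y = 0" for m
      using E by (auto simp: normal_form_def)
    have E2: "q y ((u ^^ p) z) = 0" if "y \<in> E m" "z \<in> E m" "Suc p \<noteq> m" for m p y z
      using E that by (auto simp: normal_form_def)
    have E3: "q y ((u ^^ p) z) = 0" if "y \<in> E m" "z \<in> E l" "m \<noteq> l" for m l p y z
      using E that unfolding normal_form_def by blast
    have E4: "X' \<subseteq> span (\<Union>n m. (u ^^ m) ` E n)" using E by (auto simp: normal_form_def)
    have E5: "\<exists>e\<in>E m. \<exists>z\<in>X'. \<exists>w\<in>X'. (u ^^ (m - 1)) z = 0 \<and> (u ^^ Suc m) w = 0 \<and> y = e + z + u w"
      if "y \<in> X'" "(u ^^ m) y = 0" for m y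
      using E that unfolding normal_form_def by blast
    have x0: "q x ((u ^^ p) e) = 0" "q e ((u ^^ p) x) = 0" if "e \<in> X'" for p e
    proof -
      have "q ((u ^^ p) x) e = 0" using that pC by (auto simp: X'_def)
      then show "q x ((u ^^ p) e) = 0" by (simp add: up_sa)
      then show "q e ((u ^^ p) x) = 0" using lev.q_swap_0 by blast
    qed
    \<comment> \<open>X' may have cells of length n as well, so x enlarges \<open>E n\<close>
      instead of replacing it.\<close>
    define E' where "E' = E (n := {g *s x + e | g e. e \<in> E n})"
    have EE': "E m \<subseteq> E' m" for m
    proof
      fix y assume y: "y \<in> E m"
      then have "m = n \<Longrightarrow> \<exists>g e. y = g *s x + e \<and> e \<in> E n" by (metis scale_zero_left add_0)
      with y show "y \<in> E' m" by (auto simp: E'_def)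
    qed
    have E'n: "E' n = {g *s x + e | g e. e \<in> E n}" "m \<noteq> n \<Longrightarrow> E' m = E m" for m
      by (auto simp: E'_def)
    have xE': "g *s x \<in> E' n" for g
      using subspace_0[OF E1(1)[of n]] by (auto simp: E'_def) (metis add_0_right)
    have rep: "\<exists>g. \<exists>e\<in>E m. y = g *s x + e \<and> (m \<noteq> n \<longrightarrow> g = 0)" if "y \<in> E' m" for y m
    proof (cases "m = n")
      case False
      then show ?thesis using that E'n(2) by (intro exI[of _ 0]) auto
    qed (use that E'n(1) in auto)
    have "normal_form X E'" unfolding normal_form_def
    proof (intro conjI allI ballI impI)
      show "subspace (E' m)" for m
      proof (cases "m = n")
        case True
        have "E' n = {y + z | y z. y \<in> span {x} \<and> z \<in> E n}"
          by (auto simp: E'n(1) span_singleton)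
        then show ?thesis using True subspace_sums[of "span {x}" "E n"] E1(1) by simp
      qed (use E1 E'n in simp)
      show "E' m \<subseteq> X" for m
      proof
        fix y assume "y \<in> E' m"
        with rep obtain g e where "e \<in> E m" "y = g *s x + e" by blast
        then show "y \<in> X" using E1(2) X'X x(1) sX by (auto intro!: subspace_add subspace_scale)
      qed
      show "(u ^^ m) y = 0" if y: "y \<in> E' m" for m y
      proof -
        obtain g e where "e \<in> E m" "y = g *s x + e" "m \<noteq> n \<longrightarrow> g = 0" using rep[OF y] by blast
        then show ?thesis using E1(3) n[OF x(1)] by (cases "m = n") (auto simp: up_simps)
      qed
      show "q y ((u ^^ p) z) = 0" if yz: "y \<in> E' m" "z \<in> E' m" and p: "Suc p \<noteq> m" for m y z p
      proof -
        obtain g e where y: "e \<in> E m" "y = g *s x + e" "m \<noteq> n \<longrightarrow> g = 0" using rep[OF yz(1)] by blast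
        obtain h f where z: "f \<in> E m" "z = h *s x + f" "m \<noteq> n \<longrightarrow> h = 0" using rep[OF yz(2)] by blast
        have "q e ((u ^^ p) f) = 0" using E2 y z p by blast
        moreover have "e \<in> X'" "f \<in> X'" using y z E1(2) by auto
        ultimately have "q y ((u ^^ p) z) = \<sigma> g * (h * q x ((u ^^ p) x))"
          by (simp add: y(2) z(2) q_simps up_simps x0)
        also have "\<dots> = 0" using x(3)[of p] y(3) z(3) p N by (cases "m = n") auto
        finally show ?thesis .
      qed
      show "q y ((u ^^ p) z) = 0" if ml: "m \<noteq> l" and yz: "y \<in> E' m" "z \<in> E' l" for m l y z p
      proof -
        obtain g e where y: "e \<in> E m" "y = g *s x + e" "m \<noteq> n \<longrightarrow> g = 0" using rep[OF yz(1)] by blast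
        obtain h f where z: "f \<in> E l" "z = h *s x + f" "l \<noteq> n \<longrightarrow> h = 0" using rep[OF yz(2)] by blast
        have "q e ((u ^^ p) f) = 0" using E3 y z ml by blast
        moreover have "e \<in> X'" "f \<in> X'" using y z E1(2) by auto
        ultimately have "q y ((u ^^ p) z) = \<sigma> g * (h * q x ((u ^^ p) x))"
          by (simp add: y(2) z(2) q_simps up_simps x0)
        also have "\<dots> = 0" using y(3) z(3) ml by (cases "m = n") auto
        finally show ?thesis .
      qed
      let ?S = "span (\<Union>n m. (u ^^ m) ` E' n)"
      have "C \<subseteq> ?S" unfolding C_def
      proof (rule span_minimal)
        have "(u ^^ p) x \<in> ?S" for p
          using xE'[of 1] by (auto intro!: span_base)
        then show "(\<lambda>p. (u ^^ p) x) ` {..<n} \<subseteq> ?S" by auto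
      qed simp
      moreover have "X' \<subseteq> ?S"
        by (rule order_trans[OF E4 span_mono]) (use EE' in blast)
      ultimately show "X \<subseteq> ?S"
      proof (intro subsetI)
        fix y assume "y \<in> X" and *: "C \<subseteq> ?S" "X' \<subseteq> ?S"
        obtain c where c: "c \<in> C" "\<And>z. z \<in> C \<Longrightarrow> q z (y - c) = 0" using nondeg_split[OF fC nC] by blast
        have "y - c \<in> X'" using c CX \<open>y \<in> X\<close> sX by (auto simp: X'_def subspace_diff)
        then have "c + (y - c) \<in> ?S" using * c(1) by (intro span_add) auto
        then show "y \<in> ?S" by simp
      qed
      fix m y assume y: "y \<in> X" "(u ^^ m) y = 0"
      obtain c where c: "c \<in> C" "\<And>z. z \<in> C \<Longrightarrow> q z (y - c) = 0" using nondeg_split[OF fC nC] by blast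
      define y' where "y' = y - c"
      have y': "y' \<in> X'" "y = c + y'" using c CX \<open>y \<in> X\<close> sX by (auto simp: X'_def y'_def subspace_diff)
      have cy: "(u ^^ m) c = - (u ^^ m) y'" using y(2) by (simp add: y'(2) up_simps eq_neg_iff_add_eq_0)
      \<comment> \<open>The two components of y are killed separately, because C and X' meet only in
        0.\<close>
      have "(u ^^ m) c \<in> X'" using upX'[OF y'(1)] sX' by (simp add: cy subspace_neg)
      with upC[OF c(1), of m] nC have uc: "(u ^^ m) c = 0" unfolding X'_def nondeg_def by blast
      with cy have "(u ^^ m) y' = 0" by simp
      from E5[OF y'(1) this] obtain e z w where ezw: "e \<in> E m" "z \<in> X'" "w \<in> X'"
        "(u ^^ (m - 1)) z = 0" "(u ^^ Suc m) w = 0" "y' = e + z + u w" by blast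
      obtain g c1 where gc: "c1 \<in> C" "c = g *s x + u c1" using C_dec[OF c(1)] by blast
      have uc1: "(u ^^ Suc m) c1 = 0" if "g = 0 \<or> m \<ge> n"
      proof (cases "g = 0")
        case True
        then show ?thesis using uc gc by (simp add: u_up2)
      next
        case False
        then show ?thesis using that up_zero_mono[OF n, of c1 "Suc m"] gc CX by auto
      qed
      \<comment> \<open>For m < n, the vanishing of u^m c forces g = 0, so c = u c1 joins the image
        part. For m = n the term g x joins the new block. For m > n, c is already killed by
        u^(m-1).\<close>
      consider "m < n" | "m = n" | "m > n" by linarith
      then show "\<exists>e\<in>E' m. \<exists>z\<in>X. \<exists>w\<in>X. (u ^^ (m - 1)) z = 0 \<and> (u ^^ Suc m) w = 0 \<and> y = e + z + u w"
      proof cases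
        case 1
        have "g * q x ((u ^^ N) x) = q ((u ^^ (N - m)) x) ((u ^^ m) c)"
          using coeff[of "N - m" m c1 g] gc 1 N by simp
        then have "g = 0" using x(2) uc by simp
        then show ?thesis
          using ezw gc uc1 EE' X'X CX y'(2) sX
          by (intro bexI[of _ e] bexI[of _ z] bexI[of _ "w + c1"])
             (auto simp: up_simps u_simps algebra_simps intro: subspace_add)
      next
        case 2
        then show ?thesis
          using ezw gc uc1 X'X CX y'(2) sX
          by (intro bexI[of _ "g *s x + e"] bexI[of _ z] bexI[of _ "w + c1"])
             (auto simp: up_simps u_simps algebra_simps E'n(1) intro: subspace_add)
      next
        case 3
        have "(u ^^ (m - 1)) c = 0" using up_zero_mono[OF n, of c "m - 1"] c(1) CX 3 by auto
        then show ?thesis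
          using ezw c EE' X'X CX y'(2) sX
          by (intro bexI[of _ e] bexI[of _ "z + c"] bexI[of _ w])
             (auto simp: up_simps u_simps algebra_simps intro: subspace_add)
      qed
    qed
    then show ?thesis by blast
  qed
qed

end

section \<open>Splittings\<close>

context selfadjoint_operator
begin

text \<open>Linear relations in place of functions: a cell is described by the images of the
  generators \<open>(u ^^ m) x\<close>, which may be zero or linearly dependent.\<close>

inductive_set pair_span :: "('b \<times> 'b) set \<Rightarrow> ('b \<times> 'b) set" for g where
  zero: "(0, 0) \<in> pair_span g"
| base: "p \<in> g \<Longrightarrow> p \<in> pair_span g"
| add: "(x, x') \<in> pair_span g \<Longrightarrow> (y, y') \<in> pair_span g \<Longrightarrow> (x + y, x' + y') \<in> pair_span g"
| scale: "(x, x') \<in> pair_span g \<Longrightarrow> (a *s x, a *s x') \<in> pair_span g"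

text \<open>\<open>splitting_graph R \<Gamma>\<close> holds if \<open>\<Gamma>\<close> behaves like the graph of a selfadjoint \<open>v\<close> on \<open>R\<close> such that
  \<open>v\<close> and \<open>u - v\<close> have square zero. Single-valuedness is not required: it follows
  from selfadjointness as soon as the form is nondegenerate on \<open>R\<close>.\<close>

definition splitting_graph :: "'b set \<Rightarrow> ('b \<times> 'b) set \<Rightarrow> bool" where
  "splitting_graph R \<Gamma> \<longleftrightarrow> (0, 0) \<in> \<Gamma> \<and>
     (\<forall>x x' y y'. (x, x') \<in> \<Gamma> \<longrightarrow> (y, y') \<in> \<Gamma> \<longrightarrow> (x + y, x' + y') \<in> \<Gamma>) \<and>
     (\<forall>a x x'. (x, x') \<in> \<Gamma> \<longrightarrow> (a *s x, a *s x') \<in> \<Gamma>) \<and>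
     \<Gamma> \<subseteq> R \<times> R \<and> R \<subseteq> fst ` \<Gamma> \<and>
     (\<forall>x x' y y'. (x, x') \<in> \<Gamma> \<longrightarrow> (y, y') \<in> \<Gamma> \<longrightarrow> q x' y = q x y') \<and>
     (\<forall>x x'. (x, x') \<in> \<Gamma> \<longrightarrow> (x', 0) \<in> \<Gamma>) \<and>
     (\<forall>x x'. (x, x') \<in> \<Gamma> \<longrightarrow> (u x, u (u x) - u x') \<in> \<Gamma>)"

lemma splitting_graphD:
  assumes "splitting_graph R \<Gamma>"
  shows "(0, 0) \<in> \<Gamma>"
    and [rule_format]: "\<forall>x x' y y'. (x, x') \<in> \<Gamma> \<longrightarrow> (y, y') \<in> \<Gamma> \<longrightarrow> (x + y, x' + y') \<in> \<Gamma>"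
    and [rule_format]: "\<forall>a x x'. (x, x') \<in> \<Gamma> \<longrightarrow> (a *s x, a *s x') \<in> \<Gamma>"
    and "\<Gamma> \<subseteq> R \<times> R" "R \<subseteq> fst ` \<Gamma>"
    and [rule_format]: "\<forall>x x' y y'. (x, x') \<in> \<Gamma> \<longrightarrow> (y, y') \<in> \<Gamma> \<longrightarrow> q x' y = q x y'"
    and [rule_format]: "\<forall>x x'. (x, x') \<in> \<Gamma> \<longrightarrow> (x', 0) \<in> \<Gamma>"
    and [rule_format]: "\<forall>x x'. (x, x') \<in> \<Gamma> \<longrightarrow> (u x, u (u x) - u x') \<in> \<Gamma>"
  using assms unfolding splitting_graph_def by - (elim conjE, assumption)+

definition splits :: "'b set \<Rightarrow> bool" where
  "splits R \<longleftrightarrow> subspace R \<and> (\<exists>\<Gamma>. splitting_graph R \<Gamma>)"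

text \<open>Every condition is linear in a pair or sesquilinear in two pairs, hence passes from
  generators to their span. The condition \<open>uu\<close> encodes that u - v has square zero: once
  v^2 = 0, this says v u = u^2 - u v.\<close>

lemma splits_generated:
  assumes "g \<subseteq> R \<times> R" "R = span (fst ` g)"
    and sa: "\<And>x x' y y'. (x, x') \<in> g \<Longrightarrow> (y, y') \<in> g \<Longrightarrow> q x' y = q x y'"
    and sq: "\<And>x x'. (x, x') \<in> g \<Longrightarrow> (x', 0) \<in> pair_span g"
    and uu: "\<And>x x'. (x, x') \<in> g \<Longrightarrow> (u x, u (u x) - u x') \<in> pair_span g"
  shows "splits R"
  unfolding splits_def splitting_graph_def
proof (intro conjI exI[of _ "pair_span g"] allI impI)
  show sR: "subspace R" by (simp add: assms(2))
  show "(0, 0) \<in> pair_span g" by (rule pair_span.zero)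
  show "(x + y, x' + y') \<in> pair_span g" if "(x, x') \<in> pair_span g" "(y, y') \<in> pair_span g" for x x' y y'
    using that by (rule pair_span.add)
  show "(a *s x, a *s x') \<in> pair_span g" if "(x, x') \<in> pair_span g" for a x x'
    using that by (rule pair_span.scale)
  have "fst p \<in> R \<and> snd p \<in> R" if "p \<in> pair_span g" for p
    using that by induction (use assms(1) sR in \<open>auto simp: subspace_0 subspace_add subspace_scale\<close>)
  then show "pair_span g \<subseteq> R \<times> R" by auto
  have "\<exists>x'. (x, x') \<in> pair_span g" if "x \<in> span (fst ` g)" for x
    using that
  proof (induction rule: span_induct_alt)
    case (step a x y)
    then obtain x' y' where "(x, x') \<in> g" "(y, y') \<in> pair_span g" by auto
    then show ?case by (intro exI[of _ "a *s x' + y'"]) (blast intro: pair_span.intros)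
  qed (blast intro: pair_span.zero)
  then show "R \<subseteq> fst ` pair_span g" unfolding assms(2) by force
  have sa1: "q (snd p) y = q (fst p) y'" if "p \<in> pair_span g" "(y, y') \<in> g" for p y y'
    using that(1) by induction (auto simp: q_simps sa that(2))
  have "q x' (fst r) = q x (snd r)" if "r \<in> pair_span g" "(x, x') \<in> pair_span g" for r x x'
    using that(1) by induction (use sa1[OF that(2)] in \<open>auto simp: q_simps\<close>)
  then show "q x' y = q x y'" if "(x, x') \<in> pair_span g" "(y, y') \<in> pair_span g" for x x' y y'
    using that by fastforce
  have "(snd p, 0) \<in> pair_span g" if "p \<in> pair_span g" for p
    using that
  proof induction
    case (add x x' y y')
    then show ?case using pair_span.add[of x' 0 g y' 0] by simp
  next
    case (scale x x' a)
    then show ?case using pair_span.scale[of x' 0 g a] by simp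
  qed (auto simp: sq intro: pair_span.zero)
  then show "(x', 0) \<in> pair_span g" if "(x, x') \<in> pair_span g" for x x'
    using that by fastforce
  have "(u (fst p), u (u (fst p)) - u (snd p)) \<in> pair_span g" if "p \<in> pair_span g" for p
    using that
  proof induction
    case (add x x' y y')
    then show ?case using pair_span.add[of "u x" "u (u x) - u x'" g "u y" "u (u y) - u y'"]
      by (simp add: u_simps algebra_simps)
  next
    case (scale x x' a)
    then show ?case using pair_span.scale[of "u x" "u (u x) - u x'" g a]
      by (simp add: u_simps scale_right_diff_distrib)
  qed (auto simp: uu intro: pair_span.zero)
  then show "(u x, u (u x) - u x') \<in> pair_span g" if "(x, x') \<in> pair_span g" for x x'
    using that by fastforce
qed

lemma splits_add:
  assumes "splits R" "splits S" "\<And>x y. x \<in> R \<Longrightarrow> y \<in> S \<Longrightarrow> q x y = 0"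
  shows "splits {x + y | x y. x \<in> R \<and> y \<in> S}"
proof -
  obtain \<Gamma> \<Delta> where "splitting_graph R \<Gamma>" "splitting_graph S \<Delta>"
    using assms(1,2) unfolding splits_def by blast
  note G = splitting_graphD[OF this(1)] and D = splitting_graphD[OF this(2)]
  define \<Theta> where "\<Theta> = {(x + y, x' + y') | x x' y y'. (x, x') \<in> \<Gamma> \<and> (y, y') \<in> \<Delta>}"
  have ThI: "(x, x') \<in> \<Gamma> \<Longrightarrow> (y, y') \<in> \<Delta> \<Longrightarrow> z = x + y \<Longrightarrow> z' = x' + y' \<Longrightarrow> (z, z') \<in> \<Theta>"
    for x x' y y' z z' unfolding \<Theta>_def by blast
  have ThE: "\<exists>x x' y y'. (x, x') \<in> \<Gamma> \<and> (y, y') \<in> \<Delta> \<and> z = x + y \<and> z' = x' + y'" if "(z, z') \<in> \<Theta>" for z z'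
    using that unfolding \<Theta>_def by blast
  have swap0: "q y x = 0" if "x \<in> R" "y \<in> S" for x y using assms(3)[OF that] q_swap_0 by blast
  show ?thesis unfolding splits_def splitting_graph_def
  proof (intro conjI exI[of _ \<Theta>] allI impI)
    show "subspace {x + y |x y. x \<in> R \<and> y \<in> S}"
      using assms by (intro subspace_sums) (auto simp: splits_def)
    show "(0, 0) \<in> \<Theta>" by (rule ThI[OF G(1) D(1)]) auto
    show "(x + y, x' + y') \<in> \<Theta>" if xy: "(x, x') \<in> \<Theta>" "(y, y') \<in> \<Theta>" for x x' y y'
    proof -
      obtain a a' b b' where 1: "(a, a') \<in> \<Gamma>" "(b, b') \<in> \<Delta>" "x = a + b" "x' = a' + b'"
        using ThE[OF xy(1)] by blast
      obtain c c' d d' where 2: "(c, c') \<in> \<Gamma>" "(d, d') \<in> \<Delta>" "y = c + d" "y' = c' + d'"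
        using ThE[OF xy(2)] by blast
      show ?thesis by (rule ThI[OF G(2)[OF 1(1) 2(1)] D(2)[OF 1(2) 2(2)]]) (simp_all add: 1 2 algebra_simps)
    qed
    show "(e *s x, e *s x') \<in> \<Theta>" if x: "(x, x') \<in> \<Theta>" for e x x'
    proof -
      obtain a a' b b' where 1: "(a, a') \<in> \<Gamma>" "(b, b') \<in> \<Delta>" "x = a + b" "x' = a' + b'"
        using ThE[OF x] by blast
      show ?thesis by (rule ThI[OF G(3)[OF 1(1)] D(3)[OF 1(2)]]) (simp_all add: 1 scale_right_distrib)
    qed
    show "\<Theta> \<subseteq> {x + y |x y. x \<in> R \<and> y \<in> S} \<times> {x + y |x y. x \<in> R \<and> y \<in> S}"
      using G(4) D(4) unfolding \<Theta>_def by blast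
    show "{x + y |x y. x \<in> R \<and> y \<in> S} \<subseteq> fst ` \<Theta>"
    proof safe
      fix x y assume "x \<in> R" "y \<in> S"
      then obtain x' y' where "(x, x') \<in> \<Gamma>" "(y, y') \<in> \<Delta>" using G(5) D(5) by fastforce
      from ThI[OF this refl refl] show "x + y \<in> fst ` \<Theta>" by force
    qed
    show "q x' y = q x y'" if xy: "(x, x') \<in> \<Theta>" "(y, y') \<in> \<Theta>" for x x' y y'
    proof -
      obtain a a' b b' where 1: "(a, a') \<in> \<Gamma>" "(b, b') \<in> \<Delta>" "x = a + b" "x' = a' + b'"
        using ThE[OF xy(1)] by blast
      obtain c c' d d' where 2: "(c, c') \<in> \<Gamma>" "(d, d') \<in> \<Delta>" "y = c + d" "y' = c' + d'"
        using ThE[OF xy(2)] by blast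
      have "a \<in> R" "a' \<in> R" "c \<in> R" "c' \<in> R" "b \<in> S" "b' \<in> S" "d \<in> S" "d' \<in> S"
        using 1 2 G(4) D(4) by auto
      then show ?thesis using G(6)[OF 1(1) 2(1)] D(6)[OF 1(2) 2(2)]
        by (simp add: 1 2 q_simps assms(3) swap0)
    qed
    fix x x' assume x: "(x, x') \<in> \<Theta>"
    obtain a a' b b' where 1: "(a, a') \<in> \<Gamma>" "(b, b') \<in> \<Delta>" "x = a + b" "x' = a' + b'"
      using ThE[OF x] by blast
    show "(x', 0) \<in> \<Theta>"
      by (rule ThI[OF G(7)[OF 1(1)] D(7)[OF 1(2)]]) (simp_all add: 1)
    show "(u x, u (u x) - u x') \<in> \<Theta>"
      by (rule ThI[OF G(8)[OF 1(1)] D(8)[OF 1(2)]])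
         (simp_all add: 1 u_simps algebra_simps)
  qed
qed

section \<open>Cells on which the operator splits\<close>

definition orbit :: "'b set \<Rightarrow> 'b set" where
  "orbit S = span (\<Union>m. (u ^^ m) ` S)"

lemma orbit_subspace: "subspace (orbit S)" by (simp add: orbit_def)

lemma orbit_base: "x \<in> S \<Longrightarrow> (u ^^ m) x \<in> orbit S"
  unfolding orbit_def by (rule span_base) blast

lemma orbit_mono: "S \<subseteq> T \<Longrightarrow> orbit S \<subseteq> orbit T"
  unfolding orbit_def by (rule span_mono) blast

lemma orbit_perp:
  assumes "\<And>x y p. x \<in> S \<Longrightarrow> y \<in> T \<Longrightarrow> q x ((u ^^ p) y) = 0" "x \<in> orbit S" "y \<in> orbit T"
  shows "q x y = 0"
proof -
  have 1: "q s y = 0" if s: "s \<in> (\<Union>m. (u ^^ m) ` S)" for s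
  proof -
    have "q t s = 0" if t: "t \<in> (\<Union>m. (u ^^ m) ` T)" for t
    proof -
      obtain a b m l where "a \<in> S" "s = (u ^^ m) a" "b \<in> T" "t = (u ^^ l) b" using s t by blast
      then have "q s t = 0" using assms(1) by (simp add: up_sa)
      then show ?thesis using q_swap_0 by blast
    qed
    then have "q y s = 0" using assms(3) perp_span unfolding orbit_def by blast
    then show ?thesis using q_swap_0 by blast
  qed
  show ?thesis using assms(2) perp_span[OF 1] unfolding orbit_def by blast
qed

lemma orbit_eqI:
  assumes "\<And>z. z \<in> G \<Longrightarrow> z \<in> orbit S" "\<And>x m. x \<in> S \<Longrightarrow> (u ^^ m) x \<in> G"
  shows "orbit S = span G"
proof
  show "orbit S \<subseteq> span G" unfolding orbit_def by (rule span_mono) (use assms(2) in blast)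
  show "span G \<subseteq> orbit S" by (rule span_minimal[OF _ orbit_subspace]) (use assms(1) in blast)
qed

lemma even_or_odd_cases: fixes m :: nat obtains k where "m = 2 * k" | k where "m = Suc (2 * k)"
  by (metis oddE evenE Suc_eq_plus1)

lemma splits_killed:
  assumes "\<And>x. x \<in> S \<Longrightarrow> u x = 0"
  shows "splits (orbit S)"
proof -
  define g where "g = (\<Union>m. \<Union>x\<in>S. {((u ^^ m) x, 0::'b)})"
  have u0: "u ((u ^^ m) x) = 0" if "x \<in> S" for x m
  proof -
    have "u ((u ^^ m) x) = (u ^^ m) (u x)" by (simp add: u_up2)
    then show ?thesis using assms[OF that] by simp
  qed
  show ?thesis
  proof (rule splits_generated[of g])
    show "g \<subseteq> orbit S \<times> orbit S" using subspace_0[OF orbit_subspace] by (auto simp: g_def orbit_base)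
    show "orbit S = span (fst ` g)" by (rule orbit_eqI) (force simp: g_def orbit_base)+
  qed (auto simp: g_def u0 intro: pair_span.zero)
qed

text \<open>v acts as u on even powers and as 0 on odd ones, and u - v the other way round. Either
  side of the selfadjointness equation can be nonzero only for an even total exponent, where the
  hypothesis makes it vanish. On \<open>E n\<close> with n even this holds, the only product being
  at n - 1.\<close>

lemma splits_even:
  assumes "\<And>x y p. x \<in> S \<Longrightarrow> y \<in> S \<Longrightarrow> q x ((u ^^ (2 * p)) y) = 0"
  shows "splits (orbit S)"
proof -
  define g where "g = (\<Union>m. \<Union>x\<in>S. {((u ^^ (2 * m)) x, (u ^^ Suc (2 * m)) x), ((u ^^ Suc (2 * m)) x, 0)})"
  have g1: "((u ^^ (2 * m)) x, (u ^^ Suc (2 * m)) x) \<in> pair_span g" if "x \<in> S" for x m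
    using that by (intro pair_span.base) (auto simp: g_def)
  have g2: "((u ^^ Suc (2 * m)) x, 0) \<in> pair_span g" if "x \<in> S" for x m
    using that by (intro pair_span.base) (auto simp: g_def)
  have ev: "q x ((u ^^ p) y) = 0" if "x \<in> S" "y \<in> S" "even p" for x y p
    using assms[OF that(1,2), of "p div 2"] that(3) by simp
  show ?thesis
  proof (rule splits_generated[of g])
    show "g \<subseteq> orbit S \<times> orbit S" using subspace_0[OF orbit_subspace] by (auto simp: g_def orbit_base)
    show "orbit S = span (fst ` g)"
    proof (rule orbit_eqI)
      show "z \<in> fst ` g \<Longrightarrow> z \<in> orbit S" for z by (auto simp: g_def orbit_base)
      show "(u ^^ m) x \<in> fst ` g" if "x \<in> S" for x m
        by (cases m rule: even_or_odd_cases) (use that in \<open>force simp: g_def\<close>)+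
    qed
    show "q x' y = q x y'" if "(x, x') \<in> g" "(y, y') \<in> g" for x x' y y'
      using that by (auto simp: g_def up_sa ev)
    show "(x', 0) \<in> pair_span g" if "(x, x') \<in> g" for x x'
      using that g2 by (auto simp: g_def intro: pair_span.zero)
    show "(u x, u (u x) - u x') \<in> pair_span g" if "(x, x') \<in> g" for x x'
      using that g2 g1[of _ "Suc _"] by (auto simp: g_def u_up2)
  qed
qed

text \<open>The same alternation with opposite phases: v kills the even powers on S and the odd
  powers on T. As S and T are isotropic at all levels and pair only at even exponents, the opposite
  phases make v selfadjoint.\<close>

lemma splits_hyperbolic:
  assumes SS: "\<And>x y p. x \<in> S \<Longrightarrow> y \<in> S \<Longrightarrow> q x ((u ^^ p) y) = 0"
    and TT: "\<And>x y p. x \<in> T \<Longrightarrow> y \<in> T \<Longrightarrow> q x ((u ^^ p) y) = 0"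
    and ST: "\<And>x y p. x \<in> S \<Longrightarrow> y \<in> T \<Longrightarrow> odd p \<Longrightarrow> q x ((u ^^ p) y) = 0"
  shows "splits (orbit (S \<union> T))"
proof -
  define S1 where "S1 (m::nat) x = ((u ^^ (2 * m)) x, 0::'b)" for m x
  define S2 where "S2 (m::nat) x = ((u ^^ (2 * m + 1)) x, (u ^^ (2 * m + 2)) x)" for m x
  define T1 where "T1 (m::nat) x = ((u ^^ (2 * m)) x, (u ^^ (2 * m + 1)) x)" for m x
  define T2 where "T2 (m::nat) x = ((u ^^ (2 * m + 1)) x, 0::'b)" for m x
  note F = S1_def S2_def T1_def T2_def
  define g where "g = (\<Union>m. (\<Union>x\<in>S. {S1 m x, S2 m x}) \<union> (\<Union>x\<in>T. {T1 m x, T2 m x}))"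
  have g: "x \<in> S \<Longrightarrow> S1 m x \<in> pair_span g" "x \<in> S \<Longrightarrow> S2 m x \<in> pair_span g"
     "x \<in> T \<Longrightarrow> T1 m x \<in> pair_span g" "x \<in> T \<Longrightarrow> T2 m x \<in> pair_span g" for m x
    by (auto intro!: pair_span.base simp: g_def)
  have gE: "\<exists>m x. x \<in> S \<and> p = S1 m x \<or> x \<in> S \<and> p = S2 m x \<or> x \<in> T \<and> p = T1 m x \<or> x \<in> T \<and> p = T2 m x"
    if "p \<in> g" for p
    using that unfolding g_def by blast
  have TS: "q y ((u ^^ p) x) = 0" if "x \<in> S" "y \<in> T" "odd p" for x y p
    using ST[OF that] lev.q_swap_0 by blast
  have O: "orbit (S \<union> T) = span (fst ` g)"
  proof (rule orbit_eqI)
    show "z \<in> fst ` g \<Longrightarrow> z \<in> orbit (S \<union> T)" for z by (auto simp: g_def F orbit_base)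
    fix x and m :: nat assume x: "x \<in> S \<union> T"
    obtain k where k: "m = 2 * k \<or> m = 2 * k + 1" by (cases m rule: even_or_odd_cases) auto
    have "x \<in> S \<Longrightarrow> fst (S1 k x) \<in> fst ` g" "x \<in> S \<Longrightarrow> fst (S2 k x) \<in> fst ` g"
      "x \<in> T \<Longrightarrow> fst (T1 k x) \<in> fst ` g" "x \<in> T \<Longrightarrow> fst (T2 k x) \<in> fst ` g"
      by (rule imageI, force simp: g_def)+
    then show "(u ^^ m) x \<in> fst ` g" using x k by (auto simp: F)
  qed
  show ?thesis
  proof (rule splits_generated[OF _ O])
    show "g \<subseteq> orbit (S \<union> T) \<times> orbit (S \<union> T)"
      using subspace_0[OF orbit_subspace] by (auto simp: g_def F orbit_base)
    show "q x' y = q x y'" if xy: "(x, x') \<in> g" "(y, y') \<in> g" for x x' y y'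
      using gE[OF xy(1)] gE[OF xy(2)]
      by (elim exE disjE) (simp_all add: F up_sa SS TT ST TS)
    show "(x', 0) \<in> pair_span g" if x: "(x, x') \<in> g" for x x'
    proof -
      obtain m z where z: "z \<in> S \<and> (x, x') = S1 m z \<or> z \<in> S \<and> (x, x') = S2 m z \<or>
         z \<in> T \<and> (x, x') = T1 m z \<or> z \<in> T \<and> (x, x') = T2 m z"
        using gE[OF x] by blast
      show ?thesis using z g(1)[of z "Suc m"] g(4)[of z m]
        by (elim disjE) (simp_all add: F pair_span.zero eval_nat_numeral)
    qed
    show "(u x, u (u x) - u x') \<in> pair_span g" if x: "(x, x') \<in> g" for x x'
    proof -
      obtain m z where z: "z \<in> S \<and> (x, x') = S1 m z \<or> z \<in> S \<and> (x, x') = S2 m z \<or>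
         z \<in> T \<and> (x, x') = T1 m z \<or> z \<in> T \<and> (x, x') = T2 m z"
        using gE[OF x] by blast
      show ?thesis using z g(1)[of z "Suc m"] g(2)[of z m] g(3)[of z "Suc m"] g(4)[of z m]
        by (elim disjE) (simp_all add: F u_up2 eval_nat_numeral)
    qed
  qed
qed

text \<open>The images of \<open>x\<close>, \<open>u x\<close>, \<open>\<theta> x\<close>, \<open>u (\<theta> x)\<close> under \<open>v\<close> start from
  \<open>v x = c (u x + \<theta> x)\<close>; the others follow from selfadjointness and from
  \<open>v (u x) = u (u x) - u (v x)\<close>.\<close>

lemma splits_linked:
  assumes AA: "\<And>x y p. x \<in> A \<Longrightarrow> y \<in> A \<Longrightarrow> p \<noteq> 2 * K + 2 \<Longrightarrow> q x ((u ^^ p) y) = 0"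
    and TT: "\<And>x y p. x \<in> A \<Longrightarrow> y \<in> A \<Longrightarrow> p \<noteq> 2 * K \<Longrightarrow> q (\<theta> x) ((u ^^ p) (\<theta> y)) = 0"
    and AT: "\<And>x y p. x \<in> A \<Longrightarrow> y \<in> A \<Longrightarrow> q x ((u ^^ p) (\<theta> y)) = 0"
    and anti: "\<And>x y. x \<in> A \<Longrightarrow> y \<in> A \<Longrightarrow> q (\<theta> x) ((u ^^ (2 * K)) (\<theta> y)) = - q x ((u ^^ (2 * K + 2)) y)"
  shows "splits (orbit (A \<union> \<theta> ` A))"
proof -
  obtain c where c: "c + \<sigma> c = 1" using trace_one by blast
  define d where "d = \<sigma> c"
  have sd: "\<sigma> c = d" "\<sigma> d = c" and cd: "1 - c = d" "1 - d = c" "d + c = 1" "c + d = 1"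
    using c by (auto simp: d_def algebra_simps)
  \<comment> \<open>The constants balance selfadjointness. Between x and u y, the coefficient
    \<sigma> c coming from v x meets 1 - c coming from v (u y), which forces
    \<open>c + \<sigma> c = 1\<close>. Between x and \<theta> y, the \<theta>-part of v x meets the
    u^2-part of v (\<theta> y), and their opposite signs agree by the sign reversal
    \<open>anti\<close>.\<close>
  define F1 where "F1 (m::nat) x = ((u ^^ (2 * m)) x, c *s ((u ^^ (2 * m + 1)) x + (u ^^ (2 * m)) (\<theta> x)))" for m x
  define F2 where "F2 (m::nat) x = ((u ^^ (2 * m + 1)) x, d *s (u ^^ (2 * m + 2)) x - c *s (u ^^ (2 * m + 1)) (\<theta> x))" for m x
  define F3 where "F3 (m::nat) x = ((u ^^ (2 * m)) (\<theta> x), c *s (u ^^ (2 * m + 1)) (\<theta> x) - d *s (u ^^ (2 * m + 2)) x)" for m x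
  define F4 where "F4 (m::nat) x = ((u ^^ (2 * m + 1)) (\<theta> x), d *s ((u ^^ (2 * m + 2)) (\<theta> x) + (u ^^ (2 * m + 3)) x))" for m x
  define g where "g = (\<Union>m. \<Union>x\<in>A. {F1 m x, F2 m x, F3 m x, F4 m x})"
  note F = F1_def F2_def F3_def F4_def
  have g: "F1 m x \<in> pair_span g" "F2 m x \<in> pair_span g" "F3 m x \<in> pair_span g" "F4 m x \<in> pair_span g"
    if "x \<in> A" for m x
    using that by (auto intro!: pair_span.base simp: g_def)
  have gE: "\<exists>m. \<exists>z\<in>A. p = F1 m z \<or> p = F2 m z \<or> p = F3 m z \<or> p = F4 m z" if "p \<in> g" for p
    using that by (auto simp: g_def)
  define \<beta> where "\<beta> x y = q x ((u ^^ (2 * K + 2)) y)" for x y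
  have AA': "q x ((u ^^ p) y) = (if p = 2 * K + 2 then \<beta> x y else 0)" if "x \<in> A" "y \<in> A" for x y p
    using AA[OF that] by (simp add: \<beta>_def)
  have TT': "q (\<theta> x) ((u ^^ p) (\<theta> y)) = (if p = 2 * K then - \<beta> x y else 0)" if "x \<in> A" "y \<in> A" for x y p
    using TT[OF that] anti[OF that] by (simp add: \<beta>_def)
  have TA: "q (\<theta> x) ((u ^^ p) y) = 0" if "x \<in> A" "y \<in> A" for x y p
    using AT[OF that(2,1)] lev.q_swap_0 by blast
  note Q = AA' TT' AT TA
  have parity: "2 * m + 2 * l \<noteq> Suc (2 * K)" "Suc (2 * m + 2 * l) \<noteq> 2 * K"
    "Suc (Suc (Suc (2 * m + 2 * l))) \<noteq> 2 * K" for m l :: nat by presburger+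
  have O: "orbit (A \<union> \<theta> ` A) = span (fst ` g)"
  proof (rule orbit_eqI)
    show "z \<in> fst ` g \<Longrightarrow> z \<in> orbit (A \<union> \<theta> ` A)" for z
      by (auto simp: g_def F orbit_base)
    fix x and m :: nat assume "x \<in> A \<union> \<theta> ` A"
    then obtain y where y: "y \<in> A" "x = y \<or> x = \<theta> y" by auto
    obtain k where k: "m = 2 * k \<or> m = 2 * k + 1" by (cases m rule: even_or_odd_cases) auto
    have "fst (F1 k y) \<in> fst ` g" "fst (F2 k y) \<in> fst ` g" "fst (F3 k y) \<in> fst ` g" "fst (F4 k y) \<in> fst ` g"
      using y(1) by (auto simp: g_def)
    then show "(u ^^ m) x \<in> fst ` g" using y(2) k by (auto simp: F)
  qed
  show ?thesis
  proof (rule splits_generated[OF _ O])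
    show "g \<subseteq> orbit (A \<union> \<theta> ` A) \<times> orbit (A \<union> \<theta> ` A)"
      using orbit_subspace[of "A \<union> \<theta> ` A"]
      by (auto simp: g_def F orbit_base intro!: subspace_add subspace_diff subspace_scale)
    show "q x' y = q x y'" if xy: "(x, x') \<in> g" "(y, y') \<in> g" for x x' y y'
    proof -
      obtain m z where z: "z \<in> A" "(x, x') = F1 m z \<or> (x, x') = F2 m z \<or> (x, x') = F3 m z \<or> (x, x') = F4 m z"
        using gE[OF xy(1)] by blast
      obtain l w where w: "w \<in> A" "(y, y') = F1 l w \<or> (y, y') = F2 l w \<or> (y, y') = F3 l w \<or> (y, y') = F4 l w"
        using gE[OF xy(2)] by blast
      from z(2) w(2) show ?thesis
        by (elim disjE; auto simp: F q_simps up_sa Q z(1) w(1) sd parity)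
    qed
    show "(x', 0) \<in> pair_span g" if x: "(x, x') \<in> g" for x x'
    proof -
      obtain m z where z: "z \<in> A" "(x, x') = F1 m z \<or> (x, x') = F2 m z \<or> (x, x') = F3 m z \<or> (x, x') = F4 m z"
        using gE[OF x] by blast
      have lin: "(a *s fst p + b *s fst r, a *s snd p + b *s snd r) \<in> pair_span g"
        if "p \<in> pair_span g" "r \<in> pair_span g" for a b p r
        using that pair_span.add[OF pair_span.scale[of "fst p" "snd p" g a] pair_span.scale[of "fst r" "snd r" g b]]
        by simp
      \<comment> \<open>Each image is a combination of two generators whose own images cancel; for
        instance v x = c (u x + \<theta> x) and v (\<theta> x) = - v (u x).\<close>
      show ?thesis using z(2) lin[OF g(2)[OF z(1), of m] g(3)[OF z(1), of m], of c c]
          lin[OF g(1)[OF z(1), of "Suc m"] g(4)[OF z(1), of m], of d "- c"]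
          lin[OF g(4)[OF z(1), of m] g(1)[OF z(1), of "Suc m"], of c "- d"]
          lin[OF g(3)[OF z(1), of "Suc m"] g(2)[OF z(1), of "Suc m"], of d d]
        by (elim disjE; simp only: F prod.inject fst_conv snd_conv; elim conjE; hypsubst;
            simp add: scale_right_distrib scale_right_diff_distrib algebra_simps eval_nat_numeral)
    qed
    show "(u x, u (u x) - u x') \<in> pair_span g" if x: "(x, x') \<in> g" for x x'
    proof -
      obtain m z where z: "z \<in> A" "(x, x') = F1 m z \<or> (x, x') = F2 m z \<or> (x, x') = F3 m z \<or> (x, x') = F4 m z"
        using gE[OF x] by blast
      have e: "a - c *s a = d *s a" "a - d *s a = c *s a" for a
        using cd by (metis scale_left_diff_distrib scale_one)+
      have e': "a - (c *s a + b) = d *s a - b" "a - (d *s a - b) = c *s a + b" "a - (c *s a - b) = d *s a + b"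
         "a - (d *s a + b) = c *s a - b" for a b
        using e[of a] by (simp_all add: algebra_simps)
      show ?thesis using z(2) g(2)[OF z(1), of m] g(1)[OF z(1), of "Suc m"] g(4)[OF z(1), of m] g(3)[OF z(1), of "Suc m"]
        by (elim disjE) (simp_all add: F u_simps u_up2 e' scale_right_distrib eval_nat_numeral)
    qed
  qed
qed

end

lemma (in hermitian_space) nondegD:
  "nondeg S \<Longrightarrow> x \<in> S \<Longrightarrow> (\<And>y. y \<in> S \<Longrightarrow> q y x = 0) \<Longrightarrow> x = 0"
  unfolding nondeg_def by blast

context selfadjoint_operator
begin

lemma splitting_operator:
  assumes "splits X" "nondeg X"
  obtains v where "\<And>x. x \<in> X \<Longrightarrow> v x \<in> X" "\<And>x y. x \<in> X \<Longrightarrow> y \<in> X \<Longrightarrow> v (x + y) = v x + v y"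
    "\<And>a x. x \<in> X \<Longrightarrow> v (a *s x) = a *s v x"
    "\<And>x y. x \<in> X \<Longrightarrow> y \<in> X \<Longrightarrow> q (v x) y = q x (v y)"
    "\<And>x. x \<in> X \<Longrightarrow> v (v x) = 0" "\<And>x. x \<in> X \<Longrightarrow> v (u x) = u (u x) - u (v x)"
proof -
  obtain \<Gamma> where "splitting_graph X \<Gamma>" using assms(1) unfolding splits_def by blast
  note G = splitting_graphD[OF this]
  have sX: "subspace X" using assms(1) unfolding splits_def by blast
  have X: "x \<in> X" "x' \<in> X" if "(x, x') \<in> \<Gamma>" for x x' using that G(4) by auto
  have unique: "y = z" if yz: "(x, y) \<in> \<Gamma>" "(x, z) \<in> \<Gamma>" for x y z
  proof -
    have "q w (y - z) = 0" if "w \<in> X" for w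
    proof -
      obtain w' where w: "(w, w') \<in> \<Gamma>" using \<open>w \<in> X\<close> G(5) by fastforce
      have "q w' x = q w y" "q w' x = q w z" using G(6)[OF w yz(1)] G(6)[OF w yz(2)] by auto
      then show ?thesis by (simp add: q_simps)
    qed
    moreover have "y - z \<in> X" by (rule subspace_diff[OF sX X(2)[OF yz(1)] X(2)[OF yz(2)]])
    ultimately have "y - z = 0" using assms(2) unfolding nondeg_def by blast
    then show ?thesis by simp
  qed
  define v where "v x = (SOME y. (x, y) \<in> \<Gamma>)" for x
  have v: "(x, v x) \<in> \<Gamma>" if "x \<in> X" for x
    unfolding v_def by (rule someI_ex) (use that G(5) in fastforce)
  have vI: "v x = y" if "(x, y) \<in> \<Gamma>" for x y
    by (rule unique[OF v[OF X(1)[OF that]] that])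
  show thesis
  proof (rule that)
    show "v x \<in> X" if "x \<in> X" for x using X(2)[OF v[OF that]] .
    show "v (x + y) = v x + v y" if "x \<in> X" "y \<in> X" for x y
      by (rule vI[OF G(2)[OF v[OF that(1)] v[OF that(2)]]])
    show "v (a *s x) = a *s v x" if "x \<in> X" for a x by (rule vI[OF G(3)[OF v[OF that]]])
    show "q (v x) y = q x (v y)" if "x \<in> X" "y \<in> X" for x y
      by (rule G(6)[OF v[OF that(1)] v[OF that(2)]])
    show "v (v x) = 0" if "x \<in> X" for x by (rule vI[OF G(7)[OF v[OF that]]])
    show "v (u x) = u (u x) - u (v x)" if "x \<in> X" for x by (rule vI[OF G(8)[OF v[OF that]]])
  qed
qed

lemma orbit_Un: "orbit (S \<union> T) = {x + y | x y. x \<in> orbit S \<and> y \<in> orbit T}"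
proof -
  have "(\<Union>m. (u ^^ m) ` (S \<union> T)) = (\<Union>m. (u ^^ m) ` S) \<union> (\<Union>m. (u ^^ m) ` T)" by blast
  then show ?thesis unfolding orbit_def by (simp only: span_Un)
qed

lemma up_span: "x \<in> span S \<Longrightarrow> (u ^^ m) x \<in> span ((u ^^ m) ` S)"
proof (induction rule: span_induct_alt)
  case (step c x y)
  then show ?case by (simp add: up_simps span_add span_scale span_base)
qed (simp add: span_zero)

lemma orbit_subset: "S \<subseteq> span T \<Longrightarrow> orbit S \<subseteq> orbit T"
  unfolding orbit_def[of S]
proof (rule span_minimal[OF _ orbit_subspace], safe)
  fix m x assume "S \<subseteq> span T" "x \<in> S"
  then have "(u ^^ m) x \<in> span ((u ^^ m) ` T)" using up_span by blast
  then show "(u ^^ m) x \<in> orbit T"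
    unfolding orbit_def using span_mono[of "(u ^^ m) ` T" "\<Union>m. (u ^^ m) ` T"] by blast
qed

text \<open>Embeddings obtained by choosing representatives need not be linear. Interpolating j
  linearly from its values on a basis of A keeps the identity of forms, because both sides are
  sesquilinear and agree on the basis.\<close>

lemma linear_representative:
  assumes "subspace A" and j: "\<And>x y. x \<in> A \<Longrightarrow> y \<in> A \<Longrightarrow> q (j x) ((u ^^ r) (j y)) = - q x ((u ^^ s) y)"
    and "\<And>x. x \<in> A \<Longrightarrow> j x \<in> S" "subspace S"
  obtains f where "\<And>x y. f (x + y) = f x + f y" "\<And>a x. f (a *s x) = a *s f x"
    "\<And>x. x \<in> A \<Longrightarrow> f x \<in> S" "\<And>x y. x \<in> A \<Longrightarrow> y \<in> A \<Longrightarrow> q (f x) ((u ^^ r) (f y)) = - q x ((u ^^ s) y)"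
proof -
  obtain B where B: "B \<subseteq> A" "independent B" "A \<subseteq> span B" using maximal_independent_subset[of A] by blast
  have A: "A = span B" using B assms(1) by (simp add: span_minimal subset_antisym)
  interpret p: vector_space_pair scale scale ..
  define f where "f = p.construct B j"
  have lin: "Vector_Spaces.linear scale scale f" unfolding f_def by (rule p.linear_construct[OF B(2)])
  then have f1: "f (x + y) = f x + f y" "f (a *s x) = a *s f x" for x y a
    by (simp_all add: Vector_Spaces.linear_iff)
  have f0: "f 0 = 0" using f1(2)[of 0 0] by simp
  have fB: "f b = j b" if "b \<in> B" for b unfolding f_def using that by (rule p.construct_basis[OF B(2)])
  have "f x \<in> S" if "x \<in> span B" for x
    using that
  proof (induction rule: span_induct_alt)
    case (step a x y)
    then show ?case using fB assms(3,4) B(1) by (auto simp: f1 intro!: subspace_add subspace_scale)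
  qed (use f0 assms(4) in \<open>simp add: subspace_0\<close>)
  moreover have 1: "q (f x) ((u ^^ r) (f b)) = - q x ((u ^^ s) b)" if "x \<in> span B" "b \<in> B" for x b
    using that(1)
  proof (induction rule: span_induct_alt)
    case (step a x y)
    then have "q (j x) ((u ^^ r) (j b)) = - q x ((u ^^ s) b)" using j B(1) that(2) by blast
    with step show ?case by (simp add: f1 fB[OF that(2)] fB q_simps algebra_simps)
  qed (simp add: f0)
  have "q (f x) ((u ^^ r) (f y)) = - q x ((u ^^ s) y)" if "y \<in> span B" "x \<in> span B" for x y
    using that(1)
    by (induction rule: span_induct_alt) (simp_all add: f0 f1 q_simps up_simps 1[OF that(2)] algebra_simps)
  ultimately show thesis using that[of f] f1 A by blast
qed

end

section \<open>Sufficiency\<close>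

locale nilpotent_form = selfadjoint_operator +
  fixes X :: "'b set" and E :: "nat \<Rightarrow> 'b set" and K :: nat
  assumes fX: "fin_sp X" and nX: "nondeg X" and uX: "x \<in> X \<Longrightarrow> u x \<in> X"
    and nil: "x \<in> X \<Longrightarrow> (u ^^ K) x = 0" and NF: "normal_form X E"
begin

lemma sX: "subspace X" using fX by (rule fin_sp_subspace)

lemma upX: "x \<in> X \<Longrightarrow> (u ^^ p) x \<in> X"
  by (induction p) (auto simp: funpow.simps(2) uX)

lemma E_subspace: "subspace (E n)" and E_X: "E n \<subseteq> X"
  and E_killed: "x \<in> E n \<Longrightarrow> (u ^^ n) x = 0"
  using NF by (simp_all add: normal_form_def)

lemma E_same: "x \<in> E n \<Longrightarrow> y \<in> E n \<Longrightarrow> Suc p \<noteq> n \<Longrightarrow> q x ((u ^^ p) y) = 0"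
  using NF by (simp add: normal_form_def)

lemma E_diff: "x \<in> E n \<Longrightarrow> y \<in> E m \<Longrightarrow> n \<noteq> m \<Longrightarrow> q x ((u ^^ p) y) = 0"
  using NF by (simp add: normal_form_def)

lemma X_orbit: "X \<subseteq> orbit (\<Union>n. E n)"
proof -
  have "(\<Union>n m. (u ^^ m) ` E n) = (\<Union>m. (u ^^ m) ` (\<Union>n. E n))" by blast
  then show ?thesis using NF by (simp add: normal_form_def orbit_def)
qed

lemma ker_decomp:
  assumes "x \<in> X" "(u ^^ n) x = 0"
  obtains e z w where "e \<in> E n" "z \<in> X" "w \<in> X" "(u ^^ (n - 1)) z = 0" "(u ^^ Suc n) w = 0"
    "x = e + z + u w"
proof -
  have "\<forall>n. \<forall>x\<in>X. (u ^^ n) x = 0 \<longrightarrow>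
        (\<exists>e\<in>E n. \<exists>z\<in>X. \<exists>w\<in>X. (u ^^ (n - 1)) z = 0 \<and> (u ^^ Suc n) w = 0 \<and> x = e + z + u w)"
    using NF unfolding normal_form_def by (elim conjE) assumption
  from this[rule_format, OF assms] show thesis using that by (elim bexE conjE) assumption
qed

text \<open>By the orthogonality relations, e pairs with the generators of X only through
  \<open>E n\<close> at exponent n - 1. If those products vanish too, e is orthogonal to X.\<close>

lemma E_nondeg:
  assumes "e \<in> E n" "\<And>f. f \<in> E n \<Longrightarrow> q f ((u ^^ (n - 1)) e) = 0"
  shows "e = 0"
proof -
  have "q e y = 0" if "y \<in> X" for y
  proof (rule orbit_perp[of "{e}"])
    show "y \<in> orbit (\<Union>n. E n)" using that X_orbit by blast
    show "e \<in> orbit {e}" using orbit_base[of e "{e}" 0] by simp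
    fix x y p assume xy: "x \<in> {e}" "y \<in> (\<Union>n. E n)"
    then obtain m where m: "y \<in> E m" by blast
    show "q x ((u ^^ p) y) = 0"
    proof (cases "m = n \<and> Suc p = n")
      case True
      then have "q y ((u ^^ p) e) = 0" using assms(2)[of y] m by auto
      then show ?thesis using lev.q_swap_0 xy by blast
    next
      case False
      then show ?thesis using xy m E_same[OF assms(1), of y p] E_diff[OF assms(1) m, of p] by blast
    qed
  qed
  then show ?thesis using nX assms(1) E_X unfolding nondeg_def using q_swap_0 by blast
qed

lemma E_large: "n > K \<Longrightarrow> E n = {0}"
proof -
  assume "n > K"
  have "e = 0" if "e \<in> E n" for e
  proof (rule E_nondeg[OF that])
    have "(u ^^ K) e = 0" using nil that E_X by blast
    then have "(u ^^ (n - 1)) e = 0" by (rule up_zero_mono) (use \<open>n > K\<close> in simp)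
    then show "q f ((u ^^ (n - 1)) e) = 0" for f by simp
  qed
  then show ?thesis using subspace_0[OF E_subspace] by blast
qed

section \<open>The blocks of odd length and their accumulation\<close>

definition G :: "nat \<Rightarrow> 'b set" where "G k = E (2 * k + 1)"

lemma G_subspace: "subspace (G k)" and G_X: "G k \<subseteq> X" and G_large: "k \<ge> K \<Longrightarrow> G k = {0}"
  using E_large by (auto simp: G_def E_subspace E_X)

lemma G_same: "x \<in> G k \<Longrightarrow> y \<in> G k \<Longrightarrow> p \<noteq> 2 * k \<Longrightarrow> q x ((u ^^ p) y) = 0"
  unfolding G_def by (erule E_same) auto

lemma G_diff: "x \<in> G k \<Longrightarrow> y \<in> G l \<Longrightarrow> k \<noteq> l \<Longrightarrow> q x ((u ^^ p) y) = 0"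
  unfolding G_def by (erule E_diff) auto

lemma G_fin: "fin_sp (G k)" using fin_sp_mono[OF fX G_subspace G_X] .

lemma G_nondeg: "lev.nondeg (2 * k) (G k)"
  unfolding lev.nondeg_def
proof (intro ballI impI)
  fix x assume x: "x \<in> G k" "\<forall>y\<in>G k. q y ((u ^^ (2 * k)) x) = 0"
  have "q f ((u ^^ (2 * k + 1 - 1)) x) = 0" if "f \<in> E (2 * k + 1)" for f
    using x(2) that unfolding G_def by simp
  then show "x = 0" using E_nondeg[of x "2 * k + 1"] x(1) unfolding G_def by blast
qed

text \<open>With the form \<open>q x (u^(2k) y)\<close>, \<open>F k\<close> is the orthogonal sum of the forms \<open>G i\<close> with \<open>i \<ge> k\<close>.\<close>

definition F :: "nat \<Rightarrow> 'b set" where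
  "F k = span (\<Union>i\<in>{k..}. (u ^^ (i - k)) ` G i)"

lemma F_subspace: "subspace (F k)" by (simp add: F_def)

lemma F_X: "F k \<subseteq> X"
  unfolding F_def by (rule span_minimal[OF _ sX]) (use G_X upX in blast)

lemma F_fin: "fin_sp (F k)" using fin_sp_mono[OF fX F_subspace F_X] .

lemma G_F: "G k \<subseteq> F k"
proof
  fix x assume "x \<in> G k"
  then have "x \<in> (u ^^ (k - k)) ` G k" by simp
  then show "x \<in> F k" unfolding F_def by (intro span_base) blast
qed

lemma u_F: "x \<in> F (Suc k) \<Longrightarrow> u x \<in> F k"
  unfolding F_def[of "Suc k"]
proof (induction rule: span_induct_alt)
  case (step a x y)
  then obtain i g where "Suc k \<le> i" "g \<in> G i" "x = (u ^^ (i - Suc k)) g" by auto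
  then have "u x = (u ^^ (i - k)) g" by (simp add: u_up2 Suc_diff_Suc)
  then have "u x \<in> F k" unfolding F_def using \<open>Suc k \<le> i\<close> \<open>g \<in> G i\<close> by (intro span_base) auto
  then show ?case using step F_subspace by (simp add: u_simps subspace_add subspace_scale)
qed (simp add: subspace_0[OF F_subspace])

text \<open>The recursion behind the descending inductions. Since q (u x) (u^(2k) (u y)) = q x
  (u^(2k+2) y), the map u carries the form of level 2 * Suc k on \<open>F (Suc k)\<close> to that of
  level 2 * k, and by \<open>G_F_perp\<close> the two summands are orthogonal.\<close>

lemma F_decomp: "x \<in> F k \<Longrightarrow> \<exists>e\<in>G k. \<exists>f\<in>F (Suc k). x = e + u f"
  unfolding F_def[of k]
proof (induction rule: span_induct_alt)
  case base
  then show ?case using subspace_0[OF F_subspace] subspace_0[OF G_subspace]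
    by (intro bexI[of _ 0]) auto
next
  case (step a x y)
  then obtain e f where ef: "e \<in> G k" "f \<in> F (Suc k)" "y = e + u f" by blast
  obtain i g where i: "k \<le> i" "g \<in> G i" "x = (u ^^ (i - k)) g" using step(1) by auto
  show ?case
  proof (cases "i = k")
    case True
    then show ?thesis using ef i G_subspace
      by (intro bexI[of _ "a *s g + e"] bexI[of _ f]) (auto simp: subspace_add subspace_scale)
  next
    case False
    then have "x = u ((u ^^ (i - Suc k)) g)" using i by (simp add: u_up2 Suc_diff_Suc)
    moreover have "(u ^^ (i - Suc k)) g \<in> F (Suc k)"
      unfolding F_def using i False by (intro span_base) auto
    ultimately show ?thesis using ef F_subspace
      by (intro bexI[of _ e] bexI[of _ "a *s (u ^^ (i - Suc k)) g + f"])
         (auto simp: subspace_add subspace_scale u_simps)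
  qed
qed

lemma G_F_perp:
  assumes "e \<in> G k" "f \<in> F l" "l > k"
  shows "q e ((u ^^ p) f) = 0"
proof -
  have "q ((u ^^ p) f) e = 0"
    using assms(2) unfolding F_def
  proof (induction rule: span_induct_alt)
    case (step a x y)
    then obtain i g where i: "l \<le> i" "g \<in> G i" "x = (u ^^ (i - l)) g" by auto
    have "q e ((u ^^ p) x) = 0" using G_diff[OF assms(1) i(2)] assms(3) i by simp
    then have "q ((u ^^ p) x) e = 0" using q_swap_0 by blast
    with step show ?case by (simp add: up_simps q_simps)
  qed simp
  then show ?thesis using q_swap_0 by blast
qed

lemma F_G_perp: "e \<in> G k \<Longrightarrow> f \<in> F l \<Longrightarrow> l > k \<Longrightarrow> q f ((u ^^ p) e) = 0"
  using G_F_perp lev.q_swap_0 by blast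

lemma F_large: "k \<ge> K \<Longrightarrow> F k = {0}"
proof -
  assume "k \<ge> K"
  then have "(\<Union>i\<in>{k..}. (u ^^ (i - k)) ` G i) \<subseteq> {0}" using G_large by fastforce
  from span_mono[OF this] have "F k \<subseteq> {0}" unfolding F_def by simp
  then show ?thesis using subspace_0[OF F_subspace] by blast
qed

lemma F_nondeg: "lev.nondeg (2 * k) (F k)"
proof (induction "K - k" arbitrary: k)
  case 0
  then show ?case using F_large[of k] by (simp add: lev.nondeg_def)
next
  case (Suc d)
  have IH: "lev.nondeg (2 * Suc k) (F (Suc k))" by (rule Suc.hyps(1)) (use Suc.hyps(2) in simp)
  show ?case unfolding lev.nondeg_def
  proof (intro ballI impI)
    fix x assume x: "x \<in> F k" "\<forall>y\<in>F k. q y ((u ^^ (2 * k)) x) = 0"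
    obtain e f where ef: "e \<in> G k" "f \<in> F (Suc k)" "x = e + u f" using F_decomp[OF x(1)] by blast
    have "q y ((u ^^ (2 * k)) e) = 0" if "y \<in> G k" for y
    proof -
      have "q y ((u ^^ (2 * k)) x) = 0" by (rule x(2)[rule_format, OF subsetD[OF G_F that]])
      then show ?thesis using G_F_perp[OF that ef(2)] by (simp add: ef(3) q_simps up_simps u_up2)
    qed
    then have "e = 0" by (rule lev.nondegD[OF G_nondeg ef(1)])
    moreover have "q y ((u ^^ (2 * Suc k)) f) = 0" if "y \<in> F (Suc k)" for y
    proof -
      have "q (u y) ((u ^^ (2 * k)) x) = 0" by (rule x(2)[rule_format, OF u_F[OF that]])
      then show ?thesis by (simp add: ef(3) \<open>e = 0\<close> u_sa u_up2)
    qed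
    then have "f = 0" by (rule lev.nondegD[OF IH ef(2)])
    ultimately show "x = 0" by (simp add: ef(3))
  qed
qed

text \<open>Condition (ii) at k in terms of representatives. No linearity is asked of j, so that
  choice functions qualify; \<open>linear_representative\<close> supplies it.\<close>

definition anti_embeds :: "nat \<Rightarrow> 'b set \<Rightarrow> bool" where
  "anti_embeds k A \<longleftrightarrow> (\<exists>j. (\<forall>a\<in>A. j a \<in> G k) \<and>
     (\<forall>a\<in>A. \<forall>b\<in>A. q (j a) ((u ^^ (2 * k)) (j b)) = - q a ((u ^^ (2 * Suc k)) b)))"

end

lemma (in hermitian_space) witt_decomposition':
  assumes "fin_sp F" "nondeg F"
  obtains B C A where "B \<subseteq> F" "C \<subseteq> F" "\<And>x y. x \<in> span B \<Longrightarrow> y \<in> span B \<Longrightarrow> q x y = 0"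
    "\<And>x y. x \<in> span C \<Longrightarrow> y \<in> span C \<Longrightarrow> q x y = 0" "nondeg (span (B \<union> C))"
    "A = {x\<in>F. \<forall>y\<in>span (B \<union> C). q y x = 0}" "\<And>a. a \<in> A \<Longrightarrow> q a a = 0 \<Longrightarrow> a = 0"
    "\<And>x. x \<in> F \<Longrightarrow> \<exists>u\<in>span (B \<union> C). x - u \<in> A"
  apply (rule witt_decomposition[OF assms])
  subgoal premises p for B C A by (rule that[OF p(7-14)])
  done

context nilpotent_form
begin

text \<open>L is an isotropic half of the hyperbolic part of the orthogonal of f A in
  \<open>G k\<close>. The new isotropic space consists of u T, of L and of the graph vectors u a + f
  a. Orthogonality to u T and L reduces a vector of \<open>F k\<close> to one of u A + f A + A'; the
  graph vectors then remove everything but A'.\<close>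

lemma linked_reduction:
  assumes red: "lev.aniso_reduction (2 * Suc k) (F (Suc k)) T A" and A: "A \<subseteq> G (Suc k)"
    and f_add: "\<And>x y. f (x + y) = f x + f y" and f_scale: "\<And>a x. f (a *s x) = a *s f x"
    and fG: "\<And>x. x \<in> A \<Longrightarrow> f x \<in> G k"
    and anti: "\<And>x y. x \<in> A \<Longrightarrow> y \<in> A \<Longrightarrow> q (f x) ((u ^^ (2 * k)) (f y)) = - q x ((u ^^ (2 * Suc k)) y)"
    and L: "subspace L" "L \<subseteq> G k" "\<And>x y. x \<in> L \<Longrightarrow> y \<in> L \<Longrightarrow> q x ((u ^^ (2 * k)) y) = 0"
    "\<And>x y. x \<in> A \<Longrightarrow> y \<in> L \<Longrightarrow> q (f x) ((u ^^ (2 * k)) y) = 0"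
    and A': "subspace A'" "A' \<subseteq> G k" "\<And>x. x \<in> A' \<Longrightarrow> q x ((u ^^ (2 * k)) x) = 0 \<Longrightarrow> x = 0"
    "\<And>x y. x \<in> A \<Longrightarrow> y \<in> A' \<Longrightarrow> q (f x) ((u ^^ (2 * k)) y) = 0"
    "\<And>x y. x \<in> L \<Longrightarrow> y \<in> A' \<Longrightarrow> q x ((u ^^ (2 * k)) y) = 0"
    and dec: "\<And>x. x \<in> G k \<Longrightarrow> (\<And>z. z \<in> L \<Longrightarrow> q z ((u ^^ (2 * k)) x) = 0) \<Longrightarrow>
        \<exists>a\<in>A. \<exists>z\<in>L. \<exists>a'\<in>A'. x = f a + z + a'"
  shows "lev.aniso_reduction (2 * k) (F k) {u (t + a) + f a + z | t a z. t \<in> T \<and> a \<in> A \<and> z \<in> L} A'"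
    (is "lev.aniso_reduction _ _ ?T _")
proof -
  note d = lev.aniso_reductionD[OF red]
  have f0: "f 0 = 0" using f_scale[of 0 0] by simp
  have f_diff: "f (x - y) = f x - f y" for x y
  proof -
    have "f (x - y) + f y = f x" by (simp flip: f_add)
    then show ?thesis by (simp add: algebra_simps)
  qed
  define S where "S = {u (t + a) + f a + z | t a z. t \<in> T \<and> a \<in> A \<and> z \<in> L}"
  have TI: "u (t + a) + f a + z \<in> S" if "t \<in> T" "a \<in> A" "z \<in> L" for t a z using that unfolding S_def by blast
  have TE: thesis if "x \<in> S" "\<And>t a z. t \<in> T \<Longrightarrow> a \<in> A \<Longrightarrow> z \<in> L \<Longrightarrow> x = u (t + a) + f a + z \<Longrightarrow> thesis" for x thesis
    using that(1) unfolding S_def by (elim CollectE exE conjE) (rule that(2))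
  have uu: "q (u x) ((u ^^ (2 * k)) (u y)) = q x ((u ^^ (2 * Suc k)) y)" for x y
    by (simp add: u_sa u_up2)
  have gu: "q g ((u ^^ (2 * k)) (u x)) = 0" "q (u x) ((u ^^ (2 * k)) g) = 0" if "g \<in> G k" "x \<in> F (Suc k)" for g x
    using G_F_perp[OF that, of "Suc (2 * k)"] F_G_perp[OF that, of "Suc (2 * k)"] by (simp_all add: u_sa u_up2)
  have TF: "t + a \<in> F (Suc k)" if "t \<in> T" "a \<in> A" for t a
    by (rule subspace_add[OF d(1) subsetD[OF d(4) that(1)] subsetD[OF d(5) that(2)]])
  have Lf: "q y ((u ^^ (2 * k)) (f x)) = 0" if "x \<in> A" "y \<in> L" for x y using L(4)[OF that] lev.q_swap_0[of _ "2 * k"] by blast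
  have gG: "f a + z \<in> G k" if "a \<in> A" "z \<in> L" for a z
    by (rule subspace_add[OF G_subspace fG[OF that(1)] subsetD[OF L(2) that(2)]])
  have 0: "0 \<in> T" "0 \<in> A" "0 \<in> L" using d(2,3) L(1) subspace_0 by auto
  show ?thesis unfolding lev.aniso_reduction_def S_def[symmetric]
  proof (intro conjI ballI impI)
    show "subspace (F k)" by (rule F_subspace)
    show "subspace S"
    proof (rule subspaceI)
      show "0 \<in> S" using TI[OF 0] by (simp add: f0)
    next
      fix x y assume "x \<in> S" "y \<in> S"
      obtain t a z where *: "t \<in> T" "a \<in> A" "z \<in> L" "x = u (t + a) + f a + z" using TE[OF \<open>x \<in> S\<close>] .
      obtain t' a' z' where **: "t' \<in> T" "a' \<in> A" "z' \<in> L" "y = u (t' + a') + f a' + z'" using TE[OF \<open>y \<in> S\<close>] .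
      have "x + y = u ((t + t') + (a + a')) + f (a + a') + (z + z')"
        by (simp add: * ** u_simps f_add algebra_simps)
      moreover have "t + t' \<in> T" "a + a' \<in> A" "z + z' \<in> L"
        using * ** d(2,3) L(1) by (simp_all add: subspace_add)
      ultimately show "x + y \<in> S" using TI by metis
    next
      fix c x assume "x \<in> S"
      then obtain t a z where *: "t \<in> T" "a \<in> A" "z \<in> L" "x = u (t + a) + f a + z" by (rule TE)
      have "c *s x = u (c *s t + c *s a) + f (c *s a) + c *s z"
        by (simp add: * u_simps f_scale scale_right_distrib)
      moreover have "c *s t \<in> T" "c *s a \<in> A" "c *s z \<in> L"
        using * d(2,3) L(1) by (simp_all add: subspace_scale)
      ultimately show "c *s x \<in> S" using TI by metis
    qed
    show "subspace A'" by (rule A')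
    show "A' \<subseteq> F k" using A'(2) G_F by blast
    show "S \<subseteq> F k"
    proof
      fix x assume "x \<in> S"
      then obtain t a z where *: "t \<in> T" "a \<in> A" "z \<in> L" "x = u (t + a) + f a + z" by (rule TE)
      have "u (t + a) \<in> F k" "f a + z \<in> F k"
        using u_F[OF TF[OF *(1,2)]] gG[OF *(2,3)] G_F by auto
      then have "u (t + a) + (f a + z) \<in> F k" by (rule subspace_add[OF F_subspace])
      then show "x \<in> F k" by (simp add: *(4) add.assoc)
    qed
    show "q x ((u ^^ (2 * k)) y) = 0" if xy: "x \<in> S" "y \<in> S" for x y
    proof -
      obtain t a z where *: "t \<in> T" "a \<in> A" "z \<in> L" and x: "x = u (t + a) + f a + z" using TE[OF xy(1)] .
      obtain t' a' z' where **: "t' \<in> T" "a' \<in> A" "z' \<in> L" and y: "y = u (t' + a') + f a' + z'" using TE[OF xy(2)] .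
      note fa = fG[OF *(2)] fG[OF **(2)] subsetD[OF L(2) *(3)] subsetD[OF L(2) **(3)]
      have "q (u (t + a)) ((u ^^ (2 * k)) (u (t' + a'))) = q a ((u ^^ (2 * Suc k)) a')"
        unfolding uu up_add q_add_left q_add_right d(6)[OF *(1) **(1)] d(7)[OF *(1) **(2)] d(8)[OF **(1) *(2)]
        by simp
      moreover have "q (f a) ((u ^^ (2 * k)) (f a')) = - q a ((u ^^ (2 * Suc k)) a')"
        by (rule anti[OF *(2) **(2)])
      moreover have "q (u (t + a)) ((u ^^ (2 * k)) (f a')) = 0" "q (f a) ((u ^^ (2 * k)) (u (t' + a'))) = 0"
        "q (u (t + a)) ((u ^^ (2 * k)) z') = 0" "q z ((u ^^ (2 * k)) (u (t' + a'))) = 0"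
        by (rule gu(2)[OF fa(2) TF[OF *(1,2)]] gu(1)[OF fa(1) TF[OF **(1,2)]]
              gu(2)[OF fa(4) TF[OF *(1,2)]] gu(1)[OF fa(3) TF[OF **(1,2)]])+
      moreover have "q (f a) ((u ^^ (2 * k)) z') = 0" "q z ((u ^^ (2 * k)) (f a')) = 0" "q z ((u ^^ (2 * k)) z') = 0"
        by (rule L(4)[OF *(2) **(3)] Lf[OF **(2) *(3)] L(3)[OF *(3) **(3)])+
      ultimately show ?thesis unfolding x y by (simp only: q_add_left up_add q_add_right) simp
    qed
    show "q x ((u ^^ (2 * k)) y) = 0" if xy: "x \<in> S" "y \<in> A'" for x y
    proof -
      obtain t a z where *: "t \<in> T" "a \<in> A" "z \<in> L" and x: "x = u (t + a) + f a + z" using TE[OF xy(1)] .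
      have "q (u (t + a)) ((u ^^ (2 * k)) y) = 0" by (rule gu(2)[OF subsetD[OF A'(2) xy(2)] TF[OF *(1,2)]])
      moreover have "q (f a) ((u ^^ (2 * k)) y) = 0" "q z ((u ^^ (2 * k)) y) = 0"
        by (rule A'(4)[OF *(2) xy(2)] A'(5)[OF *(3) xy(2)])+
      ultimately show ?thesis unfolding x by (simp only: q_add_left) simp
    qed
    show "x = 0" if "x \<in> A'" "q x ((u ^^ (2 * k)) x) = 0" for x using A'(3)[OF that] .
    fix x assume x: "x \<in> F k" and perp: "\<forall>t\<in>S. q t ((u ^^ (2 * k)) x) = 0"
    obtain e g where eg: "e \<in> G k" "g \<in> F (Suc k)" "x = e + u g" using F_decomp[OF x] by (elim bexE)
    have x1: "q (u y) ((u ^^ (2 * k)) x) = q y ((u ^^ (2 * Suc k)) g)" if "y \<in> F (Suc k)" for y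
    proof -
      have "q (u y) ((u ^^ (2 * k)) x) = q (u y) ((u ^^ (2 * k)) e) + q (u y) ((u ^^ (2 * k)) (u g))"
        by (simp only: eg(3) up_add q_add_right)
      then show ?thesis by (simp only: gu(2)[OF eg(1) that] uu) simp
    qed
    have x2: "q y ((u ^^ (2 * k)) x) = q y ((u ^^ (2 * k)) e)" if "y \<in> G k" for y
      by (simp only: eg(3) up_add q_add_right gu(1)[OF that eg(2)]) simp
    have gT: "q t ((u ^^ (2 * Suc k)) g) = 0" if "t \<in> T" for t
    proof -
      have "q (u t) ((u ^^ (2 * k)) x) = 0" using perp[rule_format, OF TI[OF that 0(2,3)]] by (simp add: f0)
      then show ?thesis using x1[OF subsetD[OF d(4) that]] by simp
    qed
    obtain t a where ta: "t \<in> T" "a \<in> A" "g = t + a" using d(10)[OF eg(2)] gT by blast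
    have eL: "q z ((u ^^ (2 * k)) e) = 0" if "z \<in> L" for z
    proof -
      have "q z ((u ^^ (2 * k)) x) = 0" using perp[rule_format, OF TI[OF 0(1,2) that]] by (simp add: f0)
      then show ?thesis using x2[OF subsetD[OF L(2) that]] by simp
    qed
    obtain a2 z a' where e: "a2 \<in> A" "z \<in> L" "a' \<in> A'" "e = f a2 + z + a'" using dec[OF eg(1)] eL by blast
    \<comment> \<open>The vector x has component a in the copy u A and a2 in the copy f A. Testing
      against the graph vector of their difference yields the norm of a - a2, so nonisotropy of A
      makes the two components equal, and together they form a graph vector.\<close>
    define a1 where "a1 = a - a2"
    have a1: "a1 \<in> A" using subspace_diff[OF d(3)] ta e by (simp add: a1_def)
    have "q (u a1 + f a1) ((u ^^ (2 * k)) x) = 0" using perp[rule_format, OF TI[OF 0(1) a1 0(3)]] by simp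
    moreover have "q (u a1) ((u ^^ (2 * k)) x) = q a1 ((u ^^ (2 * Suc k)) a)"
      unfolding x1[OF subsetD[OF d(5) a1]] ta(3) up_add q_add_right d(8)[OF ta(1) a1] by simp
    moreover have "q (f a1) ((u ^^ (2 * k)) x) = - q a1 ((u ^^ (2 * Suc k)) a2)"
      unfolding x2[OF fG[OF a1]] e(4) up_add q_add_right anti[OF a1 e(1)] L(4)[OF a1 e(2)] A'(4)[OF a1 e(3)] by simp
    ultimately have "q a1 ((u ^^ (2 * Suc k)) a) - q a1 ((u ^^ (2 * Suc k)) a2) = 0" by (simp only: q_add_left) simp
    then have "q a1 ((u ^^ (2 * Suc k)) a1) = 0" unfolding a1_def up_diff q_diff_right .
    then have "a1 = 0" by (rule d(9)[OF a1])
    then have "x = (u (t + a) + f a + z) + a'" using eg(3) e(4) ta(3) by (simp add: a1_def algebra_simps)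
    then show "\<exists>t\<in>S. \<exists>a\<in>A'. x = t + a" by (intro bexI[OF _ TI[OF ta(1,2) e(2)]] bexI[OF _ e(3)])
  qed
qed

text \<open>The hypothesis provides an embedding for some nonisotropic part A0, while the descent
  needs one for the A that it has just constructed.\<close>

lemma anti_embedding_transfer:
  assumes "lev.aniso_reduction (2 * Suc k) (F (Suc k)) T A" "lev.aniso_reduction (2 * Suc k) (F (Suc k)) T0 A0"
    "anti_embeds k A0"
  obtains f where "\<And>x y. f (x + y) = f x + f y" "\<And>a x. f (a *s x) = a *s f x"
    "\<And>x. x \<in> A \<Longrightarrow> f x \<in> G k"
    "\<And>x y. x \<in> A \<Longrightarrow> y \<in> A \<Longrightarrow> q (f x) ((u ^^ (2 * k)) (f y)) = - q x ((u ^^ (2 * Suc k)) y)"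
proof -
  obtain h where h: "\<And>a. a \<in> A \<Longrightarrow> h a \<in> A0"
    "\<And>a b. a \<in> A \<Longrightarrow> b \<in> A \<Longrightarrow> q (h a) ((u ^^ (2 * Suc k)) (h b)) = q a ((u ^^ (2 * Suc k)) b)"
    using lev.aniso_reduction_unique[OF F_fin assms(1,2)] by blast
  obtain j where j: "\<And>a. a \<in> A0 \<Longrightarrow> j a \<in> G k"
    "\<And>a b. a \<in> A0 \<Longrightarrow> b \<in> A0 \<Longrightarrow> q (j a) ((u ^^ (2 * k)) (j b)) = - q a ((u ^^ (2 * Suc k)) b)"
    using assms(3) unfolding anti_embeds_def by blast
  have "q (j (h a)) ((u ^^ (2 * k)) (j (h b))) = - q a ((u ^^ (2 * Suc k)) b)" if "a \<in> A" "b \<in> A" for a b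
    by (simp only: j(2)[OF h(1)[OF that(1)] h(1)[OF that(2)]] h(2)[OF that])
  from linear_representative[OF lev.aniso_reductionD(3)[OF assms(1)] this j(1)[OF h(1)] G_subspace] that
  show thesis by blast
qed

text \<open>One step down splits the linked cell of \<open>A\<close> and its image in \<open>G k\<close>; the orthogonal of this image
  in \<open>G k\<close> is a hyperbolic part plus a nonisotropic \<open>A'\<close>, which is again a nonisotropic part of
  \<open>F k\<close> by \<open>linked_reduction\<close>.\<close>

lemma splits_tower:
  assumes H: "\<And>k. \<exists>T A. lev.aniso_reduction (2 * Suc k) (F (Suc k)) T A \<and> anti_embeds k A"
  shows "A \<subseteq> G N \<Longrightarrow> lev.aniso_reduction (2 * N) (F N) T A \<Longrightarrow> splits (orbit (A \<union> (\<Union>i<N. G i)))"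
proof (induction N arbitrary: A T)
  case 0
  \<comment> \<open>At the bottom only a subspace of \<open>G 0 = E 1\<close> is left, which u
    kills.\<close>
  show ?case by (rule splits_killed) (use 0 E_killed[of _ 1] in \<open>auto simp: G_def funpow.simps(2)\<close>)
next
  case (Suc k)
  note red = Suc.prems(2) and AG = Suc.prems(1)
  note d = lev.aniso_reductionD[OF red]
  obtain T0 A0 where "lev.aniso_reduction (2 * Suc k) (F (Suc k)) T0 A0" "anti_embeds k A0" using H by blast
  from anti_embedding_transfer[OF red this] obtain f where
    f_add: "\<And>x y. f (x + y) = f x + f y" and f_scale: "\<And>a x. f (a *s x) = a *s f x"
    and fG: "\<And>x. x \<in> A \<Longrightarrow> f x \<in> G k"
    and anti: "\<And>x y. x \<in> A \<Longrightarrow> y \<in> A \<Longrightarrow> q (f x) ((u ^^ (2 * k)) (f y)) = - q x ((u ^^ (2 * Suc k)) y)"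
    by blast
  have f0: "f 0 = 0" using f_scale[of 0 0] by simp
  define Y where "Y = f ` A"
  have YI: "f a \<in> Y" if "a \<in> A" for a using that by (simp add: Y_def)
  have sY: "subspace Y"
  proof (rule subspaceI)
    show "0 \<in> Y" using YI[OF subspace_0[OF d(3)]] by (simp add: f0)
    show "x + y \<in> Y" if "x \<in> Y" "y \<in> Y" for x y
      using that d(3) by (auto simp: Y_def subspace_add simp flip: f_add)
    show "c *s x \<in> Y" if "x \<in> Y" for c x
      using that d(3) by (auto simp: Y_def subspace_scale simp flip: f_scale)
  qed
  have YG: "Y \<subseteq> G k" using fG by (auto simp: Y_def)
  have fY: "fin_sp Y" by (rule fin_sp_mono[OF G_fin sY YG])
  have nY: "lev.nondeg (2 * k) Y" unfolding lev.nondeg_def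
  proof (intro ballI impI)
    fix y assume y: "y \<in> Y" "\<forall>z\<in>Y. q z ((u ^^ (2 * k)) y) = 0"
    then obtain a where a: "a \<in> A" "y = f a" by (auto simp: Y_def)
    have "q (f a) ((u ^^ (2 * k)) (f a)) = 0" using y(2) y(1) a(2) by simp
    then have "q a ((u ^^ (2 * Suc k)) a) = 0" unfolding anti[OF a(1) a(1)] by simp
    then have "a = 0" by (rule d(9)[OF a(1)])
    then show "y = 0" by (simp add: a f0)
  qed
  \<comment> \<open>Y inherits nondegeneracy from the nonisotropic A through f, so
    \<open>G k\<close> is the orthogonal sum of Y and C, and C is nondegenerate in its turn.\<close>
  define C where "C = {x \<in> G k. \<forall>y\<in>Y. q y ((u ^^ (2 * k)) x) = 0}"
  have sC: "subspace C" unfolding C_def by (rule lev.subspace_perp[OF G_subspace])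
  have CG: "C \<subseteq> G k" by (auto simp: C_def)
  have fC: "fin_sp C" by (rule fin_sp_mono[OF G_fin sC CG])
  have nC: "lev.nondeg (2 * k) C" unfolding C_def
    by (rule lev.nondeg_perp[OF fY nY YG G_subspace G_nondeg])
  have CY: "q (f a) ((u ^^ (2 * k)) x) = 0" if "x \<in> C" "a \<in> A" for a x
    using that YI by (auto simp: C_def)
  obtain B B' A' where W: "B \<subseteq> C" "B' \<subseteq> C"
    "\<And>x y. x \<in> span B \<Longrightarrow> y \<in> span B \<Longrightarrow> q x ((u ^^ (2 * k)) y) = 0"
    "\<And>x y. x \<in> span B' \<Longrightarrow> y \<in> span B' \<Longrightarrow> q x ((u ^^ (2 * k)) y) = 0"
    "lev.nondeg (2 * k) (span (B \<union> B'))"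
    "A' = {x \<in> C. \<forall>y\<in>span (B \<union> B'). q y ((u ^^ (2 * k)) x) = 0}"
    "\<And>a. a \<in> A' \<Longrightarrow> q a ((u ^^ (2 * k)) a) = 0 \<Longrightarrow> a = 0"
    "\<And>x. x \<in> C \<Longrightarrow> \<exists>w\<in>span (B \<union> B'). x - w \<in> A'"
    apply (rule lev.witt_decomposition'[OF fC nC])
    subgoal premises p for B B' A' by (rule p(1)[OF p(2-9)])
    done
  have BC: "span B \<subseteq> C" "span B' \<subseteq> C" using W(1,2) sC by (simp_all add: span_minimal)
  have A'C: "A' \<subseteq> C" using W(6) by auto
  have sA': "subspace A'" unfolding W(6) by (rule lev.subspace_perp[OF sC])
  have BA': "q x ((u ^^ (2 * k)) y) = 0" if "x \<in> span B \<or> x \<in> span B'" "y \<in> A'" for x y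
  proof -
    have "x \<in> span (B \<union> B')" using that(1) span_mono[of B "B \<union> B'"] span_mono[of B' "B \<union> B'"] by auto
    then show ?thesis using that(2) W(6) by auto
  qed
  have dec0: "\<exists>a\<in>A. \<exists>z\<in>span B. \<exists>z'\<in>span B'. \<exists>a'\<in>A'. x = f a + (z + z') + a'" if x: "x \<in> G k" for x
  proof -
    obtain y where y: "y \<in> Y" "\<And>z. z \<in> Y \<Longrightarrow> q z ((u ^^ (2 * k)) (x - y)) = 0"
      using lev.nondeg_split[OF fY nY] by blast
    have "x - y \<in> G k" by (rule subspace_diff[OF G_subspace x subsetD[OF YG y(1)]])
    then have "x - y \<in> C" using y(2) by (simp add: C_def)
    from W(8)[OF this] obtain w where w: "w \<in> span (B \<union> B')" "x - y - w \<in> A'" by blast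
    obtain z z' where z: "z \<in> span B" "z' \<in> span B'" "w = z + z'" using w(1) by (auto simp: span_Un)
    obtain a where a: "a \<in> A" "y = f a" using y(1) by (auto simp: Y_def)
    have "x = f a + (z + z') + (x - y - w)" by (simp add: a z)
    then show ?thesis using a(1) z(1,2) w(2) by blast
  qed
  have dec: "\<exists>a\<in>A. \<exists>z\<in>span B. \<exists>a'\<in>A'. x = f a + z + a'"
    if x: "x \<in> G k" and perp: "\<And>z. z \<in> span B \<Longrightarrow> q z ((u ^^ (2 * k)) x) = 0" for x
  proof -
    obtain a z z' a' where e: "a \<in> A" "z \<in> span B" "z' \<in> span B'" "a' \<in> A'" "x = f a + (z + z') + a'"
      using dec0[OF x] by blast
    have 1: "q w ((u ^^ (2 * k)) z') = 0" if w: "w \<in> span B" for w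
    proof -
      have "q (f a) ((u ^^ (2 * k)) w) = 0" using CY[OF subsetD[OF BC(1) w] e(1)] .
      then have "q w ((u ^^ (2 * k)) (f a)) = 0" using lev.q_swap_0[of _ "2 * k"] by blast
      moreover have "q w ((u ^^ (2 * k)) z) = 0" "q w ((u ^^ (2 * k)) a') = 0"
        using W(3)[OF w e(2)] BA'[OF disjI1[OF w] e(4)] by auto
      ultimately show ?thesis using perp[OF w] unfolding e(5) up_add q_add_right by simp
    qed
    \<comment> \<open>Being orthogonal to B, and to B' by isotropy, z' lies in the radical of the
      hyperbolic part.\<close>
    have "z' = 0"
    proof (rule lev.nondegD[OF W(5)])
      show "z' \<in> span (B \<union> B')" using e(3) span_mono[of B' "B \<union> B'"] by auto
      fix y assume "y \<in> span (B \<union> B')"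
      then obtain w w' where "w \<in> span B" "w' \<in> span B'" "y = w + w'" by (auto simp: span_Un)
      then show "q y ((u ^^ (2 * k)) z') = 0" using 1 W(4) e(3) by (simp add: q_add_left)
    qed
    then show ?thesis using e by auto
  qed
  have red': "lev.aniso_reduction (2 * k) (F k) {u (t + a) + f a + z | t a z. t \<in> T \<and> a \<in> A \<and> z \<in> span B} A'"
  proof (rule linked_reduction[OF red AG f_add f_scale fG anti])
    show "span B \<subseteq> G k" "A' \<subseteq> G k" using BC A'C CG by auto
    show "q (f x) ((u ^^ (2 * k)) y) = 0" if "x \<in> A" "y \<in> span B" for x y
      using CY[OF subsetD[OF BC(1) that(2)] that(1)] .
    show "q (f x) ((u ^^ (2 * k)) y) = 0" if "x \<in> A" "y \<in> A'" for x y
      using CY[OF subsetD[OF A'C that(2)] that(1)] .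
    show "q x ((u ^^ (2 * k)) y) = 0" if "x \<in> span B" "y \<in> A'" for x y using BA' that by blast
  qed (use W(3,7) sA' dec in auto)
  have s3: "splits (orbit (A' \<union> (\<Union>i<k. G i)))" by (rule Suc.IH[OF order_trans[OF A'C CG] red'])
  have s1: "splits (orbit (A \<union> f ` A))"
  proof (rule splits_linked[where K = k])
    show "q x ((u ^^ p) y) = 0" if "x \<in> A" "y \<in> A" "p \<noteq> 2 * k + 2" for x y p
      by (rule G_same[OF subsetD[OF AG that(1)] subsetD[OF AG that(2)]]) (use that(3) in simp)
    show "q (f x) ((u ^^ p) (f y)) = 0" if "x \<in> A" "y \<in> A" "p \<noteq> 2 * k" for x y p
      by (rule G_same[OF fG[OF that(1)] fG[OF that(2)] that(3)])
    show "q x ((u ^^ p) (f y)) = 0" if "x \<in> A" "y \<in> A" for x y p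
      by (rule G_diff[OF subsetD[OF AG that(1)] fG[OF that(2)]]) simp
    show "q (f x) ((u ^^ (2 * k)) (f y)) = - q x ((u ^^ (2 * k + 2)) y)" if "x \<in> A" "y \<in> A" for x y
      using anti[OF that] by simp
  qed
  \<comment> \<open>Inside \<open>G k\<close> only the exponent 2 * k carries products, so
    orthogonality at that one level already separates the orbits.\<close>
  have Gperp: "q x ((u ^^ p) y) = 0"
    if "x \<in> G k" "y \<in> G k" "q x ((u ^^ (2 * k)) y) = 0" for x y p
    using G_same[OF that(1,2), of p] that(3) by (cases "p = 2 * k") auto
  have s2: "splits (orbit (span B \<union> span B'))"
  proof (rule splits_hyperbolic)
    show "q x ((u ^^ p) y) = 0" if "x \<in> span B" "y \<in> span B" for x y p
      using Gperp[OF _ _ W(3)[OF that]] that BC CG by blast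
    show "q x ((u ^^ p) y) = 0" if "x \<in> span B'" "y \<in> span B'" for x y p
      using Gperp[OF _ _ W(4)[OF that]] that BC CG by blast
    show "q x ((u ^^ p) y) = 0" if "x \<in> span B" "y \<in> span B'" "odd p" for x y p
    proof -
      have "x \<in> G k" "y \<in> G k" using that BC CG by auto
      moreover have "p \<noteq> 2 * k" using that(3) by auto
      ultimately show ?thesis by (rule G_same)
    qed
  qed
  have lower: "q x ((u ^^ p) y) = 0" if "x \<in> G k" "y \<in> (\<Union>i<k. G i)" for x y p
    using that(2) by (auto intro: G_diff[OF that(1)])
  have "splits {x + y |x y. x \<in> orbit (span B \<union> span B') \<and> y \<in> orbit (A' \<union> (\<Union>i<k. G i))}"
  proof (rule splits_add[OF s2 s3], rule orbit_perp)
    fix x y p assume xy: "x \<in> span B \<union> span B'" "y \<in> A' \<union> (\<Union>i<k. G i)"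
    have xG: "x \<in> G k" using xy(1) BC CG by auto
    show "q x ((u ^^ p) y) = 0"
    proof (cases "y \<in> A'")
      case True
      have "q x ((u ^^ (2 * k)) y) = 0" using BA' True xy(1) by blast
      then show ?thesis using Gperp[OF xG] True A'C CG by blast
    qed (use lower[OF xG] xy(2) in blast)
  qed
  then have s4: "splits (orbit ((span B \<union> span B') \<union> (A' \<union> (\<Union>i<k. G i))))" by (simp only: orbit_Un)
  have "splits {x + y |x y. x \<in> orbit (A \<union> f ` A) \<and> y \<in> orbit ((span B \<union> span B') \<union> (A' \<union> (\<Union>i<k. G i)))}"
  proof (rule splits_add[OF s1 s4], rule orbit_perp)
    fix x y p assume xy: "x \<in> A \<union> f ` A" "y \<in> (span B \<union> span B') \<union> (A' \<union> (\<Union>i<k. G i))"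
    have y: "y \<in> C \<or> y \<in> (\<Union>i<k. G i)" using xy(2) BC A'C by auto
    show "q x ((u ^^ p) y) = 0"
    proof (cases "x \<in> A")
      case True
      from y obtain i where "y \<in> G i" "i \<noteq> Suc k" using CG by fastforce
      then show ?thesis using G_diff[of x "Suc k" y i p] True AG by blast
    next
      case False
      then obtain a where a: "a \<in> A" "x = f a" using xy(1) by auto
      have xG: "x \<in> G k" using fG a by simp
      from y show ?thesis
      proof
        assume yC: "y \<in> C"
        show ?thesis using Gperp[OF xG subsetD[OF CG yC]] CY[OF yC a(1)] a(2) by blast
      qed (rule lower[OF xG])
    qed
  qed
  then have s5: "splits (orbit ((A \<union> f ` A) \<union> ((span B \<union> span B') \<union> (A' \<union> (\<Union>i<k. G i)))))"
    by (simp only: orbit_Un)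
  have "orbit ((A \<union> f ` A) \<union> ((span B \<union> span B') \<union> (A' \<union> (\<Union>i<k. G i)))) = orbit (A \<union> (\<Union>i<Suc k. G i))"
    (is "orbit ?L = orbit ?R")
  proof
    have "?L \<subseteq> ?R" using fG BC A'C CG by (auto simp: lessThan_Suc)
    then show "orbit ?L \<subseteq> orbit ?R" by (rule orbit_mono)
    have "G k \<subseteq> span ?L"
    proof
      fix x assume "x \<in> G k"
      from dec0[OF this] obtain a z z' a' where e: "a \<in> A" "z \<in> span B" "z' \<in> span B'" "a' \<in> A'"
        "x = f a + (z + z') + a'" by blast
      show "x \<in> span ?L" unfolding e(5) using e(1-4) by (intro span_add) (auto intro: span_base)
    qed
    moreover have "A \<union> (\<Union>i<k. G i) \<subseteq> span ?L" by (auto intro: span_base)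
    ultimately have "?R \<subseteq> span ?L" by (auto simp: lessThan_Suc)
    then show "orbit ?R \<subseteq> orbit ?L" by (rule orbit_subset)
  qed
  with s5 show ?case by simp
qed

text \<open>The descent starts at K, where F K = 0 admits the reduction with T = A = 0, and takes
  care of all odd blocks. The even blocks need no partner and are split together by
  \<open>splits_even\<close>.\<close>

theorem splits_if_anti_embeds:
  assumes H: "\<And>k. \<exists>T A. lev.aniso_reduction (2 * Suc k) (F (Suc k)) T A \<and> anti_embeds k A"
  shows "splits X"
proof -
  have "lev.aniso_reduction (2 * K) (F K) {0} {0}"
    by (simp add: lev.aniso_reduction_def F_large subspace_single_0)
  moreover have "{0} \<subseteq> G K" using subspace_0[OF G_subspace] by simp
  ultimately have s1: "splits (orbit ({0} \<union> (\<Union>i<K. G i)))" using splits_tower[OF H] by blast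
  have s2: "splits (orbit (\<Union>i. E (2 * i)))"
  proof (rule splits_even)
    fix x y p assume "x \<in> (\<Union>i. E (2 * i))" "y \<in> (\<Union>i. E (2 * i))"
    then obtain i j where ij: "x \<in> E (2 * i)" "y \<in> E (2 * j)" by blast
    have "Suc (2 * p) \<noteq> 2 * i" by presburger
    then show "q x ((u ^^ (2 * p)) y) = 0" using E_same[of x "2 * i" y] E_diff[OF ij] ij by (cases "i = j") auto
  qed
  have "splits {x + y |x y. x \<in> orbit ({0} \<union> (\<Union>i<K. G i)) \<and> y \<in> orbit (\<Union>i. E (2 * i))}"
  proof (rule splits_add[OF s1 s2], rule orbit_perp)
    fix x y p assume x: "x \<in> {0} \<union> (\<Union>i<K. G i)" and "y \<in> (\<Union>i. E (2 * i))"
    then obtain j where j: "y \<in> E (2 * j)" by blast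
    show "q x ((u ^^ p) y) = 0"
    proof (cases "x = 0")
      case False
      with x obtain i where i: "x \<in> E (2 * i + 1)" by (auto simp: G_def)
      have "2 * i + 1 \<noteq> 2 * j" by presburger
      then show ?thesis by (rule E_diff[OF i j])
    qed simp
  qed
  then have s3: "splits (orbit (({0} \<union> (\<Union>i<K. G i)) \<union> (\<Union>i. E (2 * i))))" by (simp only: orbit_Un)
  have "orbit (({0} \<union> (\<Union>i<K. G i)) \<union> (\<Union>i. E (2 * i))) = X" (is "orbit ?L = X")
  proof
    have "?L \<subseteq> X" using G_X E_X subspace_0[OF sX] by blast
    then show "orbit ?L \<subseteq> X" unfolding orbit_def by (intro span_minimal[OF _ sX]) (use upX in blast)
    have "E n \<subseteq> ?L" for n
    proof (cases n rule: even_or_odd_cases)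
      case (2 i)
      then have "E n = G i" by (simp add: G_def)
      then show ?thesis using G_large[of i] by (cases "i < K") auto
    qed auto
    then have "(\<Union>n. E n) \<subseteq> ?L" by blast
    then show "X \<subseteq> orbit ?L" using X_orbit orbit_mono by blast
  qed
  with s3 show ?thesis by simp
qed

end

section \<open>Necessity\<close>

lemma (in hermitian_space) double_perp_left:
  assumes "fin_sp S" "S \<subseteq> X" "subspace X" "nondeg X" "x \<in> X"
    and "\<And>y. y \<in> X \<Longrightarrow> \<forall>s\<in>S. q s y = 0 \<Longrightarrow> q y x = 0"
  shows "x \<in> S"
  using double_perp[OF assms(1-5)] assms(6) q_swap_0 by blast

lemma (in selfadjoint_operator) subspace_up_image:
  assumes "subspace S"
  shows "subspace ((u ^^ n) ` S)"
proof (rule subspaceI)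
  show "0 \<in> (u ^^ n) ` S" using subspace_0[OF assms] by (metis image_eqI up_0)
  fix a b assume "a \<in> (u ^^ n) ` S" "b \<in> (u ^^ n) ` S"
  then obtain x y where "x \<in> S" "y \<in> S" "a = (u ^^ n) x" "b = (u ^^ n) y" by blast
  then show "a + b \<in> (u ^^ n) ` S" using assms
    by (intro image_eqI[of _ _ "x + y"]) (simp_all add: up_add subspace_add)
next
  fix c a assume "a \<in> (u ^^ n) ` S"
  then obtain x where "x \<in> S" "a = (u ^^ n) x" by blast
  then show "c *s a \<in> (u ^^ n) ` S" using assms
    by (intro image_eqI[of _ _ "c *s x"]) (simp_all add: up_scale subspace_scale)
qed

context nilpotent_form
begin

text \<open>Explains the exponents in \<open>F k\<close>. At level 2 * k, u^i(E n) pairs only with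
  u^j(E n) for i + j = n - 1 - 2k. These come in hyperbolic pairs except for the middle i = j, which
  exists for odd n = 2m + 1 and equals m - k. The isotropic space is built downwards as u M plus Ker
  u^(2k), the latter being the radical of the form.\<close>

lemma isotropic_reduction_to_F:
  obtains \<Lambda> where "subspace \<Lambda>" "\<Lambda> \<subseteq> X" "\<And>x. x \<in> X \<Longrightarrow> (u ^^ (2 * k)) x = 0 \<Longrightarrow> x \<in> \<Lambda>"
    "\<And>x y. x \<in> \<Lambda> \<Longrightarrow> y \<in> \<Lambda> \<Longrightarrow> q x ((u ^^ (2 * k)) y) = 0"
    "\<And>x f. x \<in> \<Lambda> \<Longrightarrow> f \<in> F k \<Longrightarrow> q x ((u ^^ (2 * k)) f) = 0"
    "\<And>x. x \<in> X \<Longrightarrow> (\<And>l. l \<in> \<Lambda> \<Longrightarrow> q l ((u ^^ (2 * k)) x) = 0) \<Longrightarrow> \<exists>l\<in>\<Lambda>. \<exists>f\<in>F k. x = l + f"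
proof (induction "K - k" arbitrary: k thesis)
  case 0
  \<comment> \<open>For k at least K the form of level 2 * k is zero, so X itself is
    isotropic.\<close>
  have "(u ^^ (2 * k)) x = 0" if "x \<in> X" for x
    by (rule up_zero_mono[OF nil[OF that]]) (use 0(1) in simp)
  moreover have "\<exists>l\<in>X. \<exists>f\<in>F k. x = l + f" if "x \<in> X" for x
    using that subspace_0[OF F_subspace] by (intro bexI[of _ x] bexI[of _ 0]) auto
  moreover have "f \<in> X" if "f \<in> F k" for f using that F_X by blast
  ultimately show ?case by (intro "0"(2)[of X]) (simp_all add: sX)
next
  case (Suc d)
  have dk: "d = K - Suc k" using Suc.hyps(2) by simp
  obtain M where M: "subspace M" "M \<subseteq> X" "\<And>x. x \<in> X \<Longrightarrow> (u ^^ (2 * Suc k)) x = 0 \<Longrightarrow> x \<in> M"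
    "\<And>x y. x \<in> M \<Longrightarrow> y \<in> M \<Longrightarrow> q x ((u ^^ (2 * Suc k)) y) = 0"
    "\<And>x f. x \<in> M \<Longrightarrow> f \<in> F (Suc k) \<Longrightarrow> q x ((u ^^ (2 * Suc k)) f) = 0"
    "\<And>x. x \<in> X \<Longrightarrow> (\<And>l. l \<in> M \<Longrightarrow> q l ((u ^^ (2 * Suc k)) x) = 0) \<Longrightarrow> \<exists>l\<in>M. \<exists>f\<in>F (Suc k). x = l + f"
    apply (rule Suc.hyps(1)[OF dk])
    subgoal premises p for M by (rule p(1)[OF p(2-7)])
    done
  define \<Lambda> where "\<Lambda> = {u l + z | l z. l \<in> M \<and> z \<in> X \<and> (u ^^ (2 * k)) z = 0}"
  have LI: "u l + z \<in> \<Lambda>" if "l \<in> M" "z \<in> X" "(u ^^ (2 * k)) z = 0" for l z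
    using that unfolding \<Lambda>_def by blast
  have LE: thesis if "x \<in> \<Lambda>" "\<And>l z. l \<in> M \<Longrightarrow> z \<in> X \<Longrightarrow> (u ^^ (2 * k)) z = 0 \<Longrightarrow> x = u l + z \<Longrightarrow> thesis" for x thesis
    using that(1) unfolding \<Lambda>_def by (elim CollectE exE conjE) (rule that(2))
  have M0: "0 \<in> M" and X0: "0 \<in> X" using subspace_0 M(1) sX by auto
  have qz: "q z ((u ^^ (2 * k)) y) = 0" if "(u ^^ (2 * k)) z = 0" for z y
    using that by (simp flip: up_sa)
  show ?case
  proof (rule Suc.prems)
    show "subspace \<Lambda>"
    proof (rule subspaceI)
      show "0 \<in> \<Lambda>" using LI[OF M0 X0] by simp
      fix x y assume "x \<in> \<Lambda>" "y \<in> \<Lambda>"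
      obtain l z where 1: "l \<in> M" "z \<in> X" "(u ^^ (2 * k)) z = 0" "x = u l + z" using LE[OF \<open>x \<in> \<Lambda>\<close>] .
      obtain l' z' where 2: "l' \<in> M" "z' \<in> X" "(u ^^ (2 * k)) z' = 0" "y = u l' + z'" using LE[OF \<open>y \<in> \<Lambda>\<close>] .
      have "x + y = u (l + l') + (z + z')" by (simp add: 1 2 u_simps)
      then show "x + y \<in> \<Lambda>"
        using LI[OF subspace_add[OF M(1) 1(1) 2(1)] subspace_add[OF sX 1(2) 2(2)]] by (simp add: up_simps 1(3) 2(3))
    next
      fix c x assume "x \<in> \<Lambda>"
      obtain l z where 1: "l \<in> M" "z \<in> X" "(u ^^ (2 * k)) z = 0" "x = u l + z" using LE[OF \<open>x \<in> \<Lambda>\<close>] .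
      have "c *s x = u (c *s l) + c *s z" by (simp add: 1 u_simps scale_right_distrib)
      then show "c *s x \<in> \<Lambda>"
        using LI[OF subspace_scale[OF M(1) 1(1)] subspace_scale[OF sX 1(2)]] by (simp add: up_simps 1(3))
    qed
    show "\<Lambda> \<subseteq> X"
    proof
      fix x assume "x \<in> \<Lambda>"
      then obtain l z where 1: "l \<in> M" "z \<in> X" "(u ^^ (2 * k)) z = 0" "x = u l + z" by (rule LE)
      show "x \<in> X" unfolding 1(4) by (rule subspace_add[OF sX uX[OF subsetD[OF M(2) 1(1)]] 1(2)])
    qed
    show "x \<in> \<Lambda>" if "x \<in> X" "(u ^^ (2 * k)) x = 0" for x using LI[OF M0 that] by simp
    show "q x ((u ^^ (2 * k)) y) = 0" if "x \<in> \<Lambda>" "y \<in> \<Lambda>" for x y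
    proof -
      obtain l z where 1: "l \<in> M" "z \<in> X" "(u ^^ (2 * k)) z = 0" "x = u l + z" using LE[OF \<open>x \<in> \<Lambda>\<close>] .
      obtain l' z' where 2: "l' \<in> M" "z' \<in> X" "(u ^^ (2 * k)) z' = 0" "y = u l' + z'" using LE[OF \<open>y \<in> \<Lambda>\<close>] .
      have "q (u l) ((u ^^ (2 * k)) (u l')) = q l ((u ^^ (2 * Suc k)) l')" by (simp add: u_sa u_up2)
      then show ?thesis using M(4)[OF 1(1) 2(1)] qz[OF 1(3)] by (simp add: 1(4) 2(3,4) q_add_left up_add)
    qed
    show "q x ((u ^^ (2 * k)) f) = 0" if "x \<in> \<Lambda>" "f \<in> F k" for x f
    proof -
      obtain l z where 1: "l \<in> M" "z \<in> X" "(u ^^ (2 * k)) z = 0" "x = u l + z" using LE[OF \<open>x \<in> \<Lambda>\<close>] .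
      obtain e g where 2: "e \<in> G k" "g \<in> F (Suc k)" "f = e + u g" using F_decomp[OF \<open>f \<in> F k\<close>] by blast
      have "(u ^^ Suc (2 * k)) e = 0" using E_killed[of e "2 * k + 1"] 2(1) by (simp add: G_def)
      then have "q (u l) ((u ^^ (2 * k)) e) = 0" by (simp add: u_sa u_up2)
      moreover have "q (u l) ((u ^^ (2 * k)) (u g)) = q l ((u ^^ (2 * Suc k)) g)" by (simp add: u_sa u_up2)
      ultimately show ?thesis using M(5)[OF 1(1) 2(2)] qz[OF 1(3)]
        by (simp add: 1(4) 2(3) q_add_left q_add_right up_add)
    qed
    fix x assume x: "x \<in> X" and perp: "\<And>l. l \<in> \<Lambda> \<Longrightarrow> q l ((u ^^ (2 * k)) x) = 0"
    have perp1: "q l ((u ^^ Suc (2 * k)) x) = 0" if "l \<in> M" for l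
      using perp[OF LI[OF that X0]] by (simp add: u_sa u_up2)
    \<comment> \<open>M contains Ker u^(2k+2), whose orthogonal in X is the image of u^(2k+2). Hence
      \<open>perp1\<close> writes u^(2k+1) x as u^(2k+2) s, and x can be compared with u s.\<close>
    define S where "S = (u ^^ (2 * Suc k)) ` X"
    have sS: "subspace S" unfolding S_def by (rule subspace_up_image[OF sX])
    have SX: "S \<subseteq> X" using upX by (auto simp: S_def)
    have "(u ^^ Suc (2 * k)) x \<in> S"
    proof (rule double_perp_left[OF fin_sp_mono[OF fX sS SX] SX sX nX upX[OF x]])
      fix y assume y: "y \<in> X" "\<forall>s\<in>S. q s y = 0"
      have "(u ^^ (2 * Suc k)) y = 0"
      proof (rule nondegD[OF nX upX[OF y(1)]])
        fix z assume "z \<in> X"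
        then have "q ((u ^^ (2 * Suc k)) z) y = 0" using y(2) by (simp add: S_def)
        then show "q z ((u ^^ (2 * Suc k)) y) = 0" by (simp only: up_sa)
      qed
      then show "q y ((u ^^ Suc (2 * k)) x) = 0" using perp1 M(3)[OF y(1)] by blast
    qed
    then obtain s where s: "s \<in> X" "(u ^^ Suc (2 * k)) x = (u ^^ (2 * Suc k)) s" by (auto simp: S_def)
    have "q l ((u ^^ (2 * Suc k)) s) = 0" if "l \<in> M" for l using perp1[OF that] s(2) by simp
    then obtain l f where lf: "l \<in> M" "f \<in> F (Suc k)" "s = l + f" using M(6)[OF s(1)] by blast
    \<comment> \<open>In this kernel \<open>ker_decomp\<close> isolates the block
      \<open>G k\<close>. The rest u w is absorbed by u M, because w is killed by u^(2k+2).\<close>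
    have "(u ^^ (2 * k + 1)) (x - u s) = 0" using s(2) by (simp add: up_simps u_up2)
    then obtain e z w where ezw: "e \<in> E (2 * k + 1)" "z \<in> X" "w \<in> X" "(u ^^ (2 * k + 1 - 1)) z = 0"
      "(u ^^ Suc (2 * k + 1)) w = 0" "x - u s = e + z + u w"
      using ker_decomp[of "x - u s" "2 * k + 1"] subspace_diff[OF sX x uX[OF s(1)]] by blast
    have "w \<in> M" using M(3)[OF ezw(3)] ezw(5) by simp
    then have "u (l + w) + z \<in> \<Lambda>" using LI[OF subspace_add[OF M(1) lf(1)]] ezw(2,4) by simp
    moreover have "e + u f \<in> F k"
      using subspace_add[OF F_subspace subsetD[OF G_F] u_F[OF lf(2)]] ezw(1) by (simp add: G_def)
    moreover have "x = (u (l + w) + z) + (e + u f)"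
      using ezw(6) by (simp add: lf(3) u_simps algebra_simps)
    ultimately show "\<exists>l\<in>\<Lambda>. \<exists>f\<in>F k. x = l + f" by blast
  qed
qed

end

locale split_form = nilpotent_form +
  fixes v w :: "'b \<Rightarrow> 'b"
  assumes v_add: "v (x + y) = v x + v y" and v_scale: "v (a *s x) = a *s v x"
    and v_sa: "q (v x) y = q x (v y)" and vX: "x \<in> X \<Longrightarrow> v x \<in> X" and vv: "x \<in> X \<Longrightarrow> v (v x) = 0"
    and w_add: "w (x + y) = w x + w y" and w_scale: "w (a *s x) = a *s w x"
    and w_sa: "q (w x) y = q x (w y)" and wX: "x \<in> X \<Longrightarrow> w x \<in> X" and ww: "x \<in> X \<Longrightarrow> w (w x) = 0"
    and u_vw: "x \<in> X \<Longrightarrow> u x = v x + w x"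
begin

lemma v_0: "v 0 = 0" using v_scale[of 0 0] by simp
lemma w_0: "w 0 = 0" using w_scale[of 0 0] by simp

lemma uv: "x \<in> X \<Longrightarrow> u (v x) = w (v x)" and uw: "x \<in> X \<Longrightarrow> u (w x) = v (w x)"
  by (simp_all add: u_vw vX wX vv ww)

lemma uu: "x \<in> X \<Longrightarrow> u (u x) = w (v x) + v (w x)"
  by (simp add: u_vw[of x] u_add uv uw)

lemma vu: "x \<in> X \<Longrightarrow> v (u (u x)) = u (u (v x))" and wu: "x \<in> X \<Longrightarrow> w (u (u x)) = u (u (w x))"
  by (simp_all add: uu v_add w_add vX wX vv ww v_0 w_0)

text \<open>v and w commute with u^2, but in general not with u. This is why the argument runs at
  the even levels 2 * k, those of the odd blocks.\<close>

lemma v_up: "x \<in> X \<Longrightarrow> v ((u ^^ (2 * k)) x) = (u ^^ (2 * k)) (v x)"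
  and w_up: "x \<in> X \<Longrightarrow> w ((u ^^ (2 * k)) x) = (u ^^ (2 * k)) (w x)"
proof -
  assume x: "x \<in> X"
  show "v ((u ^^ (2 * k)) x) = (u ^^ (2 * k)) (v x)"
  proof (induction k)
    case (Suc k)
    have "v ((u ^^ (2 * Suc k)) x) = v (u (u ((u ^^ (2 * k)) x)))" by (simp add: u_up2)
    also have "\<dots> = u (u (v ((u ^^ (2 * k)) x)))" by (rule vu[OF upX[OF x]])
    finally show ?case by (simp add: Suc u_up2)
  qed simp
  show "w ((u ^^ (2 * k)) x) = (u ^^ (2 * k)) (w x)"
  proof (induction k)
    case (Suc k)
    have "w ((u ^^ (2 * Suc k)) x) = w (u (u ((u ^^ (2 * k)) x)))" by (simp add: u_up2)
    also have "\<dots> = u (u (w ((u ^^ (2 * k)) x)))" by (rule wu[OF upX[OF x]])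
    finally show ?case by (simp add: Suc u_up2)
  qed simp
qed

lemma anti_embeds_if_reduction:
  assumes red: "lev.aniso_reduction (2 * Suc k) (F (Suc k)) T A"
  shows "anti_embeds k A"
proof -
  note d = lev.aniso_reductionD[OF red]
  obtain \<Lambda> where M: "subspace \<Lambda>" "\<Lambda> \<subseteq> X" "\<And>x. x \<in> X \<Longrightarrow> (u ^^ (2 * Suc k)) x = 0 \<Longrightarrow> x \<in> \<Lambda>"
    "\<And>x y. x \<in> \<Lambda> \<Longrightarrow> y \<in> \<Lambda> \<Longrightarrow> q x ((u ^^ (2 * Suc k)) y) = 0"
    "\<And>x f. x \<in> \<Lambda> \<Longrightarrow> f \<in> F (Suc k) \<Longrightarrow> q x ((u ^^ (2 * Suc k)) f) = 0"
    "\<And>x. x \<in> X \<Longrightarrow> (\<And>l. l \<in> \<Lambda> \<Longrightarrow> q l ((u ^^ (2 * Suc k)) x) = 0) \<Longrightarrow> \<exists>l\<in>\<Lambda>. \<exists>f\<in>F (Suc k). x = l + f"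
    apply (rule isotropic_reduction_to_F[of "Suc k"])
    subgoal premises p for M by (rule p(1)[OF p(2-7)])
    done
  define D where "D = u ^^ (2 * k)"
  define m where "m = 2 * Suc k"
  note d = d[folded m_def] and M = M[folded m_def]
  have D_sa: "q (D x) y = q x (D y)" for x y by (simp add: D_def up_sa)
  have D_add: "D (x + y) = D x + D y" and D_diff: "D (x - y) = D x - D y" for x y
    by (simp_all add: D_def up_simps)
  have D0: "D 0 = 0" by (simp add: D_def)
  have Dm: "D (u (u x)) = (u ^^ m) x" for x by (simp add: D_def m_def u_up2)
  have DX: "D x \<in> X" if "x \<in> X" for x using upX[OF that] by (simp add: D_def)
  have Dv: "v (D x) = D (v x)" and Dw: "w (D x) = D (w x)" if "x \<in> X" for x
    using v_up[OF that] w_up[OF that] by (simp_all add: D_def)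
  have Dvw: "q (D (v (w x))) y = q x (D (w (v y)))" and Dwv: "q (D (w (v x))) y = q x (D (v (w y)))"
    if "x \<in> X" "y \<in> X" for x y
    using that by (simp_all add: D_sa v_sa w_sa Dv Dw vX wX)
  have um: "(u ^^ m) x = D (w (v x)) + D (v (w x))" if "x \<in> X" for x
    using that by (simp flip: Dm D_add add: uu)
  \<comment> \<open>Adding T to \<Lambda> pushes the reduction from \<open>F (Suc k)\<close> on to
    A: the orthogonal P defined below is L + A, so its isotropic vectors lie in L.\<close>
  define L where "L = {t + l | t l. t \<in> T \<and> l \<in> \<Lambda>}"
  have sL: "subspace L" unfolding L_def by (rule subspace_sums[OF d(2) M(1)])
  have LX: "L \<subseteq> X" using d(4) M(2) F_X[of "Suc k"] sX unfolding L_def by (auto intro!: subspace_add)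
  have LE: thesis if "x \<in> L" "\<And>t l. t \<in> T \<Longrightarrow> l \<in> \<Lambda> \<Longrightarrow> x = t + l \<Longrightarrow> thesis" for x thesis
    using that(1) unfolding L_def by (elim CollectE exE conjE) (rule that(2))
  have TL: "T \<subseteq> L" and LamL: "\<Lambda> \<subseteq> L"
    using subspace_0[OF d(2)] subspace_0[OF M(1)] unfolding L_def by force+
  have FM: "q f ((u ^^ m) l) = 0" if "f \<in> F (Suc k)" "l \<in> \<Lambda>" for f l
    using M(5)[OF that(2,1)] lev.q_swap_0[of _ m] by blast
  have LL: "q x ((u ^^ m) y) = 0" if xy: "x \<in> L" "y \<in> L" for x y
  proof -
    obtain t l where 1: "t \<in> T" "l \<in> \<Lambda>" "x = t + l" using LE[OF xy(1)] .
    obtain t' l' where 2: "t' \<in> T" "l' \<in> \<Lambda>" "y = t' + l'" using LE[OF xy(2)] .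
    show ?thesis unfolding 1(3) 2(3) q_add_left up_add q_add_right
      using d(6)[OF 1(1) 2(1)] FM[OF subsetD[OF d(4) 1(1)] 2(2)] M(5)[OF 1(2) subsetD[OF d(4) 2(1)]] M(4)[OF 1(2) 2(2)]
      by simp
  qed
  define P where "P = {x \<in> X. \<forall>l\<in>L. q l ((u ^^ m) x) = 0}"
  have sP: "subspace P" unfolding P_def by (rule lev.subspace_perp[OF sX])
  have PX: "P \<subseteq> X" by (auto simp: P_def)
  have LP: "q l ((u ^^ m) x) = 0" "q x ((u ^^ m) l) = 0" if "l \<in> L" "x \<in> P" for l x
    using that lev.q_swap_0[of _ m] by (auto simp: P_def)
  have AP: "A \<subseteq> P"
  proof
    fix a assume a: "a \<in> A"
    have aF: "a \<in> F (Suc k)" using d(5) a by blast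
    have "q l ((u ^^ m) a) = 0" if l: "l \<in> L" for l
    proof -
      obtain t l' where 1: "t \<in> T" "l' \<in> \<Lambda>" "l = t + l'" using LE[OF l] .
      show ?thesis unfolding 1(3) q_add_left using d(7)[OF 1(1) a] M(5)[OF 1(2) aF] by simp
    qed
    then show "a \<in> P" using aF F_X by (auto simp: P_def)
  qed
  have PL: "y \<in> L" if y: "y \<in> P" "q y ((u ^^ m) y) = 0" for y
  proof -
    have "q l ((u ^^ m) y) = 0" if "l \<in> \<Lambda>" for l using LP(1)[OF subsetD[OF LamL that] y(1)] .
    then obtain l f where lf: "l \<in> \<Lambda>" "f \<in> F (Suc k)" "y = l + f" using M(6)[OF subsetD[OF PX y(1)]] by blast
    have "q t ((u ^^ m) f) = 0" if t: "t \<in> T" for t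
      using LP(1)[OF subsetD[OF TL t] y(1)] FM[OF subsetD[OF d(4) t] lf(1)] by (simp add: lf(3) up_add q_add_right)
    then obtain t a where ta: "t \<in> T" "a \<in> A" "f = t + a" using d(10)[OF lf(2)] by blast
    have l: "t + l \<in> L" using ta(1) lf(1) unfolding L_def by blast
    have ya: "y = (t + l) + a" by (simp add: lf ta)
    have aP: "a \<in> P" using AP ta(2) by blast
    have "q y ((u ^^ m) y) = q a ((u ^^ m) a)"
      unfolding ya q_add_left[of "t + l"] up_add[of m "t + l"] q_add_right[of _ "(u ^^ m) (t + l)"]
      using LL[OF l l] LP[OF l aP] by simp
    then have "a = 0" using y(2) d(9)[OF ta(2)] by simp
    then show ?thesis using l ya by simp
  qed
  have image_subspace: "subspace ((u ^^ m) ` L)" by (rule subspace_up_image[OF sL])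
  have imX: "(u ^^ m) ` L \<subseteq> X" using LX upX by blast
  have inP: "y \<in> P" if "y \<in> X" "\<And>l. l \<in> L \<Longrightarrow> q ((u ^^ m) l) y = 0" for y
    using that by (simp add: P_def up_sa)
  have perpP: "z \<in> (u ^^ m) ` L" if z: "z \<in> X" "\<And>p. p \<in> P \<Longrightarrow> q p z = 0" for z
    by (rule double_perp_left[OF fin_sp_mono[OF fX image_subspace imX] imX sX nX z(1)])
       (use inP z(2) in blast)
  \<comment> \<open>Double orthogonality reduces the claim to vectors y orthogonal to D(vw P) and
    u^m L. Such a y is in P, and D(wv y) is orthogonal to P, hence equals u^m l0. Then the norm of y
    at level m vanishes, as it is the sum of q y (D(wv y)) = 0 and its conjugate; so y is in L. Now
    D(vw y) = u^m (y - l0) is orthogonal to x, and adjointness turns this into orthogonality of y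
    and D(wv x).\<close>
  have key: "\<exists>x'\<in>P. \<exists>l\<in>L. D (w (v x)) + D (v (w x')) = (u ^^ m) l" if x: "x \<in> P" for x
  proof -
    define S where "S = {y + z | y z. y \<in> (\<lambda>p. D (v (w p))) ` P \<and> z \<in> (u ^^ m) ` L}"
    have "subspace ((\<lambda>p. D (v (w p))) ` P)"
    proof (rule subspaceI)
      show "0 \<in> (\<lambda>p. D (v (w p))) ` P" using subspace_0[OF sP] by (auto simp: w_0 v_0 D_def intro!: image_eqI[of _ _ 0])
      show "a + b \<in> (\<lambda>p. D (v (w p))) ` P" if ab: "a \<in> (\<lambda>p. D (v (w p))) ` P" "b \<in> (\<lambda>p. D (v (w p))) ` P" for a b
      proof -
        obtain x y where "x \<in> P" "y \<in> P" "a = D (v (w x))" "b = D (v (w y))" using ab by blast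
        then show ?thesis using sP by (intro image_eqI[of _ _ "x + y"]) (auto simp: w_add v_add D_add subspace_add)
      qed
      show "c *s a \<in> (\<lambda>p. D (v (w p))) ` P" if ac: "a \<in> (\<lambda>p. D (v (w p))) ` P" for a c
      proof -
        obtain x where "x \<in> P" "a = D (v (w x))" using ac by blast
        then show ?thesis using sP
          by (intro image_eqI[of _ _ "c *s x"]) (auto simp: w_scale v_scale D_def up_scale subspace_scale)
      qed
    qed
    then have sS: "subspace S" unfolding S_def using image_subspace by (rule subspace_sums)
    have SX: "S \<subseteq> X" using imX PX sX DX vX wX unfolding S_def by (auto intro!: subspace_add)
    have xX: "x \<in> X" using PX x by blast
    have "D (w (v x)) \<in> S"
    proof (rule double_perp_left[OF fin_sp_mono[OF fX sS SX] SX sX nX])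
      show "D (w (v x)) \<in> X" using DX vX wX xX by blast
      fix y assume y: "y \<in> X" "\<forall>s\<in>S. q s y = 0"
      have S1: "D (v (w p)) + (u ^^ m) l \<in> S" if "p \<in> P" "l \<in> L" for p l using that unfolding S_def by blast
      have "q ((u ^^ m) l) y = 0" if "l \<in> L" for l
        using bspec[OF y(2) S1[OF subspace_0[OF sP] that]] by (simp add: w_0 v_0 D_def)
      then have yP: "y \<in> P" using inP y(1) by blast
      have "q p (D (w (v y))) = 0" if "p \<in> P" for p
        using bspec[OF y(2) S1[OF that subspace_0[OF sL]]] Dvw[OF subsetD[OF PX that] y(1)] by simp
      then have "D (w (v y)) \<in> (u ^^ m) ` L" using DX vX wX y(1) by (intro perpP) auto
      then obtain l0 where l0: "l0 \<in> L" "D (w (v y)) = (u ^^ m) l0" by auto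
      have "q y (D (w (v y))) = 0" using LP(2)[OF l0(1) yP] l0(2) by simp
      then have "q y ((u ^^ m) y) = 0"
        using Dwv[OF y(1) y(1)] q_swap_0[of "D (w (v y))" y] by (simp add: um[OF y(1)] q_add_right)
      then have "y \<in> L" using PL yP by blast
      then have yl: "y - l0 \<in> L" using subspace_diff[OF sL] l0(1) by blast
      have "D (v (w y)) = (u ^^ m) (y - l0)" using um[OF y(1)] l0(2) by (simp add: up_diff)
      then have "q (D (v (w y))) x = 0" using LP(1)[OF yl x] by (simp add: up_sa)
      then show "q y (D (w (v x))) = 0" using Dvw[OF y(1) xX] by simp
    qed
    then obtain p l where pl: "p \<in> P" "l \<in> L" "D (w (v x)) = D (v (w p)) + (u ^^ m) l" unfolding S_def by blast
    have "w (- p) = - w p" "v (- w p) = - v (w p)" "D (- v (w p)) = - D (v (w p))"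
      using w_scale[of "-1" p] v_scale[of "-1" "w p"] by (simp_all add: D_def up_minus)
    then have "D (w (v x)) + D (v (w (- p))) = (u ^^ m) l" by (simp add: pl(3))
    then show ?thesis using pl(1,2) subspace_neg[OF sP] by blast
  qed
  have ex: "\<exists>e x' l z r. e \<in> G k \<and> x' \<in> P \<and> l \<in> L \<and> D (w (v x)) + D (v (w x')) = (u ^^ m) l \<and>
      D z = 0 \<and> D (u (v x + w x' - u l)) = 0 \<and> v x + w x' - u l = e + z + u r" if x: "x \<in> P" for x
  proof -
    obtain x' l where xl: "x' \<in> P" "l \<in> L" "D (w (v x)) + D (v (w x')) = (u ^^ m) l" using key[OF x] by blast
    have X: "x \<in> X" "x' \<in> X" "l \<in> X" using x xl PX LX by auto
    \<comment> \<open>Applying D u to v x + w x' gives D(wv x) + D(vw x') = u^m l, which is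
      cancelled by subtracting u l.\<close>
    define j where "j = v x + w x' - u l"
    have jX: "j \<in> X" using X by (simp add: j_def subspace_add subspace_diff sX vX wX uX)
    have Duj: "D (u j) = 0"
      using xl(3) X by (simp add: j_def u_simps uv uw D_add D_diff Dm)
    then have "(u ^^ (2 * k + 1)) j = 0" by (simp add: D_def u_up2)
    from ker_decomp[OF jX this] obtain e z r where "e \<in> E (2 * k + 1)" "(u ^^ (2 * k + 1 - 1)) z = 0" "j = e + z + u r"
      by blast
    then have "e \<in> G k" "D z = 0" "j = e + z + u r" by (simp_all add: G_def D_def)
    then show ?thesis using xl Duj unfolding j_def by blast
  qed
  define R where "R x e \<longleftrightarrow> (\<exists>x' l z r. e \<in> G k \<and> x' \<in> P \<and> l \<in> L \<and> D (w (v x)) + D (v (w x')) = (u ^^ m) l \<and>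
      D z = 0 \<and> D (u (v x + w x' - u l)) = 0 \<and> v x + w x' - u l = e + z + u r)" for x e
  have RJ: "R x (SOME e. R x e)" if "x \<in> P" for x
    by (rule someI_ex) (use ex[OF that] in \<open>simp only: R_def\<close>)
  \<comment> \<open>The value is computed for every admissible e, so it holds for whichever one the
    choice operator selects. Passing from j to e costs nothing: z is killed by D, and u r is
    orthogonal at level 2 * k to the kernel of u^(2k+1).\<close>
  have Q: "q e (D e1) = - q x ((u ^^ m) y)" if R: "R x e" "R y e1" and xy: "x \<in> P" "y \<in> P" for x y e e1
  proof -
    obtain x' l z r where 1: "e \<in> G k" "x' \<in> P" "l \<in> L" "D (w (v x)) + D (v (w x')) = (u ^^ m) l"
      "D z = 0" "D (u (v x + w x' - u l)) = 0" "v x + w x' - u l = e + z + u r" using R(1) unfolding R_def by (elim exE conjE)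
    obtain y' h z1 r1 where 2: "e1 \<in> G k" "y' \<in> P" "h \<in> L" "D (w (v y)) + D (v (w y')) = (u ^^ m) h"
      "D z1 = 0" "D (u (v y + w y' - u h)) = 0" "v y + w y' - u h = e1 + z1 + u r1" using R(2) unfolding R_def by (elim exE conjE)
    have X: "x \<in> X" "x' \<in> X" "y \<in> X" "y' \<in> X" "l \<in> X" "h \<in> X" using 1 2 xy PX LX by auto
    define j where "j = v x + w x' - u l"
    define i where "i = v y + w y' - u h"
    have Duj: "D (u j) = 0" and Dui: "D (u i) = 0" using 1(6) 2(6) by (simp_all add: j_def i_def)
    have uD: "u (D a) = D (u a)" for a by (simp add: D_def u_up2)
    have Due: "D (u e) = 0" using E_killed[of e "2 * k + 1"] 1(1) by (simp add: D_def G_def u_up2)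
    have je: "j = e + z + u r" and ie: "i = e1 + z1 + u r1" using 1(7) 2(7) by (simp_all add: j_def i_def)
    have "q j (D i) = q e (D i) + q (D z) i + q r (D (u i))"
      by (simp only: je q_add_left D_sa u_sa uD)
    also have "q e (D i) = q e (D e1) + q (D (u e)) r1"
      by (simp add: ie D_add 2(5) q_add_right D_sa u_sa uD)
    finally have step1: "q j (D i) = q e (D e1)" by (simp add: 1(5) Dui Due)
    have "q j (D i) = q j (D (v y + w y')) - q (D (u j)) h"
      by (simp add: i_def D_diff D_sa u_sa uD q_diff_right)
    then have "q j (D i) = q j (D (v y + w y'))" by (simp add: Duj)
    also have "\<dots> = q (v x + w x') (D (v y + w y')) - q l (D (u (v y + w y')))"
      by (simp add: j_def q_diff_left u_sa uD)
    also have "D (u (v y + w y')) = (u ^^ m) h" using 2(4) X by (simp add: u_add uv uw D_add)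
    also have "q l ((u ^^ m) h) = 0" by (rule LL[OF 1(3) 2(3)])
    also have "q (v x + w x') (D (v y + w y')) = q x (D (v (w y'))) + q x' (D (w (v y)))"
      using X by (simp add: q_add_left D_add q_add_right v_sa w_sa v_add w_add Dv Dw vX wX vv ww D0)
    \<comment> \<open>The two cross terms are exchanged, with a sign, for the two halves of u^m y.
      The error terms from u^m L vanish because x and y are in P.\<close>
    also have "q x (D (v (w y'))) = - q x (D (w (v y)))"
    proof -
      have "q x (D (w (v y)) + D (v (w y'))) = 0" unfolding 2(4) by (rule LP(2)[OF 2(3) xy(1)])
      then show ?thesis by (simp add: q_add_right eq_neg_iff_add_eq_0 add.commute)
    qed
    also have "q x' (D (w (v y))) = - q x (D (v (w y)))"
    proof -
      have "q (D (w (v x)) + D (v (w x'))) y = 0" unfolding 1(4) using LP(1)[OF 1(3) xy(2)] by (simp add: up_sa)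
      then show ?thesis using X by (simp add: q_add_left Dvw Dwv eq_neg_iff_add_eq_0 add.commute)
    qed
    finally have "q j (D i) = - q x ((u ^^ m) y)" using X by (simp add: um q_add_right)
    with step1 show ?thesis by simp
  qed
  show ?thesis unfolding anti_embeds_def
  proof (intro exI[of _ "\<lambda>x. SOME e. R x e"] conjI ballI)
    fix a assume a: "a \<in> A"
    have aP: "a \<in> P" using a AP by blast
    show "(SOME e. R a e) \<in> G k" using RJ[OF aP] unfolding R_def by (elim exE conjE)
    fix b assume b: "b \<in> A"
    have bP: "b \<in> P" using b AP by blast
    show "q (SOME e. R a e) ((u ^^ (2 * k)) (SOME e. R b e)) = - q a ((u ^^ (2 * Suc k)) b)"
      using Q[OF RJ[OF aP] RJ[OF bP] aP bP] by (simp only: D_def m_def)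
  qed
qed

end

section \<open>Carrier-based form spaces\<close>

text \<open>Dictionary between a carrier-based space and a subspace S of a type-based one, through a
  parametrization \<pi> injective on S. Q is a free parameter, so that the negative of a form is
  covered as well.\<close>

locale form_model = vector_space scale
  for scale :: "'f::field \<Rightarrow> 'b::ab_group_add \<Rightarrow> 'b" (infixr "*s" 75) +
  fixes S :: "'b set" and Q :: "'b \<Rightarrow> 'b \<Rightarrow> 'f" and \<pi> :: "'b \<Rightarrow> 'h" and H :: "('f, 'h) form_space"
  assumes S: "subspace S" and car: "carrier H = \<pi> ` S" and inj: "inj_on \<pi> S"
    and zero: "\<zero>\<^bsub>H\<^esub> = \<pi> 0"
    and add: "x \<in> S \<Longrightarrow> y \<in> S \<Longrightarrow> \<pi> x \<oplus>\<^bsub>H\<^esub> \<pi> y = \<pi> (x + y)"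
    and smult: "x \<in> S \<Longrightarrow> a \<odot>\<^bsub>H\<^esub> \<pi> x = \<pi> (a *s x)"
    and form: "x \<in> S \<Longrightarrow> y \<in> S \<Longrightarrow> form H (\<pi> x) (\<pi> y) = Q x y"
begin

lemmas S_add = subspace_add[OF S] and S_scale = subspace_scale[OF S] and S_0 = subspace_0[OF S]

lemma vs: "vectorspace class_ring H"
proof (rule vs_criteria, goal_cases)
  case 1 show ?case by (rule class_field)
  case 4
  show ?case
  proof
    fix v assume "v \<in> carrier H"
    then obtain x where "x \<in> S" "v = \<pi> x" using car by auto
    then show "\<exists>w\<in>carrier H. v \<oplus>\<^bsub>H\<^esub> w = \<zero>\<^bsub>H\<^esub>"
      using subspace_neg[OF S] by (intro bexI[of _ "\<pi> (- x)"]) (auto simp: add zero car)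
  qed
qed (auto simp: car zero add smult S_add S_scale S_0 ac_simps scale_left_distrib scale_right_distrib)

lemma sub_model: "subspace T \<Longrightarrow> T \<subseteq> S \<Longrightarrow> form_model scale T Q \<pi> (H\<lparr>carrier := \<pi> ` T\<rparr>)"
  by unfold_locales (auto simp: zero intro!: add smult form inj_on_subset[OF inj])

lemma subspace_image: "subspace T \<Longrightarrow> T \<subseteq> S \<Longrightarrow> VectorSpace.subspace class_ring (\<pi> ` T) H"
proof -
  assume T: "subspace T" "T \<subseteq> S"
  have "module class_ring H" using vs by (simp add: vectorspace_def)
  with T vs show ?thesis
    unfolding VectorSpace.subspace_def LinearCombinations.submodule_def
    by (auto simp: car zero subspace_0 subsetD[OF T(2)] add smult subspace_add subspace_scale intro!: imageI)
qed

lemma subspace_preimage: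
  assumes "VectorSpace.subspace class_ring W H"
  obtains T where "subspace T" "T \<subseteq> S" "W = \<pi> ` T"
proof -
  have W: "W \<subseteq> carrier H" "\<And>v w. v \<in> W \<Longrightarrow> w \<in> W \<Longrightarrow> v \<oplus>\<^bsub>H\<^esub> w \<in> W" "\<zero>\<^bsub>H\<^esub> \<in> W"
    "\<And>c v. v \<in> W \<Longrightarrow> c \<odot>\<^bsub>H\<^esub> v \<in> W"
    using assms unfolding VectorSpace.subspace_def LinearCombinations.submodule_def by auto
  define T where "T = {x \<in> S. \<pi> x \<in> W}"
  have "subspace T"
  proof (rule subspaceI)
    show "0 \<in> T" using W(3) S_0 zero by (simp add: T_def)
    show "x + y \<in> T" if "x \<in> T" "y \<in> T" for x y
      using that W(2)[of "\<pi> x" "\<pi> y"] add[of x y] S_add by (simp add: T_def)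
    show "c *s x \<in> T" if "x \<in> T" for c x
      using that W(4)[of "\<pi> x" c] smult[of x c] S_scale by (simp add: T_def)
  qed
  moreover have "W = \<pi> ` T" using W(1) car by (auto simp: T_def)
  moreover have "T \<subseteq> S" by (auto simp: T_def)
  ultimately show thesis by (intro that)
qed

lemma set_add_image:
  "T \<subseteq> S \<Longrightarrow> T' \<subseteq> S \<Longrightarrow> \<pi> ` T <+>\<^bsub>H\<^esub> \<pi> ` T' = \<pi> ` {x + y | x y. x \<in> T \<and> y \<in> T'}"
  unfolding set_add_def set_mult_def
proof (safe, goal_cases)
  case (1 x y z)
  then show ?case by (auto simp: add subsetD intro!: imageI)
next
  case (2 x y z)
  then show ?case by (auto simp: add[symmetric] subsetD intro!: bexI)
qed

lemma rk_eq:
  assumes B: "finite B" "independent B" "S = span B"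
  shows "rk H = card B"
proof -
  interpret V: vectorspace class_ring H by (rule vs)
  have BS: "B \<subseteq> S" using B(3) by (auto intro: span_base)
  have lc: "V.lincomb a (\<pi> ` C) = \<pi> (\<Sum>b\<in>C. a (\<pi> b) *s b)" if "C \<subseteq> B" for a C
    using finite_subset[OF that B(1)] that
  proof (induction C rule: finite_induct)
    case empty
    then show ?case by (simp add: V.lincomb_def zero)
  next
    case (insert x C)
    have xS: "x \<in> S" "C \<subseteq> S" using insert.prems BS by auto
    have nin: "\<pi> x \<notin> \<pi> ` C" using inj xS insert.hyps(2) by (auto simp: inj_on_def)
    have sumS: "(\<Sum>b\<in>C. a (\<pi> b) *s b) \<in> S"
      using xS by (intro subspace_sum[OF S]) (auto intro: S_scale)
    have f: "a (\<pi> y) \<odot>\<^bsub>H\<^esub> \<pi> y \<in> carrier H" if "y \<in> S" for y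
      using that by (simp add: smult car S_scale)
    with nin have "V.lincomb a (\<pi> ` insert x C) = a (\<pi> x) \<odot>\<^bsub>H\<^esub> \<pi> x \<oplus>\<^bsub>H\<^esub> V.lincomb a (\<pi> ` C)"
      unfolding V.lincomb_def image_insert using insert.hyps(1) xS
      by (intro V.M.finsum_insert) auto
    then show ?case using insert xS sumS by (simp add: smult add S_scale)
  qed
  have "V.lin_indpt (\<pi> ` B)"
  proof (rule V.finite_lin_indpt2)
    show "\<pi> ` B \<subseteq> carrier H" using BS car by auto
    fix a assume "V.lincomb a (\<pi> ` B) = \<zero>\<^bsub>H\<^esub>"
    then have "\<pi> (\<Sum>b\<in>B. a (\<pi> b) *s b) = \<pi> 0" by (simp add: lc zero)
    moreover have "(\<Sum>b\<in>B. a (\<pi> b) *s b) \<in> S"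
      using BS by (intro subspace_sum[OF S]) (auto intro: S_scale)
    ultimately have "(\<Sum>b\<in>B. a (\<pi> b) *s b) = 0" using inj S_0 by (auto simp: inj_on_def)
    then have "\<forall>b\<in>B. a (\<pi> b) = 0" using independentD[OF B(2,1) subset_refl, of "\<lambda>b. a (\<pi> b)"] by simp
    then show "\<forall>v\<in>\<pi> ` B. a v = \<zero>\<^bsub>class_ring\<^esub>" by simp
  qed (use B in simp)
  moreover have "V.span (\<pi> ` B) = carrier H"
  proof -
    have fin: "finite (\<pi> ` B)" and sub: "\<pi> ` B \<subseteq> carrier H" using B BS car by auto
    have "V.span (\<pi> ` B) = {V.lincomb a (\<pi> ` B) | a. True}"
      using V.finite_span[OF fin sub] by (simp add: Pi_def)
    also have "\<dots> = \<pi> ` S"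
    proof (intro equalityI subsetI)
      fix h assume "h \<in> {V.lincomb a (\<pi> ` B) | a. True}"
      then obtain a where "h = \<pi> (\<Sum>b\<in>B. a (\<pi> b) *s b)" by (auto simp: lc)
      then show "h \<in> \<pi> ` S" using BS by (auto intro!: imageI subspace_sum[OF S] S_scale)
    next
      fix h assume "h \<in> \<pi> ` S"
      then obtain x where x: "x \<in> span B" "h = \<pi> x" using B(3) by auto
      then obtain c where c: "x = (\<Sum>b\<in>B. c b *s b)" using span_finite[OF B(1)] by auto
      \<comment> \<open>\<open>V.lincomb\<close> reads its coefficients at elements of H, so c has
        to be pulled back along \<pi>.\<close>
      have "x = (\<Sum>b\<in>B. c (inv_into S \<pi> (\<pi> b)) *s b)"
        unfolding c using BS by (intro sum.cong) (auto simp: inv_into_f_f[OF inj])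
      then have "h = V.lincomb (\<lambda>z. c (inv_into S \<pi> z)) (\<pi> ` B)" by (simp add: lc x(2))
      then show "h \<in> {V.lincomb a (\<pi> ` B) | a. True}" by blast
    qed
    finally show ?thesis by (simp add: car)
  qed
  ultimately have "V.basis (\<pi> ` B)" using BS car by (auto simp: V.basis_def)
  then have "rk H = card (\<pi> ` B)" using B(1) by (intro V.dim_basis) simp
  then show ?thesis using card_image[OF inj_on_subset[OF inj BS]] by simp
qed

end

section \<open>Nonisotropic parts and isotropic reductions\<close>

locale hermitian_model = hermitian_space scale \<sigma> q + form_model scale S q \<pi> H
  for scale :: "'f::field \<Rightarrow> 'b::ab_group_add \<Rightarrow> 'b" (infixr "*s" 75) and \<sigma> q S
    and \<pi> :: "'b \<Rightarrow> 'h" and H +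
  assumes fS: "fin_sp S" and nS: "nondeg S"
begin

lemma Int_image:
  assumes "T \<subseteq> S" "T' \<subseteq> S" "T \<inter> T' = {0}"
  shows "\<pi> ` T \<inter> \<pi> ` T' = {\<zero>\<^bsub>H\<^esub>}"
  using inj_on_image_Int[OF inj assms(1,2)] assms(3) zero by simp

text \<open>One isotropic half of the hyperbolic part serves as T. If x = t + t' + a is orthogonal
  to T, then t' is orthogonal to both halves, hence zero.\<close>

lemma nonisotropic_part_reduction:
  assumes "nonisotropic_part H W"
  obtains T A where "aniso_reduction S T A" "W = \<pi> ` A"
proof -
  from assms obtain U where U: "VectorSpace.subspace class_ring W H" "nonisotropic (H\<lparr>carrier := W\<rparr>)"
    "VectorSpace.subspace class_ring U H" "hyperbolic (H\<lparr>carrier := U\<rparr>)"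
    "\<forall>x\<in>U. \<forall>y\<in>W. form H x y = 0" "U <+>\<^bsub>H\<^esub> W = carrier H"
    unfolding nonisotropic_part_def by blast
  obtain A where A: "subspace A" "A \<subseteq> S" "W = \<pi> ` A" using subspace_preimage[OF U(1)] .
  obtain U' where U': "subspace U'" "U' \<subseteq> S" "U = \<pi> ` U'" using subspace_preimage[OF U(3)] .
  interpret U: form_model scale U' q \<pi> "H\<lparr>carrier := U\<rparr>" using sub_model[OF U'(1,2)] U'(3) by simp
  from U(4) obtain L M where LM: "totally_isotropic (H\<lparr>carrier := U\<rparr>) L" "totally_isotropic (H\<lparr>carrier := U\<rparr>) M"
    "L <+>\<^bsub>H\<lparr>carrier := U\<rparr>\<^esub> M = U" and nU: "nondegenerate (H\<lparr>carrier := U\<rparr>)"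
    unfolding hyperbolic_def by auto
  obtain T where T: "subspace T" "T \<subseteq> U'" "L = \<pi> ` T"
    using LM(1) U.subspace_preimage unfolding totally_isotropic_def by blast
  obtain T' where T': "subspace T'" "T' \<subseteq> U'" "M = \<pi> ` T'"
    using LM(2) U.subspace_preimage unfolding totally_isotropic_def by blast
  have iso: "q x y = 0" if "x \<in> T" "y \<in> T" for x y
  proof -
    have "form H (\<pi> x) (\<pi> y) = 0" using LM(1) that T(3) by (auto simp: totally_isotropic_def)
    then show ?thesis using form[of x y] that T(2) U'(2) by auto
  qed
  have iso': "q x y = 0" if "x \<in> T'" "y \<in> T'" for x y
  proof -
    have "form H (\<pi> x) (\<pi> y) = 0" using LM(2) that T'(3) by (auto simp: totally_isotropic_def)
    then show ?thesis using form[of x y] that T'(2) U'(2) by auto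
  qed
  have UA: "q x y = 0" if "x \<in> U'" "y \<in> A" for x y
  proof -
    have "form H (\<pi> x) (\<pi> y) = 0" using U(5) that U'(3) A(3) by auto
    then show ?thesis using form[of x y] that A(2) U'(2) by auto
  qed
  have U'T: "\<exists>t\<in>T. \<exists>t'\<in>T'. x = t + t'" if "x \<in> U'" for x
  proof -
    have "\<pi> ` {t + t' | t t'. t \<in> T \<and> t' \<in> T'} = U"
      using LM(3) unfolding T(3) T'(3) U.set_add_image[OF T(2) T'(2)] .
    then have "\<pi> x \<in> \<pi> ` {t + t' | t t'. t \<in> T \<and> t' \<in> T'}" using that U'(3) by blast
    then obtain t t' where t: "\<pi> x = \<pi> (t + t')" "t \<in> T" "t' \<in> T'" by blast
    moreover have "t + t' \<in> U'" using t T(2) T'(2) U.S_add by blast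
    ultimately show ?thesis using U.inj that by (auto dest: inj_onD)
  qed
  have "aniso_reduction S T A" unfolding aniso_reduction_def
  proof (intro conjI ballI impI)
    show "subspace S" "subspace T" "subspace A" "A \<subseteq> S" by (rule S T A)+
    show "T \<subseteq> S" using T(2) U'(2) by blast
    show "q x y = 0" if "x \<in> T" "y \<in> T" for x y using iso that .
    show "q x y = 0" if "x \<in> T" "y \<in> A" for x y using UA that T(2) by blast
    show "a = 0" if a: "a \<in> A" "q a a = 0" for a
    proof -
      have "form H (\<pi> a) (\<pi> a) = 0" using form[of a a] a A(2) by auto
      then have "\<pi> a = \<pi> 0" using U(2) a(1) by (auto simp: nonisotropic_def A(3) zero)
      then show ?thesis using inj S_0 a(1) A(2) by (auto dest: inj_onD)
    qed
    fix x assume x: "x \<in> S" "\<forall>t\<in>T. q t x = 0"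
    have "\<pi> x \<in> \<pi> ` {y + a | y a. y \<in> U' \<and> a \<in> A}"
      using U(6) x(1) set_add_image[OF U'(2) A(2)] by (simp add: A(3) U'(3) car)
    then obtain y a where ya: "\<pi> x = \<pi> (y + a)" "y \<in> U'" "a \<in> A" by blast
    moreover have "y + a \<in> S" using ya U'(2) A(2) S_add by blast
    ultimately have xya: "x = y + a" using inj x(1) by (auto dest: inj_onD)
    obtain t t' where t: "t \<in> T" "t' \<in> T'" "y = t + t'" using U'T[OF ya(2)] by blast
    have t'U: "t' \<in> U'" using t T' by auto
    have "q t' z = 0" if z: "z \<in> U'" for z
    proof -
      obtain s s' where s: "s \<in> T" "s' \<in> T'" "z = s + s'" using U'T[OF z] by blast
      have "q s x = 0" "q s t = 0" "q s a = 0" using x(2) s(1) iso[OF s(1) t(1)] UA ya(3) T(2) by auto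
      then have "q s t' = 0" by (simp add: xya t(3) q_add_right)
      then show ?thesis using iso'[OF t(2) s(2)] q_swap_0[of s t'] by (simp add: s(3) q_add_right)
    qed
    then have "\<forall>h\<in>carrier (H\<lparr>carrier := U\<rparr>). form (H\<lparr>carrier := U\<rparr>) (\<pi> t') h = 0"
      using U.form[OF t'U] by (auto simp: U'(3))
    then have "\<pi> t' = \<pi> 0" using nU t'U unfolding nondegenerate_def by (auto simp: U'(3) zero)
    then have "t' = 0" using U.inj U.S_0 t'U by (auto dest: inj_onD)
    then show "\<exists>t\<in>T. \<exists>a\<in>A. x = t + a" using t ya(3) xya by auto
  qed
  with that A(3) show thesis by blast
qed

text \<open>\<open>witt_simplifies\<close> quantifies over all nonisotropic parts; to extract an
  embedding from it, one part has to be exhibited.\<close>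

lemma nonisotropic_part_exists:
  obtains T A where "aniso_reduction S T A" "nonisotropic_part H (\<pi> ` A)"
proof -
  obtain B C A where W: "finite B" "finite C" "card C = card B" "B \<inter> C = {}" "independent (B \<union> C)"
    "B \<subseteq> S" "C \<subseteq> S" "\<And>x y. x \<in> span B \<Longrightarrow> y \<in> span B \<Longrightarrow> q x y = 0"
    "\<And>x y. x \<in> span C \<Longrightarrow> y \<in> span C \<Longrightarrow> q x y = 0" "nondeg (span (B \<union> C))"
    "A = {x\<in>S. \<forall>y\<in>span (B \<union> C). q y x = 0}" "\<And>a. a \<in> A \<Longrightarrow> q a a = 0 \<Longrightarrow> a = 0"
    "\<And>x. x \<in> S \<Longrightarrow> \<exists>u\<in>span (B \<union> C). x - u \<in> A"
    "\<And>D. finite D \<Longrightarrow> independent D \<Longrightarrow> D \<subseteq> S \<Longrightarrow> (\<And>x y. x \<in> D \<Longrightarrow> y \<in> D \<Longrightarrow> q x y = 0) \<Longrightarrow> card D \<le> card B"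
    apply (rule witt_decomposition[OF fS nS])
    subgoal premises p for B C A by (rule p(1)[OF p(2-15)])
    done
  define U where "U = span (B \<union> C)"
  have US: "U \<subseteq> S" unfolding U_def using W(6,7) S by (simp add: span_minimal)
  have sU: "subspace U" by (simp add: U_def)
  have BU: "span B \<subseteq> U" "span C \<subseteq> U" unfolding U_def by (auto intro!: span_mono)
  have U_dec: "\<exists>y\<in>span B. \<exists>z\<in>span C. x = y + z" if "x \<in> U" for x using that by (auto simp: U_def span_Un)
  have sA: "subspace A" unfolding W(11) by (rule subspace_perp[OF S])
  have AS: "A \<subseteq> S" by (auto simp: W(11))
  have UA: "q x y = 0" if "x \<in> U" "y \<in> A" for x y using that by (auto simp: W(11) U_def)
  have nU: "x = 0" if "x \<in> U" "\<And>y. y \<in> U \<Longrightarrow> q y x = 0" for x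
    using nondegD[OF W(10)] that by (simp add: U_def)
  have indB: "independent B" using W(5) independent_mono by blast
  have red: "aniso_reduction S (span B) A" unfolding aniso_reduction_def
  proof (intro conjI ballI impI)
    show "q t a = 0" if "t \<in> span B" "a \<in> A" for t a using UA that BU by blast
    fix x assume x: "x \<in> S" "\<forall>t\<in>span B. q t x = 0"
    obtain w where w: "w \<in> U" "x - w \<in> A" using W(13)[OF x(1)] by (auto simp: U_def)
    obtain y z where yz: "y \<in> span B" "z \<in> span C" "w = y + z" using U_dec[OF w(1)] by blast
    have "z = 0"
    proof (rule nU)
      show "z \<in> U" using yz BU by blast
      fix s assume "s \<in> U"
      then obtain s1 s2 where s: "s1 \<in> span B" "s2 \<in> span C" "s = s1 + s2" using U_dec by blast
      have "q s1 (x - w) = 0" "q s1 x = 0" "q s1 y = 0" using UA[OF _ w(2)] s(1) BU x(2) W(8) yz(1) by auto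
      then have "q s1 z = 0" by (simp add: yz(3) q_simps)
      then show "q s z = 0" using W(9)[OF s(2) yz(2)] by (simp add: s(3) q_add_left)
    qed
    then have "x = y + (x - w)" by (simp add: yz(3))
    then show "\<exists>t\<in>span B. \<exists>a\<in>A. x = t + a" using yz(1) w(2) by blast
  qed (use S sA AS BU US W(8,12) in auto)
  interpret U: form_model scale U q \<pi> "H\<lparr>carrier := \<pi> ` U\<rparr>" by (rule sub_model[OF sU US])
  have rkU: "rk (H\<lparr>carrier := \<pi> ` U\<rparr>) = 2 * card B"
    using U.rk_eq[of "B \<union> C"] W(1-5) by (simp add: U_def card_Un_disjoint)
  have BS: "span B \<subseteq> S" "span C \<subseteq> S" using BU US by auto
  have form_zero: "\<forall>x\<in>\<pi> ` R. \<forall>y\<in>\<pi> ` R'. form H x y = 0"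
    if "R \<subseteq> S" "R' \<subseteq> S" "\<And>x y. x \<in> R \<Longrightarrow> y \<in> R' \<Longrightarrow> q x y = 0" for R R'
  proof (intro ballI)
    fix h g assume "h \<in> \<pi> ` R" "g \<in> \<pi> ` R'"
    then obtain x y where "x \<in> R" "y \<in> R'" "h = \<pi> x" "g = \<pi> y" by blast
    then show "form H h g = 0" using form[OF subsetD[OF that(1)] subsetD[OF that(2)]] that(3) by simp
  qed
  \<comment> \<open>Attained by \<open>span B\<close>. A basis of any totally isotropic subspace is
    an isotropic independent set, so it is bounded by the maximality of B.\<close>
  have "witt_index H = card B" unfolding witt_index_def
  proof (rule Greatest_equality)
    interpret T: form_model scale "span B" q \<pi> "H\<lparr>carrier := \<pi> ` span B\<rparr>" by (rule sub_model[OF subspace_span BS(1)])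
    have "totally_isotropic H (\<pi> ` span B)"
      unfolding totally_isotropic_def using subspace_image[OF subspace_span BS(1)] form_zero[OF BS(1) BS(1) W(8)] by blast
    moreover have "rk (H\<lparr>carrier := \<pi> ` span B\<rparr>) = card B" by (rule T.rk_eq[OF W(1) indB refl])
    ultimately show "\<exists>W. totally_isotropic H W \<and> rk (H\<lparr>carrier := W\<rparr>) = card B" by blast
    fix n assume "\<exists>W. totally_isotropic H W \<and> rk (H\<lparr>carrier := W\<rparr>) = n"
    then obtain W' where W': "totally_isotropic H W'" "rk (H\<lparr>carrier := W'\<rparr>) = n" by blast
    obtain R where R: "subspace R" "R \<subseteq> S" "W' = \<pi> ` R"
      using W'(1) subspace_preimage unfolding totally_isotropic_def by blast
    obtain D where D: "finite D" "independent D" "R = span D" "D \<subseteq> R" using fin_sp_basis[OF fS R(1,2)] .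
    interpret R: form_model scale R q \<pi> "H\<lparr>carrier := \<pi> ` R\<rparr>" by (rule sub_model[OF R(1,2)])
    have "n = card D" using R.rk_eq[OF D(1-3)] W'(2) R(3) by simp
    also have "\<dots> \<le> card B"
    proof (rule W(14)[OF D(1,2)])
      show "D \<subseteq> S" using D(4) R(2) by blast
      fix x y assume "x \<in> D" "y \<in> D"
      then have xy: "x \<in> R" "y \<in> R" using D(4) by auto
      then have "form H (\<pi> x) (\<pi> y) = 0" using W'(1) R(3) unfolding totally_isotropic_def by blast
      then show "q x y = 0" using form[of x y] xy R(2) by auto
    qed
    finally show "n \<le> card B" .
  qed
  moreover have "hyperbolic (H\<lparr>carrier := \<pi> ` U\<rparr>)"
  proof -
    have 1: "nondegenerate (H\<lparr>carrier := \<pi> ` U\<rparr>)" unfolding nondegenerate_def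
    proof (intro ballI impI)
      fix h assume "h \<in> carrier (H\<lparr>carrier := \<pi> ` U\<rparr>)"
        and perp: "\<forall>g\<in>carrier (H\<lparr>carrier := \<pi> ` U\<rparr>). form (H\<lparr>carrier := \<pi> ` U\<rparr>) h g = 0"
      then obtain x where x: "x \<in> U" "h = \<pi> x" by auto
      have "q x y = 0" if "y \<in> U" for y using perp U.form[OF x(1) that] that by (auto simp: x(2))
      then have "x = 0" using nU[OF x(1)] q_swap_0 by blast
      then show "h = \<zero>\<^bsub>H\<lparr>carrier := \<pi> ` U\<rparr>\<^esub>" by (simp add: x(2) zero)
    qed
    have 2: "totally_isotropic (H\<lparr>carrier := \<pi> ` U\<rparr>) (\<pi> ` span B)"
      unfolding totally_isotropic_def
      using U.subspace_image[OF subspace_span BU(1)] form_zero[OF BS(1) BS(1) W(8)] by simp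
    have 3: "totally_isotropic (H\<lparr>carrier := \<pi> ` U\<rparr>) (\<pi> ` span C)"
      unfolding totally_isotropic_def
      using U.subspace_image[OF subspace_span BU(2)] form_zero[OF BS(2) BS(2) W(9)] by simp
    have "span B \<inter> span C = {0}"
    proof -
      have "x = 0" if x: "x \<in> span B" "x \<in> span C" for x
      proof (rule nU)
        show "x \<in> U" using x BU by blast
        fix y assume "y \<in> U"
        then obtain s1 s2 where s: "s1 \<in> span B" "s2 \<in> span C" "y = s1 + s2" using U_dec by blast
        show "q y x = 0" using W(8)[OF s(1) x(1)] W(9)[OF s(2) x(2)] by (simp add: s(3) q_add_left)
      qed
      then show ?thesis by (auto simp: span_zero)
    qed
    then have 4: "\<pi> ` span B \<inter> \<pi> ` span C = {\<zero>\<^bsub>H\<lparr>carrier := \<pi> ` U\<rparr>\<^esub>}"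
      using Int_image[OF BS] by simp
    have "{x + y | x y. x \<in> span B \<and> y \<in> span C} = U" by (simp add: U_def span_Un)
    then have 5: "\<pi> ` span B <+>\<^bsub>H\<lparr>carrier := \<pi> ` U\<rparr>\<^esub> \<pi> ` span C = carrier (H\<lparr>carrier := \<pi> ` U\<rparr>)"
      using U.set_add_image[OF BU] by simp
    show ?thesis unfolding hyperbolic_def using 1 2 3 4 5 by blast
  qed
  moreover have "nonisotropic (H\<lparr>carrier := \<pi> ` A\<rparr>)"
    unfolding nonisotropic_def
  proof (intro ballI impI)
    fix h assume h: "h \<in> carrier (H\<lparr>carrier := \<pi> ` A\<rparr>)" "form (H\<lparr>carrier := \<pi> ` A\<rparr>) h h = 0"
    then obtain a where a: "a \<in> A" "h = \<pi> a" by auto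
    then have "q a a = 0" using h(2) form[of a a] AS by auto
    then show "h = \<zero>\<^bsub>H\<lparr>carrier := \<pi> ` A\<rparr>\<^esub>" using W(12)[OF a(1)] a(2) zero by simp
  qed
  moreover have "\<pi> ` U \<inter> \<pi> ` A = {\<zero>\<^bsub>H\<^esub>}"
  proof (rule Int_image[OF US AS])
    show "U \<inter> A = {0}" using nU UA subspace_0[OF sU] subspace_0[OF sA] by blast
  qed
  moreover have "\<pi> ` U <+>\<^bsub>H\<^esub> \<pi> ` A = carrier H"
  proof -
    have "{x + y | x y. x \<in> U \<and> y \<in> A} = S"
    proof (intro equalityI subsetI)
      fix x assume "x \<in> S"
      then obtain w where w: "w \<in> U" "x - w \<in> A" using W(13) by (auto simp: U_def)
      have "x = w + (x - w)" by simp
      then show "x \<in> {x + y | x y. x \<in> U \<and> y \<in> A}" using w by blast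
    qed (use US AS S_add in blast)
    then show ?thesis using set_add_image[OF US AS] by (simp add: car)
  qed
  moreover have "\<forall>x\<in>\<pi> ` U. \<forall>y\<in>\<pi> ` A. form H x y = 0" by (rule form_zero[OF US AS UA])
  ultimately have "nonisotropic_part H (\<pi> ` A)"
    unfolding nonisotropic_part_def using subspace_image[OF sA AS] subspace_image[OF sU US] rkU
    by (intro conjI exI[of _ "\<pi> ` U"]) simp_all
  with red that show thesis by blast
qed

end

lemma (in form_model) neg_model:
  "form_model scale S (\<lambda>x y. - Q x y) \<pi> (neg_form H)"
  by unfold_locales (simp_all add: neg_form_def S car inj zero add smult form)

context nilpotent_form
begin

context
  fixes k and \<pi> :: "'b \<Rightarrow> 'g" and H and \<pi>' :: "'b \<Rightarrow> 'h" and H'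
  assumes G_model: "form_model scale (G k) (\<lambda>x y. q x ((u ^^ (2 * k)) y)) \<pi> H"
    and F_model: "form_model scale (F (Suc k)) (\<lambda>x y. q x ((u ^^ (2 * Suc k)) y)) \<pi>' H'"
begin

interpretation G: form_model scale "G k" "\<lambda>x y. q x ((u ^^ (2 * k)) y)" \<pi> H by (rule G_model)
interpretation NG: form_model scale "G k" "\<lambda>x y. - q x ((u ^^ (2 * k)) y)" \<pi> "neg_form H" by (rule G.neg_model)
interpretation F: hermitian_model scale \<sigma> "\<lambda>x y. q x ((u ^^ (2 * Suc k)) y)" "F (Suc k)" \<pi>' H'
  using F_model F_fin F_nondeg[of "Suc k"] lev.hermitian_space_axioms[of "2 * Suc k"]
  by (simp add: hermitian_model_def hermitian_model_axioms_def)

lemma witt_simplifies_if_anti_embeds: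
  assumes "\<And>T A. lev.aniso_reduction (2 * Suc k) (F (Suc k)) T A \<Longrightarrow> anti_embeds k A"
  shows "witt_simplifies H H'"
  unfolding witt_simplifies_def
proof (intro allI impI)
  fix W assume "nonisotropic_part H' W"
  from F.nonisotropic_part_reduction[OF this] obtain T A where
    red: "lev.aniso_reduction (2 * Suc k) (F (Suc k)) T A" and W: "W = \<pi>' ` A" by blast
  note d = lev.aniso_reductionD[OF red]
  \<comment> \<open>The reduction is compared with itself: what is gained is an additive and
    homogeneous f.\<close>
  obtain f where f_add: "\<And>x y. f (x + y) = f x + f y" and f_scale: "\<And>a x. f (a *s x) = a *s f x"
    and fG: "\<And>x. x \<in> A \<Longrightarrow> f x \<in> G k"
    and anti: "\<And>x y. x \<in> A \<Longrightarrow> y \<in> A \<Longrightarrow> q (f x) ((u ^^ (2 * k)) (f y)) = - q x ((u ^^ (2 * Suc k)) y)"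
    using anti_embedding_transfer[OF red red assms[OF red]] by blast
  have f0: "f 0 = 0" using f_scale[of 0 0] by simp
  have sub: "subspace (f ` A)"
  proof (rule subspaceI)
    show "0 \<in> f ` A" using subspace_0[OF d(3)] f0 by (metis image_eqI)
    show "x + y \<in> f ` A" if "x \<in> f ` A" "y \<in> f ` A" for x y
      using that d(3) by (auto simp: subspace_add simp flip: f_add)
    show "c *s x \<in> f ` A" if "x \<in> f ` A" for c x
      using that d(3) by (auto simp: subspace_scale simp flip: f_scale)
  qed
  have fA: "f ` A \<subseteq> G k" using fG by blast
  interpret A: form_model scale A "\<lambda>x y. q x ((u ^^ (2 * Suc k)) y)" \<pi>' "H'\<lparr>carrier := \<pi>' ` A\<rparr>"
    by (rule F.sub_model[OF d(3,5)])
  interpret Z: form_model scale "f ` A" "\<lambda>x y. - q x ((u ^^ (2 * k)) y)" \<pi> "(neg_form H)\<lparr>carrier := \<pi> ` (f ` A)\<rparr>"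
    by (rule NG.sub_model[OF sub fA])
  \<comment> \<open>Injectivity comes from nonisotropy: f (x - y) = 0 makes the norm of x - y
    vanish.\<close>
  have f_inj: "inj_on f A"
  proof (rule inj_onI)
    fix x y assume xy: "x \<in> A" "y \<in> A" "f x = f y"
    have "f (x - y) + f y = f x" by (simp flip: f_add)
    then have "f (x - y) = 0" using xy(3) by simp
    moreover have a: "x - y \<in> A" by (rule subspace_diff[OF d(3) xy(1,2)])
    ultimately have "q (x - y) ((u ^^ (2 * Suc k)) (x - y)) = 0" using anti[OF a a] by simp
    then show "x = y" using d(9)[OF a] by simp
  qed
  define g where "g = inv_into A \<pi>'"
  have g: "g (\<pi>' x) = x" if "x \<in> A" for x unfolding g_def by (rule inv_into_f_f[OF A.inj that])
  have "isometric (H'\<lparr>carrier := W\<rparr>) ((neg_form H)\<lparr>carrier := \<pi> ` (f ` A)\<rparr>)"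
    unfolding isometric_def W
  proof (intro exI[of _ "\<lambda>h. \<pi> (f (g h))"] conjI)
    have Zadd: "\<pi> (f x) \<oplus>\<^bsub>(neg_form H)\<lparr>carrier := \<pi> ` (f ` A)\<rparr>\<^esub> \<pi> (f y) = \<pi> (f (x + y))"
      if "x \<in> A" "y \<in> A" for x y
      unfolding f_add by (rule Z.add) (use that in auto)
    have Zsmult: "a \<odot>\<^bsub>(neg_form H)\<lparr>carrier := \<pi> ` (f ` A)\<rparr>\<^esub> \<pi> (f x) = \<pi> (f (a *s x))"
      if "x \<in> A" for a x
      unfolding f_scale by (rule Z.smult) (use that in auto)
    show "(\<lambda>h. \<pi> (f (g h))) \<in> LinearCombinations.module_hom class_ring (H'\<lparr>carrier := \<pi>' ` A\<rparr>)
        ((neg_form H)\<lparr>carrier := \<pi> ` (f ` A)\<rparr>)"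
      unfolding LinearCombinations.module_hom_def
    proof (intro CollectI conjI allI impI Pi_I)
      fix h assume "h \<in> carrier (H'\<lparr>carrier := \<pi>' ` A\<rparr>)"
      then obtain x where x: "x \<in> A" "h = \<pi>' x" by auto
      then show "\<pi> (f (g h)) \<in> carrier ((neg_form H)\<lparr>carrier := \<pi> ` (f ` A)\<rparr>)" by (simp add: g)
    next
      fix h h' assume "h \<in> carrier (H'\<lparr>carrier := \<pi>' ` A\<rparr>) \<and> h' \<in> carrier (H'\<lparr>carrier := \<pi>' ` A\<rparr>)"
      then obtain x y where x: "x \<in> A" "h = \<pi>' x" and y: "y \<in> A" "h' = \<pi>' y" by auto
      show "\<pi> (f (g (h \<oplus>\<^bsub>H'\<lparr>carrier := \<pi>' ` A\<rparr>\<^esub> h'))) =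
        \<pi> (f (g h)) \<oplus>\<^bsub>(neg_form H)\<lparr>carrier := \<pi> ` (f ` A)\<rparr>\<^esub> \<pi> (f (g h'))"
        unfolding x(2) y(2) A.add[OF x(1) y(1)] g[OF x(1)] g[OF y(1)] g[OF A.S_add[OF x(1) y(1)]]
        by (rule Zadd[OF x(1) y(1), symmetric])
    next
      fix a :: 'a and h assume "a \<in> carrier class_ring \<and> h \<in> carrier (H'\<lparr>carrier := \<pi>' ` A\<rparr>)"
      then obtain x where x: "x \<in> A" "h = \<pi>' x" by auto
      show "\<pi> (f (g (a \<odot>\<^bsub>H'\<lparr>carrier := \<pi>' ` A\<rparr>\<^esub> h))) =
        a \<odot>\<^bsub>(neg_form H)\<lparr>carrier := \<pi> ` (f ` A)\<rparr>\<^esub> \<pi> (f (g h))"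
        unfolding x(2) A.smult[OF x(1)] g[OF x(1)] g[OF A.S_scale[OF x(1)]] by (rule Zsmult[OF x(1), symmetric])
    qed
    have "inj_on (\<lambda>h. \<pi> (f (g h))) (\<pi>' ` A)"
    proof (rule inj_onI)
      fix h h' assume "h \<in> \<pi>' ` A" "h' \<in> \<pi>' ` A" and e: "\<pi> (f (g h)) = \<pi> (f (g h'))"
      then obtain x y where xy: "x \<in> A" "h = \<pi>' x" "y \<in> A" "h' = \<pi>' y" by auto
      then have "\<pi> (f x) = \<pi> (f y)" using e by (simp add: g)
      then have "f x = f y" using Z.inj xy by (auto dest: inj_onD)
      then show "h = h'" using f_inj xy by (auto dest: inj_onD)
    qed
    moreover have "(\<lambda>h. \<pi> (f (g h))) ` (\<pi>' ` A) = \<pi> ` (f ` A)" by (simp add: image_image g)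
    ultimately show "bij_betw (\<lambda>h. \<pi> (f (g h))) (carrier (H'\<lparr>carrier := \<pi>' ` A\<rparr>))
        (carrier ((neg_form H)\<lparr>carrier := \<pi> ` (f ` A)\<rparr>))"
      by (simp add: bij_betw_def)
    show "\<forall>x\<in>carrier (H'\<lparr>carrier := \<pi>' ` A\<rparr>). \<forall>y\<in>carrier (H'\<lparr>carrier := \<pi>' ` A\<rparr>).
       form ((neg_form H)\<lparr>carrier := \<pi> ` (f ` A)\<rparr>) (\<pi> (f (g x))) (\<pi> (f (g y))) = form (H'\<lparr>carrier := \<pi>' ` A\<rparr>) x y"
    proof (intro ballI)
      fix h h' assume "h \<in> carrier (H'\<lparr>carrier := \<pi>' ` A\<rparr>)" "h' \<in> carrier (H'\<lparr>carrier := \<pi>' ` A\<rparr>)"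
      then obtain x y where x: "x \<in> A" "h = \<pi>' x" and y: "y \<in> A" "h' = \<pi>' y" by auto
      show "form ((neg_form H)\<lparr>carrier := \<pi> ` (f ` A)\<rparr>) (\<pi> (f (g h))) (\<pi> (f (g h'))) = form (H'\<lparr>carrier := \<pi>' ` A\<rparr>) h h'"
        unfolding x(2) y(2) g[OF x(1)] g[OF y(1)] A.form[OF x(1) y(1)] Z.form[OF imageI[OF x(1)] imageI[OF y(1)]]
          anti[OF x(1) y(1)] by simp
    qed
  qed
  then show "\<exists>Z. VectorSpace.subspace class_ring Z (neg_form H) \<and>
      isometric (H'\<lparr>carrier := W\<rparr>) ((neg_form H)\<lparr>carrier := Z\<rparr>)"
    using NG.subspace_image[OF sub fA] by blast
qed

lemma anti_embeds_if_witt_simplifies: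
  assumes "witt_simplifies H H'"
  shows "\<exists>T A. lev.aniso_reduction (2 * Suc k) (F (Suc k)) T A \<and> anti_embeds k A"
proof -
  obtain T A where red: "lev.aniso_reduction (2 * Suc k) (F (Suc k)) T A" and W: "nonisotropic_part H' (\<pi>' ` A)"
    using F.nonisotropic_part_exists by blast
  note d = lev.aniso_reductionD[OF red]
  obtain Z \<phi> where Z: "VectorSpace.subspace class_ring Z (neg_form H)"
    "bij_betw \<phi> (carrier (H'\<lparr>carrier := \<pi>' ` A\<rparr>)) (carrier ((neg_form H)\<lparr>carrier := Z\<rparr>))"
    "\<And>x y. x \<in> \<pi>' ` A \<Longrightarrow> y \<in> \<pi>' ` A \<Longrightarrow> form (neg_form H) (\<phi> x) (\<phi> y) = form H' x y"
    using assms W unfolding witt_simplifies_def isometric_def by fastforce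
  obtain Z' where Z': "Z' \<subseteq> G k" "Z = \<pi> ` Z'" using NG.subspace_preimage[OF Z(1)] by blast
  have "\<exists>e. e \<in> G k \<and> \<phi> (\<pi>' a) = \<pi> e" if "a \<in> A" for a
  proof -
    have "\<phi> (\<pi>' a) \<in> Z" using Z(2) that by (auto simp: bij_betw_def)
    then show ?thesis using Z' by auto
  qed
  then obtain j where j: "\<And>a. a \<in> A \<Longrightarrow> j a \<in> G k \<and> \<phi> (\<pi>' a) = \<pi> (j a)" by metis
  have "q (j a) ((u ^^ (2 * k)) (j b)) = - q a ((u ^^ (2 * Suc k)) b)" if ab: "a \<in> A" "b \<in> A" for a b
  proof -
    have "- q (j a) ((u ^^ (2 * k)) (j b)) = form (neg_form H) (\<phi> (\<pi>' a)) (\<phi> (\<pi>' b))"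
      using j ab by (simp add: NG.form)
    also have "\<dots> = form H' (\<pi>' a) (\<pi>' b)" using Z(3) ab by blast
    also have "\<dots> = q a ((u ^^ (2 * Suc k)) b)" using F.form[OF subsetD[OF d(5) ab(1)] subsetD[OF d(5) ab(2)]] .
    finally show ?thesis by (metis minus_minus)
  qed
  then have "anti_embeds k A" unfolding anti_embeds_def using j by blast
  with red show ?thesis by blast
qed

end
end

section \<open>The forms on the quotients\<close>

locale carried_form = nilpotent_form scale \<sigma> q u X E K + V: form_model scale X q \<psi> V
  for scale :: "'f::field \<Rightarrow> 'b::ab_group_add \<Rightarrow> 'b" (infixr "*s" 75) and \<sigma> q u X E K
    and \<psi> :: "'b \<Rightarrow> 'v" and V +
  fixes uV :: "'v \<Rightarrow> 'v"
  assumes uV: "x \<in> X \<Longrightarrow> uV (\<psi> x) = \<psi> (u x)"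
begin

lemma uV_up: "x \<in> X \<Longrightarrow> (uV ^^ n) (\<psi> x) = \<psi> ((u ^^ n) x)"
proof (induction n)
  case (Suc n)
  then show ?case using uV[OF upX[OF Suc.prems, of n]] by (simp add: funpow.simps(2))
qed simp

lemma kernel_image: "a_kernel V V (uV ^^ n) = \<psi> ` {x \<in> X. (u ^^ n) x = 0}"
proof -
  have "\<psi> y = \<psi> 0 \<longleftrightarrow> y = 0" if "y \<in> X" for y using V.inj V.S_0 that by (auto dest: inj_onD)
  then show ?thesis using upX by (auto simp: a_kernel_def' V.car V.zero uV_up)
qed

text \<open>The subspace divided out in (b,u)_{t,2k+1}, read in X.\<close>

definition N :: "nat \<Rightarrow> 'b set" where
  "N k = {z + w | z w. z \<in> {x \<in> X. (u ^^ (2 * k)) x = 0} \<and> w \<in> {x \<in> X. (u ^^ (2 * k + 1)) x = 0} \<inter> u ` X}"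

definition coset :: "nat \<Rightarrow> 'b \<Rightarrow> 'v set" where
  "coset k x = \<psi> ` {n + x | n. n \<in> N k}"

lemma subspace_kernel: "subspace {x \<in> X. (u ^^ n) x = 0}"
  using sX by (auto simp: subspace_def up_simps)

lemma N_subspace: "subspace (N k)"
proof -
  have "subspace (u ` X)" using subspace_up_image[OF sX, of 1] by (simp add: funpow.simps(2))
  then show ?thesis unfolding N_def
    using subspace_sums[OF subspace_kernel subspace_inter[OF subspace_kernel]] by blast
qed

lemma N_X: "N k \<subseteq> X" unfolding N_def using sX by (auto intro: subspace_add uX)

lemma N_kernel: "n \<in> N k \<Longrightarrow> (u ^^ (2 * k + 1)) n = 0"
proof -
  assume "n \<in> N k"
  then obtain z w where "n = z + w" "(u ^^ (2 * k)) z = 0" "(u ^^ (2 * k + 1)) w = 0" by (auto simp: N_def)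
  then show ?thesis using up_zero_mono[of "2 * k" z "2 * k + 1"] by (simp add: up_add)
qed

lemma N_perp: "n \<in> N k \<Longrightarrow> (u ^^ (2 * k + 1)) x = 0 \<Longrightarrow> q n ((u ^^ (2 * k)) x) = 0"
proof -
  assume n: "n \<in> N k" and x: "(u ^^ (2 * k + 1)) x = 0"
  obtain z w where zw: "n = z + u w" "(u ^^ (2 * k)) z = 0" using n by (auto simp: N_def)
  have "q z ((u ^^ (2 * k)) x) = q ((u ^^ (2 * k)) z) x" by (simp only: up_sa)
  moreover have "q (u w) ((u ^^ (2 * k)) x) = q w ((u ^^ (2 * k + 1)) x)" by (simp add: u_sa u_up2)
  ultimately show ?thesis using zw x by (simp add: q_add_left)
qed

lemma coset_eq_iff:
  assumes "x \<in> X" "y \<in> X"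
  shows "coset k x = coset k y \<longleftrightarrow> x - y \<in> N k"
proof
  assume "coset k x = coset k y"
  moreover have "\<psi> x \<in> coset k x" using subspace_0[OF N_subspace] by (force simp: coset_def)
  ultimately obtain n where n: "n \<in> N k" "\<psi> x = \<psi> (n + y)" by (auto simp: coset_def)
  have "n + y \<in> X" using n(1) N_X assms(2) sX by (auto intro: subspace_add)
  then have "x = n + y" using V.inj n(2) assms(1) by (auto dest: inj_onD)
  then show "x - y \<in> N k" using n(1) by simp
next
  assume xy: "x - y \<in> N k"
  have "{n + x | n. n \<in> N k} = {n + y | n. n \<in> N k}"
  proof (intro equalityI subsetI)
    fix z assume "z \<in> {n + x | n. n \<in> N k}"
    then obtain n where n: "n \<in> N k" "z = n + x" by blast
    have "z = (n + (x - y)) + y" using n by simp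
    then show "z \<in> {n + y | n. n \<in> N k}" using subspace_add[OF N_subspace n(1) xy] by blast
  next
    fix z assume "z \<in> {n + y | n. n \<in> N k}"
    then obtain n where n: "n \<in> N k" "z = n + y" by blast
    have "z = (n - (x - y)) + x" using n by simp
    then show "z \<in> {n + x | n. n \<in> N k}" using subspace_diff[OF N_subspace n(1) xy] by blast
  qed
  then show "coset k x = coset k y" by (simp add: coset_def)
qed

text \<open>Each coset has exactly one representative in \<open>G k\<close>: one exists by
  \<open>ker_decomp\<close>, and two would differ by an element of \<open>N k\<close>, which is
  orthogonal to the kernel at level 2 * k, where \<open>G k\<close> is nondegenerate.\<close>

lemma t_form_model:
  "form_model scale (G k) (\<lambda>x y. q x ((u ^^ (2 * k)) y)) (coset k) (t_form V uV (2 * k + 1))"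
proof -
  define VV where "VV = V\<lparr>carrier := a_kernel V V (uV ^^ (2 * k + 1)), form := (\<lambda>x y. form V x ((uV ^^ (2 * k)) y))\<rparr>"
  have im: "\<psi> ` {x \<in> X. (u ^^ (2 * k + 1)) x = 0} \<inter> uV ` carrier V = \<psi> ` ({x \<in> X. (u ^^ (2 * k + 1)) x = 0} \<inter> u ` X)"
  proof -
    have e: "uV ` carrier V = \<psi> ` (u ` X)" by (auto simp: V.car uV image_image)
    have "{x \<in> X. (u ^^ (2 * k + 1)) x = 0} \<subseteq> X" "u ` X \<subseteq> X" using uX by auto
    then show ?thesis unfolding e by (rule inj_on_image_Int[OF V.inj, symmetric])
  qed
  have NN: "a_kernel V V (uV ^^ (2 * k)) <+>\<^bsub>V\<^esub> (a_kernel V V (uV ^^ (2 * k + 1)) \<inter> uV ` carrier V) = \<psi> ` N k"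
    unfolding kernel_image im N_def by (rule V.set_add_image) auto
  have t: "t_form V uV (2 * k + 1) = quotient_form VV (\<psi> ` N k)"
    unfolding t_form_def NN[symmetric] VV_def by simp
  have GX: "x \<in> X" "(u ^^ (2 * k + 1)) x = 0" if "x \<in> G k" for x
    using that G_X E_killed[of x "2 * k + 1"] by (auto simp: G_def)
  have NxX: "n + x \<in> X" if "n \<in> N k" "x \<in> X" for n x using that N_X sX by (auto intro: subspace_add)
  have cos: "\<psi> ` N k +>\<^bsub>VV\<^esub> \<psi> x = coset k x" if "x \<in> X" for x
  proof -
    have "\<psi> ` N k +>\<^bsub>VV\<^esub> \<psi> x = (\<Union>n\<in>N k. {\<psi> n \<oplus>\<^bsub>V\<^esub> \<psi> x})" by (simp add: a_r_coset_def' VV_def)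
    also have "\<dots> = (\<Union>n\<in>N k. {\<psi> (n + x)})"
      by (intro SUP_cong refl) (simp add: V.add[OF subsetD[OF N_X] that])
    also have "\<dots> = coset k x" by (auto simp: coset_def)
    finally show ?thesis .
  qed
  have cE: "\<exists>n\<in>N k. h = \<psi> (n + x)" if "h \<in> coset k x" for h x using that by (auto simp: coset_def)
  have cI: "\<psi> (n + x) \<in> coset k x" if "n \<in> N k" for n x using that by (auto simp: coset_def)
  show ?thesis unfolding t
  proof (unfold_locales)
    show "subspace (G k)" by (rule G_subspace)
    have "carrier (quotient_form VV (\<psi> ` N k)) = (\<Union>a\<in>carrier VV. {\<psi> ` N k +>\<^bsub>VV\<^esub> a})"
      by (simp add: quotient_form_def A_RCOSETS_def')
    also have "\<dots> = (\<Union>x\<in>{x \<in> X. (u ^^ (2 * k + 1)) x = 0}. {coset k x})"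
      using cos by (auto simp: VV_def kernel_image)
    also have "\<dots> = coset k ` G k"
    proof (intro equalityI subsetI)
      fix h assume "h \<in> (\<Union>x\<in>{x \<in> X. (u ^^ (2 * k + 1)) x = 0}. {coset k x})"
      then obtain x where x: "x \<in> X" "(u ^^ (2 * k + 1)) x = 0" "h = coset k x" by blast
      obtain e z w where e: "e \<in> E (2 * k + 1)" "z \<in> X" "w \<in> X" "(u ^^ (2 * k + 1 - 1)) z = 0"
        "(u ^^ Suc (2 * k + 1)) w = 0" "x = e + z + u w" using ker_decomp[OF x(1,2)] .
      have "u w \<in> {x \<in> X. (u ^^ (2 * k + 1)) x = 0} \<inter> u ` X" using e(3,5) uX by (auto simp: u_up2)
      then have "x - e \<in> N k" unfolding N_def using e(2,4,6) by auto
      then have "h = coset k e" using coset_eq_iff[OF x(1), of e] e(1) E_X x(3) by auto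
      then show "h \<in> coset k ` G k" using e(1) by (simp add: G_def)
    qed (use GX in blast)
    finally show "carrier (quotient_form VV (\<psi> ` N k)) = coset k ` G k" .
    show "inj_on (coset k) (G k)"
    proof (rule inj_onI)
      fix x y assume xy: "x \<in> G k" "y \<in> G k" "coset k x = coset k y"
      then have n: "x - y \<in> N k" using coset_eq_iff GX by blast
      have "x - y \<in> G k" using subspace_diff[OF G_subspace] xy by blast
      then have "x - y = 0"
      proof (rule lev.nondegD[OF G_nondeg])
        fix z assume "z \<in> G k"
        then have "q (x - y) ((u ^^ (2 * k)) z) = 0" using N_perp[OF n] GX by blast
        then show "q z ((u ^^ (2 * k)) (x - y)) = 0" using lev.q_swap_0[of _ "2 * k"] by blast
      qed
      then show "x = y" by simp
    qed
    have "coset k 0 = \<psi> ` N k" by (simp add: coset_def)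
    then show "\<zero>\<^bsub>quotient_form VV (\<psi> ` N k)\<^esub> = coset k 0" by (simp add: quotient_form_def)
    show "coset k x \<oplus>\<^bsub>quotient_form VV (\<psi> ` N k)\<^esub> coset k y = coset k (x + y)" if xy: "x \<in> G k" "y \<in> G k" for x y
    proof -
      have X: "x \<in> X" "y \<in> X" using xy GX by auto
      have "coset k x \<oplus>\<^bsub>quotient_form VV (\<psi> ` N k)\<^esub> coset k y = (\<Union>h\<in>coset k x. \<Union>g\<in>coset k y. {h \<oplus>\<^bsub>V\<^esub> g})"
        by (simp add: quotient_form_def set_add_def set_mult_def VV_def)
      also have "\<dots> = coset k (x + y)"
      proof (intro equalityI subsetI)
        fix h assume "h \<in> (\<Union>h\<in>coset k x. \<Union>g\<in>coset k y. {h \<oplus>\<^bsub>V\<^esub> g})"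
        then obtain n m where nm: "n \<in> N k" "m \<in> N k" "h = \<psi> (n + x) \<oplus>\<^bsub>V\<^esub> \<psi> (m + y)" using cE by blast
        have "h = \<psi> ((n + m) + (x + y))" using nm(3) NxX[OF nm(1) X(1)] NxX[OF nm(2) X(2)] by (simp add: V.add ac_simps)
        then show "h \<in> coset k (x + y)" using cI subspace_add[OF N_subspace nm(1,2)] by blast
      next
        fix h assume "h \<in> coset k (x + y)"
        then obtain n where n: "n \<in> N k" "h = \<psi> (n + (x + y))" using cE by blast
        then have "h = \<psi> (n + x) \<oplus>\<^bsub>V\<^esub> \<psi> (0 + y)" using NxX[OF n(1) X(1)] X by (simp add: V.add ac_simps)
        then show "h \<in> (\<Union>h\<in>coset k x. \<Union>g\<in>coset k y. {h \<oplus>\<^bsub>V\<^esub> g})"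
          using cI[OF n(1)] cI[OF subspace_0[OF N_subspace]] by blast
      qed
      finally show ?thesis .
    qed
    show "a \<odot>\<^bsub>quotient_form VV (\<psi> ` N k)\<^esub> coset k x = coset k (a *s x)" if x: "x \<in> G k" for a x
    proof -
      have X: "x \<in> X" using x GX by auto
      have "\<psi> ` N k +>\<^bsub>VV\<^esub> (a \<odot>\<^bsub>V\<^esub> h) = coset k (a *s x)" if h: "h \<in> coset k x" for h
      proof -
        obtain n where n: "n \<in> N k" "h = \<psi> (n + x)" using cE[OF h] by blast
        have aX: "a *s (n + x) \<in> X" "a *s x \<in> X" using NxX[OF n(1) X] X sX by (auto intro: subspace_scale)
        have "a \<odot>\<^bsub>V\<^esub> h = \<psi> (a *s (n + x))" using n NxX[OF n(1) X] by (simp add: V.smult)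
        then have "\<psi> ` N k +>\<^bsub>VV\<^esub> (a \<odot>\<^bsub>V\<^esub> h) = coset k (a *s (n + x))" using cos aX by simp
        also have "\<dots> = coset k (a *s x)"
          using coset_eq_iff[OF aX] subspace_scale[OF N_subspace n(1)] by (simp add: scale_right_distrib)
        finally show ?thesis .
      qed
      moreover have "coset k x \<noteq> {}" using cI[OF subspace_0[OF N_subspace]] by blast
      ultimately have "(\<Union>h\<in>coset k x. \<psi> ` N k +>\<^bsub>VV\<^esub> (a \<odot>\<^bsub>V\<^esub> h)) = coset k (a *s x)" by auto
      then show ?thesis by (simp add: quotient_form_def VV_def)
    qed
    show "form (quotient_form VV (\<psi> ` N k)) (coset k x) (coset k y) = q x ((u ^^ (2 * k)) y)"
      if xy: "x \<in> G k" "y \<in> G k" for x y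
    proof -
      have X: "x \<in> X" "y \<in> X" using xy GX by auto
      have val: "form V h ((uV ^^ (2 * k)) g) = q x ((u ^^ (2 * k)) y)"
        if hg: "h \<in> coset k x" "g \<in> coset k y" for h g
      proof -
        obtain n where n: "n \<in> N k" "h = \<psi> (n + x)" using cE[OF hg(1)] by blast
        obtain m where m: "m \<in> N k" "g = \<psi> (m + y)" using cE[OF hg(2)] by blast
        have "form V h ((uV ^^ (2 * k)) g) = q (n + x) ((u ^^ (2 * k)) (m + y))"
          using NxX[OF n(1) X(1)] NxX[OF m(1) X(2)] by (simp add: n(2) m(2) uV_up upX V.form)
        also have "\<dots> = q n ((u ^^ (2 * k)) m) + q n ((u ^^ (2 * k)) y) + q x ((u ^^ (2 * k)) m) + q x ((u ^^ (2 * k)) y)"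
          by (simp add: q_add_left q_add_right up_add)
        also have "q x ((u ^^ (2 * k)) m) = 0"
          using N_perp[OF m(1) GX(2)[OF xy(1)]] lev.q_swap_0[of _ "2 * k"] by blast
        finally show ?thesis using N_perp[OF n(1) N_kernel[OF m(1)]] N_perp[OF n(1) GX(2)[OF xy(2)]] by simp
      qed
      have "form (quotient_form VV (\<psi> ` N k)) (coset k x) (coset k y) =
        (THE c. \<forall>h\<in>coset k x. \<forall>g\<in>coset k y. form V h ((uV ^^ (2 * k)) g) = c)"
        by (simp add: quotient_form_def VV_def)
      also have "\<dots> = q x ((u ^^ (2 * k)) y)"
      proof (rule the_equality)
        fix c assume c: "\<forall>h\<in>coset k x. \<forall>g\<in>coset k y. form V h ((uV ^^ (2 * k)) g) = c"
        have xc: "\<psi> (0 + x) \<in> coset k x" and yc: "\<psi> (0 + y) \<in> coset k y"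
          by (rule cI[OF subspace_0[OF N_subspace]])+
        show "c = q x ((u ^^ (2 * k)) y)" using c[rule_format, OF xc yc] val[OF xc yc] by (rule trans[OF sym])
      qed (use val in blast)
      finally show ?thesis .
    qed
  qed
qed

end

section \<open>Orthogonal sums of the odd forms as families of vectors\<close>

context selfadjoint_operator
begin

lemma q_sum_left: "q (\<Sum>a\<in>A. f a) y = (\<Sum>a\<in>A. q (f a) y)"
  by (induction A rule: infinite_finite_induct) (simp_all add: q_add_left)

lemma q_sum_right: "q x (\<Sum>a\<in>A. f a) = (\<Sum>a\<in>A. q x (f a))"
  by (induction A rule: infinite_finite_induct) (simp_all add: q_add_right)

lemma up_sum: "(u ^^ n) (\<Sum>a\<in>A. f a) = (\<Sum>a\<in>A. (u ^^ n) (f a))"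
  by (induction A rule: infinite_finite_induct) (simp_all add: up_add)

end

context nilpotent_form
begin

text \<open>Indexed by all natural numbers and zero below l. From K on the entries vanish by
  \<open>G_large\<close>, so the sum in \<open>assemble\<close> is finite and the support condition
  of \<open>orth_sum\<close> holds.\<close>

definition families :: "nat \<Rightarrow> (nat \<Rightarrow> 'b) set" where
  "families l = {g. (\<forall>i. g i \<in> G i) \<and> (\<forall>i<l. g i = 0)}"

definition assemble :: "nat \<Rightarrow> (nat \<Rightarrow> 'b) \<Rightarrow> 'b" where
  "assemble l g = (\<Sum>i\<in>{l..<K}. (u ^^ (i - l)) (g i))"

lemma families_add: "g \<in> families l \<Longrightarrow> h \<in> families l \<Longrightarrow> (\<lambda>i. g i + h i) \<in> families l"
  and families_scale: "g \<in> families l \<Longrightarrow> (\<lambda>i. a *s g i) \<in> families l"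
  and families_diff: "g \<in> families l \<Longrightarrow> h \<in> families l \<Longrightarrow> (\<lambda>i. g i - h i) \<in> families l"
  by (simp_all add: families_def subspace_add[OF G_subspace] subspace_scale[OF G_subspace] subspace_diff[OF G_subspace])

lemma families_single: "x \<in> G i \<Longrightarrow> l \<le> i \<Longrightarrow> (\<lambda>j. if j = i then x else 0) \<in> families l"
  by (simp add: families_def subspace_0[OF G_subspace])

lemma assemble_add: "assemble l (\<lambda>i. g i + h i) = assemble l g + assemble l h"
  and assemble_scale: "assemble l (\<lambda>i. a *s g i) = a *s assemble l g"
  and assemble_diff: "assemble l (\<lambda>i. g i - h i) = assemble l g - assemble l h"
  by (simp_all add: assemble_def up_simps sum.distrib scale_sum_right sum_subtractf)

lemma assemble_form:
  assumes "g \<in> families l" "h \<in> families l"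
  shows "q (assemble l g) ((u ^^ (2 * l)) (assemble l h)) = (\<Sum>i\<in>{l..<K}. q (g i) ((u ^^ (2 * i)) (h i)))"
proof -
  have "q (assemble l g) ((u ^^ (2 * l)) (assemble l h)) =
      (\<Sum>i\<in>{l..<K}. \<Sum>j\<in>{l..<K}. q ((u ^^ (i - l)) (g i)) ((u ^^ (2 * l)) ((u ^^ (j - l)) (h j))))"
    by (simp only: assemble_def q_sum_left q_sum_right up_sum) (rule sum.swap)
  also have "\<dots> = (\<Sum>i\<in>{l..<K}. \<Sum>j\<in>{l..<K}. if i = j then q (g i) ((u ^^ (2 * i)) (h i)) else 0)"
  proof (intro sum.cong refl)
    fix i j assume ij: "i \<in> {l..<K}" "j \<in> {l..<K}"
    define e where "e = i - l + (2 * l + (j - l))"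
    have "q ((u ^^ (i - l)) (g i)) ((u ^^ (2 * l)) ((u ^^ (j - l)) (h j))) = q (g i) ((u ^^ e) (h j))"
      by (simp only: up_sa up_up e_def)
    moreover have "i = j \<Longrightarrow> e = 2 * i" using ij by (simp add: e_def)
    moreover have "q (g i) ((u ^^ p) (h j)) = 0" if "i \<noteq> j" for p
      by (rule G_diff[OF _ _ that]) (use assms in \<open>simp_all add: families_def\<close>)
    ultimately show "q ((u ^^ (i - l)) (g i)) ((u ^^ (2 * l)) ((u ^^ (j - l)) (h j))) =
       (if i = j then q (g i) ((u ^^ (2 * i)) (h i)) else 0)" by auto
  qed
  also have "\<dots> = (\<Sum>i\<in>{l..<K}. q (g i) ((u ^^ (2 * i)) (h i)))" by simp
  finally show ?thesis .
qed

text \<open>Pairing the difference with a family having a single nonzero entry y isolates one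
  component, which vanishes by nondegeneracy of \<open>G i\<close>.\<close>

lemma assemble_inj: "inj_on (assemble l) (families l)"
proof (rule inj_onI)
  fix g h assume gh: "g \<in> families l" "h \<in> families l" "assemble l g = assemble l h"
  define d where "d i = g i - h i" for i
  have d: "d \<in> families l" using families_diff[OF gh(1,2)] by (simp add: d_def[abs_def])
  have d0: "assemble l d = 0" using gh(3) by (simp add: d_def[abs_def] assemble_diff)
  have "d i = 0" for i
  proof (cases "l \<le> i \<and> i < K")
    case True
    show ?thesis
    proof (rule lev.nondegD[OF G_nondeg])
      show "d i \<in> G i" using d by (simp add: families_def)
      fix y assume y: "y \<in> G i"
      have "0 = (\<Sum>j\<in>{l..<K}. q (if j = i then y else 0) ((u ^^ (2 * j)) (d j)))"
        using assemble_form[OF families_single[OF y] d] True by (simp add: d0)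
      also have "\<dots> = (\<Sum>j\<in>{l..<K}. if j = i then q y ((u ^^ (2 * i)) (d i)) else 0)"
        by (intro sum.cong) auto
      also have "\<dots> = q y ((u ^^ (2 * i)) (d i))" using True by simp
      finally show "q y ((u ^^ (2 * i)) (d i)) = 0" ..
    qed
  next
    case False
    have "d i \<in> G i" "i < l \<longrightarrow> d i = 0" using d by (simp_all add: families_def)
    then show ?thesis using False G_large[of i] by (cases "i < l") auto
  qed
  then show "g = h" by (simp add: d_def fun_eq_iff)
qed

lemma assemble_image: "assemble l ` families l = F l"
proof
  show "assemble l ` families l \<subseteq> F l"
  proof
    fix x assume "x \<in> assemble l ` families l"
    then obtain g where g: "g \<in> families l" "x = assemble l g" by blast
    show "x \<in> F l" unfolding g(2) assemble_def
    proof (rule subspace_sum[OF F_subspace])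
      fix i assume "i \<in> {l..<K}"
      then show "(u ^^ (i - l)) (g i) \<in> F l"
        unfolding F_def using g(1) by (intro span_base) (auto simp: families_def)
    qed
  qed
  show "F l \<subseteq> assemble l ` families l"
    unfolding F_def
  proof (rule span_minimal)
    show "(\<Union>i\<in>{l..}. (u ^^ (i - l)) ` G i) \<subseteq> assemble l ` families l"
    proof
      fix x assume "x \<in> (\<Union>i\<in>{l..}. (u ^^ (i - l)) ` G i)"
      then obtain i y where iy: "l \<le> i" "y \<in> G i" "x = (u ^^ (i - l)) y" by auto
      have "assemble l (\<lambda>j. if j = i then y else 0) = (\<Sum>j\<in>{l..<K}. if j = i then x else 0)"
        unfolding assemble_def using iy(3) by (intro sum.cong) auto
      also have "\<dots> = x" using iy G_large[of i] by (cases "i < K") auto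
      finally show "x \<in> assemble l ` families l" using families_single[OF iy(2,1)] by (metis image_eqI)
    qed
    show "subspace (assemble l ` families l)"
    proof (rule subspaceI)
      have "(\<lambda>_. 0) \<in> families l" by (simp add: families_def subspace_0[OF G_subspace])
      moreover have "assemble l (\<lambda>_. 0) = 0" by (simp add: assemble_def)
      ultimately show "0 \<in> assemble l ` families l" by (metis image_eqI)
      show "x + y \<in> assemble l ` families l" if xy: "x \<in> assemble l ` families l" "y \<in> assemble l ` families l" for x y
      proof -
        obtain g h where "g \<in> families l" "h \<in> families l" "x = assemble l g" "y = assemble l h" using xy by blast
        then show ?thesis by (intro image_eqI[OF _ families_add[of g l h]]) (simp_all add: assemble_add)
      qed
      show "c *s x \<in> assemble l ` families l" if x: "x \<in> assemble l ` families l" for c x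
      proof -
        obtain g where "g \<in> families l" "x = assemble l g" using x by blast
        then show ?thesis by (intro image_eqI[OF _ families_scale[of g l c]]) (simp_all add: assemble_scale)
      qed
    qed
  qed
qed

definition component :: "nat \<Rightarrow> 'b \<Rightarrow> nat \<Rightarrow> 'b" where
  "component l = inv_into (families l) (assemble l)"

lemma component_families: "x \<in> F l \<Longrightarrow> component l x \<in> families l"
  and assemble_component: "x \<in> F l \<Longrightarrow> assemble l (component l x) = x"
  unfolding component_def assemble_image[symmetric] by (simp_all add: inv_into_into f_inv_into_f)

lemma component_assemble: "g \<in> families l \<Longrightarrow> component l (assemble l g) = g"
  unfolding component_def by (rule inv_into_f_f[OF assemble_inj])

lemma component_G: "x \<in> F l \<Longrightarrow> component l x i \<in> G i"
  using component_families[of x l] by (simp add: families_def)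

lemma component_large: "x \<in> F l \<Longrightarrow> K \<le> i \<Longrightarrow> component l x i = 0"
  using component_G[of x l i] G_large[of i] by simp

lemma component_add: "x \<in> F l \<Longrightarrow> y \<in> F l \<Longrightarrow> component l (x + y) i = component l x i + component l y i"
  using component_assemble[OF families_add[OF component_families component_families], of x l y]
  by (simp add: assemble_add assemble_component fun_eq_iff)

lemma component_scale: "x \<in> F l \<Longrightarrow> component l (a *s x) i = a *s component l x i"
  using component_assemble[OF families_scale[OF component_families], of x l a]
  by (simp add: assemble_scale assemble_component fun_eq_iff)

lemma component_0: "component l 0 i = 0"
  using component_scale[OF subspace_0[OF F_subspace], of l 0 i] by simp

lemma orth_sum_model:
  assumes "\<And>i. form_model scale (G i) (\<lambda>x y. q x ((u ^^ (2 * i)) y)) (c i) (T i)"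
  shows "form_model scale (F (Suc k)) (\<lambda>x y. q x ((u ^^ (2 * Suc k)) y))
     (\<lambda>x. \<lambda>i\<in>{i. i > k}. c i (component (Suc k) x i)) (orth_sum {i. i > k} T)"
proof -
  interpret T: form_model scale "G i" "\<lambda>x y. q x ((u ^^ (2 * i)) y)" "c i" "T i" for i by (rule assms)
  define l where "l = Suc k"
  define \<pi> where "\<pi> x = (\<lambda>i\<in>{i. i > k}. c i (component l x i))" for x
  have cinj: "c i x = c i y \<longleftrightarrow> x = y" if "x \<in> G i" "y \<in> G i" for i x y
    using T.inj that by (auto dest: inj_onD)
  have c0: "c i x = c i 0 \<longleftrightarrow> x = 0" if "x \<in> G i" for i x by (rule cinj[OF that subspace_0[OF G_subspace]])
  have "form_model scale (F l) (\<lambda>x y. q x ((u ^^ (2 * l)) y)) \<pi> (orth_sum {i. i > k} T)"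
  proof unfold_locales
    show "subspace (F l)" by (rule F_subspace)
    show "carrier (orth_sum {i. i > k} T) = \<pi> ` F l"
    proof (intro equalityI subsetI)
      fix f assume f: "f \<in> carrier (orth_sum {i. i > k} T)"
      have "\<exists>x. x \<in> G i \<and> f i = c i x" if "i > k" for i
        using f that by (auto simp: orth_sum_def PiE_def Pi_def T.car)
      then obtain g0 where g0: "\<And>i. i > k \<Longrightarrow> g0 i \<in> G i \<and> f i = c i (g0 i)" by metis
      define g where "g i = (if i > k then g0 i else 0)" for i
      have g: "g \<in> families l"
        using g0 subspace_0[OF G_subspace] by (auto simp: families_def g_def l_def)
      have "f i = \<pi> (assemble l g) i" for i
      proof (cases "i > k")
        case True
        then show ?thesis using g0 by (simp add: \<pi>_def component_assemble[OF g] g_def)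
      next
        case False
        then show ?thesis using f by (auto simp: orth_sum_def \<pi>_def PiE_def extensional_def)
      qed
      then show "f \<in> \<pi> ` F l" using assemble_image[of l] g by blast
    next
      fix f assume "f \<in> \<pi> ` F l"
      then obtain x where x: "x \<in> F l" "f = \<pi> x" by blast
      have "f i = \<zero>\<^bsub>T i\<^esub>" if "i > k" "K \<le> i" for i
        using component_large[OF x(1) that(2)] that(1) by (simp add: x(2) \<pi>_def T.zero)
      then have "{i \<in> {i. i > k}. f i \<noteq> \<zero>\<^bsub>T i\<^esub>} \<subseteq> {..<K}"
        using not_less by auto
      then have "finite {i \<in> {i. i > k}. f i \<noteq> \<zero>\<^bsub>T i\<^esub>}" by (rule finite_subset) simp
      moreover have "f \<in> (\<Pi>\<^sub>E i\<in>{i. i > k}. carrier (T i))"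
        using component_G[OF x(1)] by (auto simp: x(2) \<pi>_def T.car)
      ultimately show "f \<in> carrier (orth_sum {i. i > k} T)" by (simp add: orth_sum_def)
    qed
    show "inj_on \<pi> (F l)"
    proof (rule inj_onI)
      fix x y assume xy: "x \<in> F l" "y \<in> F l" "\<pi> x = \<pi> y"
      have "component l x i = component l y i" for i
      proof (cases "i > k")
        case True
        then have "c i (component l x i) = c i (component l y i)"
          using fun_cong[OF xy(3), of i] by (simp add: \<pi>_def)
        then show ?thesis using cinj component_G xy by blast
      next
        case False
        then show ?thesis using component_families[OF xy(1)] component_families[OF xy(2)]
          by (simp add: families_def l_def)
      qed
      then have "component l x = component l y" by (simp add: fun_eq_iff)
      then show "x = y" using assemble_component xy by metis
    qed
    show "\<zero>\<^bsub>orth_sum {i. i > k} T\<^esub> = \<pi> 0"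
      by (simp add: orth_sum_def \<pi>_def T.zero component_0)
    show "\<pi> x \<oplus>\<^bsub>orth_sum {i. i > k} T\<^esub> \<pi> y = \<pi> (x + y)" if xy: "x \<in> F l" "y \<in> F l" for x y
      using component_G[OF xy(1)] component_G[OF xy(2)]
      by (auto simp: orth_sum_def \<pi>_def component_add[OF xy] T.add intro!: restrict_ext)
    show "a \<odot>\<^bsub>orth_sum {i. i > k} T\<^esub> \<pi> x = \<pi> (a *s x)" if x: "x \<in> F l" for a x
      using component_G[OF x]
      by (auto simp: orth_sum_def \<pi>_def component_scale[OF x] T.smult intro!: restrict_ext)
    show "form (orth_sum {i. i > k} T) (\<pi> x) (\<pi> y) = q x ((u ^^ (2 * l)) y)" if xy: "x \<in> F l" "y \<in> F l" for x y
    proof -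
      define J where "J = {i. i > k \<and> \<pi> x i \<noteq> \<zero>\<^bsub>T i\<^esub> \<and> \<pi> y i \<noteq> \<zero>\<^bsub>T i\<^esub>}"
      \<comment> \<open>\<open>orth_sum\<close> adds only over indices at which both entries are
        nonzero. These lie below K, and the other indices of the full range contribute zero.\<close>
      have J: "J = {i \<in> {l..<K}. component l x i \<noteq> 0 \<and> component l y i \<noteq> 0}"
      proof -
        have "i < K" if "component l x i \<noteq> 0" for i using component_large[OF xy(1), of i] that not_less by blast
        then show ?thesis using component_G[OF xy(1)] component_G[OF xy(2)]
          by (auto simp: J_def \<pi>_def T.zero c0 l_def)
      qed
      have "form (orth_sum {i. i > k} T) (\<pi> x) (\<pi> y) = (\<Sum>i\<in>J. form (T i) (\<pi> x i) (\<pi> y i))"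
        by (simp add: orth_sum_def J_def)
      also have "\<dots> = (\<Sum>i\<in>J. q (component l x i) ((u ^^ (2 * i)) (component l y i)))"
      proof (rule sum.cong[OF refl])
        fix i assume "i \<in> J"
        then have "i > k" by (simp add: J_def)
        then show "form (T i) (\<pi> x i) (\<pi> y i) = q (component l x i) ((u ^^ (2 * i)) (component l y i))"
          using T.form[OF component_G[OF xy(1)] component_G[OF xy(2)]] by (simp add: \<pi>_def)
      qed
      also have "\<dots> = (\<Sum>i\<in>{l..<K}. q (component l x i) ((u ^^ (2 * i)) (component l y i)))"
        by (rule sum.mono_neutral_left) (auto simp: J)
      also have "\<dots> = q x ((u ^^ (2 * l)) y)"
        using assemble_form[OF component_families[OF xy(1)] component_families[OF xy(2)]]
        by (simp add: assemble_component xy)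
      finally show ?thesis .
    qed
  qed
  then show ?thesis by (simp only: l_def \<pi>_def[abs_def])
qed

end

context carried_form
begin

lemma anti_embeds_if_t_form_witt_simplifies:
  assumes "witt_simplifies (t_form V uV (2 * k + 1)) (orth_sum {i. i > k} (\<lambda>i. t_form V uV (2 * i + 1)))"
  shows "\<exists>T A. lev.aniso_reduction (2 * Suc k) (F (Suc k)) T A \<and> anti_embeds k A"
  using t_form_model orth_sum_model[OF t_form_model] assms by (rule anti_embeds_if_witt_simplifies)

lemma t_form_witt_simplifies_if_anti_embeds:
  assumes "\<And>T A. lev.aniso_reduction (2 * Suc k) (F (Suc k)) T A \<Longrightarrow> anti_embeds k A"
  shows "witt_simplifies (t_form V uV (2 * k + 1)) (orth_sum {i. i > k} (\<lambda>i. t_form V uV (2 * i + 1)))"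
  using t_form_model orth_sum_model[OF t_form_model] assms by (rule witt_simplifies_if_anti_embeds)

end

section \<open>Transport to coordinates\<close>

text \<open>\<psi> is linear on the whole type but bijective only on X: coordinate vectors will be
  total functions, of which those supported on a basis form X.\<close>

locale coordinates = vector_space scale
  for scale :: "'f::field \<Rightarrow> 'b::ab_group_add \<Rightarrow> 'b" (infixr "*s" 75) +
  fixes \<sigma> and V :: "('f, 'v) form_space" and \<psi> :: "'b \<Rightarrow> 'v" and X :: "'b set"
  assumes involution: "field_involution \<sigma>" and hermitian: "hermitian \<sigma> V" and nd: "nondegenerate V"
    and \<psi>_closed: "\<psi> x \<in> carrier V"
    and \<psi>_add: "\<psi> (x + y) = \<psi> x \<oplus>\<^bsub>V\<^esub> \<psi> y" and \<psi>_scale: "\<psi> (a *s x) = a \<odot>\<^bsub>V\<^esub> \<psi> x"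
    and bij: "bij_betw \<psi> X (carrier V)" and finite_span: "\<exists>B. finite B \<and> X = span B"
begin

lemma space: "vectorspace class_ring V"
  and form_add: "h \<in> carrier V \<Longrightarrow> g \<in> carrier V \<Longrightarrow> k \<in> carrier V \<Longrightarrow> form V (h \<oplus>\<^bsub>V\<^esub> g) k = form V h k + form V g k"
  and form_smult: "h \<in> carrier V \<Longrightarrow> k \<in> carrier V \<Longrightarrow> form V (a \<odot>\<^bsub>V\<^esub> h) k = \<sigma> a * form V h k"
  and form_swap: "h \<in> carrier V \<Longrightarrow> k \<in> carrier V \<Longrightarrow> form V k h = \<sigma> (form V h k)"
  using hermitian unfolding hermitian_def by blast+

sublocale hermitian_space scale \<sigma> "\<lambda>x y. form V (\<psi> x) (\<psi> y)"
  by unfold_locales (simp_all add: involution \<psi>_add \<psi>_scale form_add form_smult \<psi>_closed form_swap[OF \<psi>_closed \<psi>_closed, symmetric])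

lemma X: "fin_sp X" using finite_span by (simp add: fin_sp_def)

lemma X_subspace: "subspace X" using X by (rule fin_sp_subspace)

lemma carrier_image: "carrier V = \<psi> ` X" and \<psi>_inj: "x \<in> X \<Longrightarrow> y \<in> X \<Longrightarrow> \<psi> x = \<psi> y \<longleftrightarrow> x = y"
  using bij by (auto simp: bij_betw_def inj_on_def)

lemma \<psi>_zero: "\<zero>\<^bsub>V\<^esub> = \<psi> 0"
proof -
  interpret V: vectorspace class_ring V by (rule space)
  show ?thesis using V.lmult_0[OF \<psi>_closed[of 0]] \<psi>_scale[of 0 0] by simp
qed

lemma model: "form_model scale X (\<lambda>x y. form V (\<psi> x) (\<psi> y)) \<psi> V"
  using bij by unfold_locales (auto simp: X_subspace carrier_image bij_betw_def \<psi>_zero \<psi>_add \<psi>_scale)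

lemma X_nondeg: "nondeg X" unfolding nondeg_def
proof (intro ballI impI)
  fix x assume x: "x \<in> X" "\<forall>y\<in>X. form V (\<psi> y) (\<psi> x) = 0"
  have "form V (\<psi> x) h = 0" if h: "h \<in> carrier V" for h
  proof -
    obtain y where "y \<in> X" "h = \<psi> y" using h carrier_image by auto
    then show ?thesis using x(2) q_swap[of "x" "y"] by simp
  qed
  then have "\<psi> x = \<psi> 0" using nd \<psi>_closed \<psi>_zero by (auto simp: nondegenerate_def)
  then show "x = 0" using \<psi>_inj[OF x(1) subspace_0[OF X_subspace]] by simp
qed

text \<open>As \<psi> is defined everywhere, lift is linear on the whole type with values in X, as
  \<open>selfadjoint_operator\<close> requires.\<close>

definition lift :: "('v \<Rightarrow> 'v) \<Rightarrow> 'b \<Rightarrow> 'b" where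
  "lift t x = inv_into X \<psi> (t (\<psi> x))"

context
  fixes t assumes t: "selfadjoint V t"
begin

lemma closed: "h \<in> carrier V \<Longrightarrow> t h \<in> carrier V"
  and t_add: "h \<in> carrier V \<Longrightarrow> g \<in> carrier V \<Longrightarrow> t (h \<oplus>\<^bsub>V\<^esub> g) = t h \<oplus>\<^bsub>V\<^esub> t g"
  and t_smult: "h \<in> carrier V \<Longrightarrow> t (a \<odot>\<^bsub>V\<^esub> h) = a \<odot>\<^bsub>V\<^esub> t h"
  using t by (auto simp: selfadjoint_def LinearCombinations.module_hom_def)

lemma lift_X: "lift t x \<in> X" and \<psi>_lift: "\<psi> (lift t x) = t (\<psi> x)"
  using closed[OF \<psi>_closed[of x]] unfolding lift_def carrier_image
  by (auto intro: inv_into_into f_inv_into_f)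

lemma lift_add: "lift t (x + y) = lift t x + lift t y"
proof -
  have "\<psi> (lift t (x + y)) = \<psi> (lift t x + lift t y)"
    by (simp add: \<psi>_lift \<psi>_add t_add \<psi>_closed)
  then show ?thesis using \<psi>_inj[OF lift_X subspace_add[OF X_subspace lift_X lift_X]] by simp
qed

lemma lift_scale: "lift t (a *s x) = a *s lift t x"
proof -
  have "\<psi> (lift t (a *s x)) = \<psi> (a *s lift t x)"
    by (simp add: \<psi>_lift \<psi>_scale t_smult \<psi>_closed)
  then show ?thesis using \<psi>_inj[OF lift_X subspace_scale[OF X_subspace lift_X]] by simp
qed

lemma lift_selfadjoint: "form V (\<psi> (lift t x)) (\<psi> y) = form V (\<psi> x) (\<psi> (lift t y))"
  using t \<psi>_closed by (simp add: \<psi>_lift selfadjoint_def)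

lemma lift_operator: "selfadjoint_operator scale \<sigma> (\<lambda>x y. form V (\<psi> x) (\<psi> y)) (lift t)"
  by unfold_locales (rule lift_add lift_scale lift_selfadjoint)+

lemma lift_up_X: "x \<in> X \<Longrightarrow> (lift t ^^ n) x \<in> X"
  by (induction n) (auto simp: lift_X)

lemma \<psi>_lift_up: "\<psi> ((lift t ^^ n) x) = (t ^^ n) (\<psi> x)"
  by (induction n) (auto simp: \<psi>_lift)

lemma lift_zero: "x \<in> X \<Longrightarrow> (t ^^ n) (\<psi> x) = \<zero>\<^bsub>V\<^esub> \<Longrightarrow> (lift t ^^ n) x = 0"
  using \<psi>_inj[OF lift_up_X[of x n] subspace_0[OF X_subspace]] by (simp add: \<psi>_lift_up \<psi>_zero)

end

lemma selfadjoint_transport: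
  assumes "\<And>x. x \<in> X \<Longrightarrow> v x \<in> X" "\<And>x y. x \<in> X \<Longrightarrow> y \<in> X \<Longrightarrow> v (x + y) = v x + v y"
    "\<And>a x. x \<in> X \<Longrightarrow> v (a *s x) = a *s v x"
    "\<And>x y. x \<in> X \<Longrightarrow> y \<in> X \<Longrightarrow> form V (\<psi> (v x)) (\<psi> y) = form V (\<psi> x) (\<psi> (v y))"
    "\<And>x. x \<in> X \<Longrightarrow> v (v x) = 0"
  shows "\<And>x. x \<in> X \<Longrightarrow> \<psi> (v (inv_into X \<psi> (\<psi> x))) = \<psi> (v x)"
    "selfadjoint V (\<lambda>h. \<psi> (v (inv_into X \<psi> h)))" "square_zero_on V (\<lambda>h. \<psi> (v (inv_into X \<psi> h)))"
proof -
  have i: "inv_into X \<psi> (\<psi> x) = x" if "x \<in> X" for x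
    using that bij by (simp add: bij_betw_def inv_into_f_f)
  show "\<psi> (v (inv_into X \<psi> (\<psi> x))) = \<psi> (v x)" if "x \<in> X" for x using i[OF that] by simp
  have "inv_into X \<psi> (\<psi> x \<oplus>\<^bsub>V\<^esub> \<psi> y) = x + y" if "x \<in> X" "y \<in> X" for x y
    using i[OF subspace_add[OF X_subspace that]] by (simp add: \<psi>_add)
  moreover have "inv_into X \<psi> (a \<odot>\<^bsub>V\<^esub> \<psi> x) = a *s x" if "x \<in> X" for a x
    using i[OF subspace_scale[OF X_subspace that]] by (simp add: \<psi>_scale)
  ultimately show "selfadjoint V (\<lambda>h. \<psi> (v (inv_into X \<psi> h)))"
    using assms(2-4) unfolding selfadjoint_def LinearCombinations.module_hom_def carrier_image
    by (auto simp: i assms(1) \<psi>_add \<psi>_scale)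
  show "square_zero_on V (\<lambda>h. \<psi> (v (inv_into X \<psi> h)))"
    using assms(1,5) by (auto simp: square_zero_on_def carrier_image i \<psi>_zero)
qed

theorem sum_of_square_zero_iff:
  assumes u: "selfadjoint V u" "nilpotent_on V u"
  shows "(\<exists>v w. selfadjoint V v \<and> square_zero_on V v \<and> selfadjoint V w \<and> square_zero_on V w \<and>
                (\<forall>x\<in>carrier V. u x = v x \<oplus>\<^bsub>V\<^esub> w x))
     \<longleftrightarrow>
     (\<forall>k. witt_simplifies (t_form V u (2 * k + 1)) (orth_sum {i. i > k} (\<lambda>i. t_form V u (2 * i + 1))))"
    (is "?split \<longleftrightarrow> ?simplifies")
proof -
  interpret U: selfadjoint_operator scale \<sigma> "\<lambda>x y. form V (\<psi> x) (\<psi> y)" "lift u"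
    using u(1) by (rule lift_operator)
  obtain K where "\<forall>x\<in>carrier V. (u ^^ K) x = \<zero>\<^bsub>V\<^esub>" using u(2) unfolding nilpotent_on_def by blast
  then have nil: "(lift u ^^ K) x = 0" if "x \<in> X" for x using lift_zero[OF u(1) that] \<psi>_closed by blast
  obtain E where NF: "U.normal_form X E" using U.normal_form_exists[OF X X_nondeg lift_X[OF u(1)] nil] ..
  interpret U: nilpotent_form scale \<sigma> "\<lambda>x y. form V (\<psi> x) (\<psi> y)" "lift u" X E K
    by unfold_locales (rule X X_nondeg lift_X[OF u(1)] nil NF | assumption)+
  interpret V: form_model scale X "\<lambda>x y. form V (\<psi> x) (\<psi> y)" \<psi> V by (rule model)
  interpret U: carried_form scale \<sigma> "\<lambda>x y. form V (\<psi> x) (\<psi> y)" "lift u" X E K \<psi> V u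
    by unfold_locales (simp add: \<psi>_lift[OF u(1)])
  show ?thesis
  proof
    assume ?split
    then obtain v w where v: "selfadjoint V v" "square_zero_on V v"
      and w: "selfadjoint V w" "square_zero_on V w"
      and uvw: "\<And>x. x \<in> carrier V \<Longrightarrow> u x = v x \<oplus>\<^bsub>V\<^esub> w x" by blast
    have sq: "lift t (lift t x) = 0" if "selfadjoint V t" "square_zero_on V t" "x \<in> X" for t x
      using lift_zero[OF that(1,3), of 2] that(2) \<psi>_closed by (simp add: square_zero_on_def numeral_2_eq_2 funpow.simps(2))
    have sum: "lift u x = lift v x + lift w x" for x
    proof -
      have "\<psi> (lift u x) = \<psi> (lift v x + lift w x)"
        by (simp add: \<psi>_add \<psi>_lift[OF u(1)] \<psi>_lift[OF v(1)] \<psi>_lift[OF w(1)] uvw \<psi>_closed)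
      then show ?thesis
        using \<psi>_inj[OF lift_X[OF u(1)] subspace_add[OF X_subspace lift_X[OF v(1)] lift_X[OF w(1)]]] by simp
    qed
    interpret S: split_form scale \<sigma> "\<lambda>x y. form V (\<psi> x) (\<psi> y)" "lift u" X E K "lift v" "lift w"
      by unfold_locales
        (rule lift_add[OF v(1)] lift_scale[OF v(1)] lift_selfadjoint[OF v(1)] lift_X[OF v(1)]
          lift_add[OF w(1)] lift_scale[OF w(1)] lift_selfadjoint[OF w(1)] lift_X[OF w(1)]
          sq[OF v] sq[OF w] sum | assumption)+
    show ?simplifies using U.t_form_witt_simplifies_if_anti_embeds S.anti_embeds_if_reduction by blast
  next
    assume ?simplifies
    then have "U.splits X" using U.anti_embeds_if_t_form_witt_simplifies by (intro U.splits_if_anti_embeds) blast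
    then obtain v where v: "\<And>x. x \<in> X \<Longrightarrow> v x \<in> X"
      "\<And>x y. x \<in> X \<Longrightarrow> y \<in> X \<Longrightarrow> v (x + y) = v x + v y"
      "\<And>a x. x \<in> X \<Longrightarrow> v (a *s x) = a *s v x"
      "\<And>x y. x \<in> X \<Longrightarrow> y \<in> X \<Longrightarrow> form V (\<psi> (v x)) (\<psi> y) = form V (\<psi> x) (\<psi> (v y))"
      "\<And>x. x \<in> X \<Longrightarrow> v (v x) = 0"
      and vu: "\<And>x. x \<in> X \<Longrightarrow> v (lift u x) = lift u (lift u x) - lift u (v x)"
      using U.splitting_operator[OF _ X_nondeg] by blast
    \<comment> \<open>The square of w is u^2 - u v - v u + v^2, which is zero by \<open>vu\<close>
      and v^2 = 0.\<close>
    define w where "w x = lift u x - v x" for x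
    have v_diff: "v (x - y) = v x - v y" if "x \<in> X" "y \<in> X" for x y
      using v(2)[OF that(1) subspace_neg[OF X_subspace that(2)]] v(3)[OF that(2), of "- 1"] by simp
    have \<psi>_diff: "form V (\<psi> (x - y)) h = form V (\<psi> x) h - form V (\<psi> y) h"
      "form V h (\<psi> (x - y)) = form V h (\<psi> x) - form V h (\<psi> y)" if "h \<in> \<psi> ` X" for x y h
      using that q_diff_left q_diff_right by auto
    have w: "\<And>x. x \<in> X \<Longrightarrow> w x \<in> X"
      "\<And>x y. x \<in> X \<Longrightarrow> y \<in> X \<Longrightarrow> w (x + y) = w x + w y"
      "\<And>a x. x \<in> X \<Longrightarrow> w (a *s x) = a *s w x"
      "\<And>x y. x \<in> X \<Longrightarrow> y \<in> X \<Longrightarrow> form V (\<psi> (w x)) (\<psi> y) = form V (\<psi> x) (\<psi> (w y))"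
      "\<And>x. x \<in> X \<Longrightarrow> w (w x) = 0"
    proof -
      show "w x \<in> X" if "x \<in> X" for x using lift_X[OF u(1)] v(1) that X_subspace by (simp add: w_def subspace_diff)
      show "w (w x) = 0" if "x \<in> X" for x
        using that lift_X[OF u(1)] v(1) by (simp add: w_def v_diff vu v(5) U.u_diff)
    qed (simp_all add: w_def v(2-4) U.u_add U.u_scale \<psi>_diff lift_selfadjoint[OF u(1)] algebra_simps scale_right_diff_distrib)
    note V = selfadjoint_transport[OF v] and W = selfadjoint_transport[OF w]
    have "u h = \<psi> (v (inv_into X \<psi> h)) \<oplus>\<^bsub>V\<^esub> \<psi> (w (inv_into X \<psi> h))" if h: "h \<in> carrier V" for h
    proof -
      obtain x where x: "x \<in> X" "h = \<psi> x" using h carrier_image by auto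
      have "u h = \<psi> (v x + w x)" by (simp add: x w_def \<psi>_lift[OF u(1)])
      then show ?thesis by (simp add: \<psi>_add x V(1) W(1))
    qed
    then show ?split
      by (intro exI[of _ "\<lambda>h. \<psi> (v (inv_into X \<psi> h))"] exI[of _ "\<lambda>h. \<psi> (w (inv_into X \<psi> h))"]
        conjI ballI V(2,3) W(2,3))
  qed
qed

end

theorem theorem6p5:
  fixes \<sigma> :: "'f::field \<Rightarrow> 'f"
    and V :: "('f, 'v) form_space"
    and u :: "'v \<Rightarrow> 'v"
  assumes "field_involution \<sigma>"
    and "hermitian \<sigma> V"
    and "vectorspace.fin_dim class_ring V"
    and "nondegenerate V"
    and "selfadjoint V u"
    and "nilpotent_on V u"
  shows "(\<exists>v w. selfadjoint V v \<and> square_zero_on V v \<and>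
                selfadjoint V w \<and> square_zero_on V w \<and>
                (\<forall>x\<in>carrier V. u x = v x \<oplus>\<^bsub>V\<^esub> w x))
     \<longleftrightarrow>
     (\<forall>k. witt_simplifies (t_form V u (2 * k + 1))
            (orth_sum {i. i > k} (\<lambda>i. t_form V u (2 * i + 1))))"
proof -
  interpret V: vectorspace class_ring V using assms(2) unfolding hermitian_def by blast
  obtain B where B: "finite B" "V.basis B" using V.finite_basis_exists[OF assms(3)] by blast
  have BV: "B \<subseteq> carrier V" and li: "V.lin_indpt B" and sp: "V.span B = carrier V"
    using B(2) by (auto simp: V.basis_def)
  \<comment> \<open>Coordinates live in the full function type with pointwise operations. \<psi>
    reads only the values on B, and X consists of the functions that vanish off B.\<close>
  define scale :: "'f \<Rightarrow> ('v \<Rightarrow> 'f) \<Rightarrow> 'v \<Rightarrow> 'f" where "scale a f = (\<lambda>x. a * f x)" for a f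
  define \<psi> where "\<psi> f = V.lincomb f B" for f
  define X where "X = {f :: 'v \<Rightarrow> 'f. \<forall>v. v \<notin> B \<longrightarrow> f v = 0}"
  interpret C: vector_space scale
    by unfold_locales (auto simp: scale_def fun_eq_iff algebra_simps)
  have closed: "\<psi> f \<in> carrier V" for f using BV by (auto simp: \<psi>_def)
  have add: "\<psi> (f + g) = \<psi> f \<oplus>\<^bsub>V\<^esub> \<psi> g" for f g
    using V.lincomb_sum[OF B(1) BV, of f g] by (simp add: \<psi>_def plus_fun_def)
  have smult: "\<psi> (scale a f) = a \<odot>\<^bsub>V\<^esub> \<psi> f" for a f
    using V.lincomb_smult[OF BV, of f a] by (simp add: \<psi>_def scale_def)
  have cong: "\<psi> f = \<psi> g" if "\<And>v. v \<in> B \<Longrightarrow> f v = g v" for f g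
    unfolding \<psi>_def V.lincomb_def using that BV by (intro V.M.finsum_cong') auto
  have bij: "bij_betw \<psi> X (carrier V)"
  proof (intro bij_betw_imageI inj_onI)
    fix f g assume fg: "f \<in> X" "g \<in> X" "\<psi> f = \<psi> g"
    have zero: "\<psi> (scale 0 g) = \<zero>\<^bsub>V\<^esub>" using smult[of 0 g] V.lmult_0[OF closed] by simp
    have "\<psi> (f + scale (- 1) g) = \<psi> (g + scale (- 1) g)" by (simp only: add fg(3))
    also have "g + scale (- 1) g = scale 0 g" by (simp add: scale_def fun_eq_iff)
    finally have "V.lincomb (f + scale (- 1) g) B = \<zero>\<^bsub>V\<^esub>" using zero by (simp only: \<psi>_def)
    then have "(f + scale (- 1) g) v = 0" if "v \<in> B" for v
      using V.not_lindepD[OF li B(1) subset_refl, of "f + scale (- 1) g"] that by auto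
    then have "f v = g v" if "v \<in> B" for v using that by (simp add: scale_def)
    moreover have "f v = g v" if "v \<notin> B" for v using that fg by (simp add: X_def)
    ultimately show "f = g" by (auto simp: fun_eq_iff)
  next
    show "\<psi> ` X = carrier V"
    proof (intro equalityI subsetI)
      fix h assume "h \<in> carrier V"
      then obtain f where "h = \<psi> f" using V.finite_span[OF B(1) BV] sp by (auto simp: \<psi>_def)
      also have "\<dots> = \<psi> (\<lambda>v. if v \<in> B then f v else 0)" by (rule cong) simp
      finally show "h \<in> \<psi> ` X" by (auto simp: X_def)
    qed (use closed in auto)
  qed
  have "X = C.span ((\<lambda>b v. of_bool (v = b)) ` B)"
  proof (intro equalityI subsetI)
    fix f assume f: "f \<in> X"
    have "(\<Sum>b\<in>C. scale (f b) (\<lambda>v. of_bool (v = b))) v = (if v \<in> C then f v else 0)"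
      if "finite C" for C v using that
      by (induction C rule: finite_induct) (auto simp: scale_def)
    then have "f = (\<Sum>b\<in>B. scale (f b) (\<lambda>v. of_bool (v = b)))" using f B(1) by (auto simp: fun_eq_iff X_def)
    also have "\<dots> \<in> C.span ((\<lambda>b v. of_bool (v = b)) ` B)"
      by (intro C.span_sum C.span_scale C.span_base imageI)
    finally show "f \<in> C.span ((\<lambda>b v. of_bool (v = b)) ` B)" .
  next
    fix f assume "f \<in> C.span ((\<lambda>b v. of_bool (v = b)) ` B)"
    then show "f \<in> X" by (induction rule: C.span_induct_alt) (auto simp: X_def scale_def)
  qed
  then have "\<exists>B'. finite B' \<and> X = C.span B'" using B(1) by blast
  then interpret coordinates scale \<sigma> V \<psi> X
    using assms(1,2,4) closed add smult bij by unfold_locales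
  show ?thesis using assms(5,6) by (rule sum_of_square_zero_iff)
qed

end
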